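(* Let $\Gamma$ be a finite simplicial graph with non-empty vertex set $V(\Gamma)$, let $\{G_v\mid v\in V(\Gamma)\}$ be a collection of non-trivial directly indecomposable groups such that the center of each $G_v$ is non-trivial, and let $G_\Gamma$ be the associated graph product. The following statements are equivalent: (i) The graph product $G_\Gamma$ is complete. (ii) All vertex groups $G_v$ are isomorphic to $\mathbb{Z}/2\mathbb{Z}$; $\Gamma$ has no separating star; $\Gamma$ is asymmetric; for any pair of vertices $v,w\in V(\Gamma)$ with $v\neq w$, $st(v)$ is not a subset of $st(w)$; and $\Gamma$ is connected and contains at least $7$ vertices.
   Context: Graphs are finite, without loops and multiple edges. For a graph $\Gamma$ with vertex set $V(\Gamma)$ and edge set $E(\Gamma)$ (a set of 2-element subsets of $V(\Gamma)$), and non-trivial groups $G_v$ ($v\in V(\Gamma)$), the graph product $G_\Gamma$ is the quotient of the free product $\ast_{v\in V(\Gamma)} G_v$ by the normal closure of all commutators $[g,h]$ with $g\in G_v$, $h\in G_w$, $\{v,w\}\in E(\Gamma)$. A group is directly indecomposable if it is not isomorphic to a direct product of two non-trivial groups. A group $G$ is called complete if its center $Z(G)$ is trivial and $\mathrm{Aut}(G)=\mathrm{Inn}(G)$. For $v\in V(\Gamma)$, the star of $v$ is $st(v)=\{v\}\cup\{w\in V(\Gamma)\mid \{v,w\}\in E(\Gamma)\}$. A graph $\Gamma$ has a separating star if there is a vertex $v\in V(\Gamma)$ such that the subgraph spanned by $V(\Gamma)-st(v)$ is disconnected, i.e. there are two vertices of $V(\Gamma)-st(v)$ not joined by a path in this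 induced subgraph (in particular, the empty graph is not disconnected). A graph automorphism of $\Gamma$ is a bijection $f\colon V(\Gamma)\to V(\Gamma)$ such that $\{f(v),f(w)\}\in E(\Gamma)$ if and only if $\{v,w\}\in E(\Gamma)$. A graph is asymmetric if its only graph automorphism is the identity. *)

theory Defs
  imports "HOL-Algebra.Algebra"
begin

section \<open>Groups\<close>

definition center :: "('a, 'b) monoid_scheme \<Rightarrow> 'a set" where
  "center G = {z \<in> carrier G. \<forall>g \<in> carrier G. z \<otimes>\<^bsub>G\<^esub> g = g \<otimes>\<^bsub>G\<^esub> z}"

(* Restricted to the carrier, because the elements of auto G are extensional functions. *)
definition inner_auto :: "('a, 'b) monoid_scheme \<Rightarrow> ('a \<Rightarrow> 'a) set" where
  "inner_auto G =
     {\<lambda>x \<in> carrier G. g \<otimes>\<^bsub>G\<^esub> x \<otimes>\<^bsub>G\<^esub> inv\<^bsub>G\<^esub> g | g. g \<in> carrier G}"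

definition complete_group :: "('a, 'b) monoid_scheme \<Rightarrow> bool" where
  "complete_group G \<longleftrightarrow> group G \<and> center G = {\<one>\<^bsub>G\<^esub>} \<and> auto G = inner_auto G"

(* Letting H and K range over groups with elements in 'a is no restriction: if G is isomorphic
   to a direct product, both factors embed into G and so have isomorphic copies of this type. *)
definition directly_indecomposable :: "('a, 'b) monoid_scheme \<Rightarrow> bool" where
  "directly_indecomposable G \<longleftrightarrow>
     group G \<and>
     (\<nexists>(H :: 'a monoid) (K :: 'a monoid).
        group H \<and> group K \<and> \<not> trivial_group H \<and> \<not> trivial_group K \<and> G \<cong> H \<times>\<times> K)"

definition normal_closure :: "('a, 'b) monoid_scheme \<Rightarrow> 'a set \<Rightarrow> 'a set" where
  "normal_closure G S = \<Inter>{N. N \<lhd> G \<and> S \<subseteq> N}"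

definition commutator :: "('a, 'b) monoid_scheme \<Rightarrow> 'a \<Rightarrow> 'a \<Rightarrow> 'a" where
  "commutator G x y = x \<otimes>\<^bsub>G\<^esub> y \<otimes>\<^bsub>G\<^esub> inv\<^bsub>G\<^esub> x \<otimes>\<^bsub>G\<^esub> inv\<^bsub>G\<^esub> y"


section \<open>Free products\<close>

text \<open>
  The free product of the groups G v, for v in V, is the monoid of words in the disjoint union
  of the carriers, modulo the least congruence that deletes identity letters and multiplies
  adjacent letters from the same group.
\<close>

definition words :: "'v set \<Rightarrow> ('v \<Rightarrow> ('a, 'b) monoid_scheme) \<Rightarrow> ('v \<times> 'a) list set" where
  "words V G = lists (SIGMA v:V. carrier (G v))"

inductive_set word_rel ::
    "'v set \<Rightarrow> ('v \<Rightarrow> ('a, 'b) monoid_scheme) \<Rightarrow> (('v \<times> 'a) list \<times> ('v \<times> 'a) list) set"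
  for V :: "'v set" and G :: "'v \<Rightarrow> ('a, 'b) monoid_scheme" where
  one: "\<lbrakk>v \<in> V; us \<in> words V G; ws \<in> words V G\<rbrakk>
     \<Longrightarrow> (us @ [(v, \<one>\<^bsub>G v\<^esub>)] @ ws, us @ ws) \<in> word_rel V G"
| mult: "\<lbrakk>v \<in> V; g \<in> carrier (G v); h \<in> carrier (G v); us \<in> words V G; ws \<in> words V G\<rbrakk>
     \<Longrightarrow> (us @ [(v, g), (v, h)] @ ws, us @ [(v, g \<otimes>\<^bsub>G v\<^esub> h)] @ ws) \<in> word_rel V G"
| refl: "us \<in> words V G \<Longrightarrow> (us, us) \<in> word_rel V G"
| sym: "(us, ws) \<in> word_rel V G \<Longrightarrow> (ws, us) \<in> word_rel V G"
| trans: "\<lbrakk>(us, ws) \<in> word_rel V G; (ws, xs) \<in> word_rel V G\<rbrakk> \<Longrightarrow> (us, xs) \<in> word_rel V G"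

definition free_product ::
    "'v set \<Rightarrow> ('v \<Rightarrow> ('a, 'b) monoid_scheme) \<Rightarrow> ('v \<times> 'a) list set monoid" where
  "free_product V G =
     \<lparr>carrier = words V G // word_rel V G,
      monoid.mult = (\<lambda>A B. \<Union>us \<in> A. \<Union>ws \<in> B. word_rel V G `` {us @ ws}),
      one = word_rel V G `` {[]}\<rparr>"

definition free_product_incl ::
    "'v set \<Rightarrow> ('v \<Rightarrow> ('a, 'b) monoid_scheme) \<Rightarrow> 'v \<Rightarrow> 'a \<Rightarrow> ('v \<times> 'a) list set" where
  "free_product_incl V G v g = word_rel V G `` {[(v, g)]}"


section \<open>Graphs\<close>

definition finite_simple_graph :: "'v set \<Rightarrow> 'v set set \<Rightarrow> bool" where
  "finite_simple_graph V E \<longleftrightarrow> finite V \<and> E \<subseteq> {e. e \<subseteq> V \<and> card e = 2}"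

definition star :: "'v set \<Rightarrow> 'v set set \<Rightarrow> 'v \<Rightarrow> 'v set" where
  "star V E v = {v} \<union> {w \<in> V. {v, w} \<in> E}"

(* Connectedness of the subgraph spanned by U; the empty graph counts as connected. *)
definition induced_connected :: "'v set set \<Rightarrow> 'v set \<Rightarrow> bool" where
  "induced_connected E U \<longleftrightarrow>
     (\<forall>x \<in> U. \<forall>y \<in> U. (x, y) \<in> {(a, b). a \<in> U \<and> b \<in> U \<and> {a, b} \<in> E}\<^sup>*)"

definition has_separating_star :: "'v set \<Rightarrow> 'v set set \<Rightarrow> bool" where
  "has_separating_star V E \<longleftrightarrow> (\<exists>v \<in> V. \<not> induced_connected E (V - star V E v))"

definition graph_automorphism :: "'v set \<Rightarrow> 'v set set \<Rightarrow> ('v \<Rightarrow> 'v) \<Rightarrow> bool" where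
  "graph_automorphism V E f \<longleftrightarrow>
     bij_betw f V V \<and> (\<forall>v \<in> V. \<forall>w \<in> V. {f v, f w} \<in> E \<longleftrightarrow> {v, w} \<in> E)"

definition asymmetric_graph :: "'v set \<Rightarrow> 'v set set \<Rightarrow> bool" where
  "asymmetric_graph V E \<longleftrightarrow> (\<forall>f. graph_automorphism V E f \<longrightarrow> (\<forall>v \<in> V. f v = v))"


section \<open>Graph products\<close>

definition graph_product_relators ::
    "'v set \<Rightarrow> 'v set set \<Rightarrow> ('v \<Rightarrow> ('a, 'b) monoid_scheme) \<Rightarrow> ('v \<times> 'a) list set set" where
  "graph_product_relators V E G =
     {commutator (free_product V G) (free_product_incl V G v g) (free_product_incl V G w h)
       | v w g h. v \<in> V \<and> w \<in> V \<and> {v, w} \<in> E \<and> g \<in> carrier (G v) \<and> h \<in> carrier (G w)}"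

definition graph_product ::
    "'v set \<Rightarrow> 'v set set \<Rightarrow> ('v \<Rightarrow> ('a, 'b) monoid_scheme) \<Rightarrow> ('v \<times> 'a) list set set monoid" where
  "graph_product V E G =
     free_product V G Mod normal_closure (free_product V G) (graph_product_relators V E G)"

end

theory Submission
  imports Defs
begin

text \<open>
  If the graph product is complete, an automorphism of a vertex group \<open>G v\<close> extends to one that
  fixes the other vertex groups, hence to conjugation by some \<open>g\<close>. As \<open>g\<close> centralises \<open>G w\<close> for some
  \<open>w\<close> not adjacent to \<open>v\<close>, its image in \<open>G v\<close> is trivial. So \<open>G v\<close> has no non-trivial automorphism,
  which leaves only the group of order 2. Transvections, partial conjugations and graph automorphisms
  are then told apart from inner automorphisms by the parities with which generators occur.

  Conversely, suppose that the graph product is a right-angled Coxeter group \<open>W\<close>. If no star is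
  contained in another one, the conjugates of generators are precisely the involutions \<open>t\<close> whose
  double centraliser is \<open>{1, t}\<close>, so an automorphism maps generators to reflections. Since no star
  separates, the walls disjoint from the image \<open>r v\<close> of a generator \<open>v\<close> lie on one side of its wall. The
  intersection of these half-spaces is non-empty, and a ping-pong argument shows that it consists of
  one chamber \<open>c\<close>. The walls of \<open>c\<close> are therefore those of the \<open>r v\<close>, so the automorphism is
  conjugation by \<open>c\<close> followed by a graph automorphism, which is trivial by asymmetry.
\<close>

section \<open>The universal property of graph products\<close>

text \<open>Chambers are the elements of \<open>W\<close>, and \<open>t \<in> inversions x\<close>
  says that the wall of the reflection \<open>t\<close> separates \<open>x\<close> from
  \<open>1\<close>; statements about half-spaces are phrased with this predicate. No linear
  representation is set up: parities, inversions and dihedral groups come from letting the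
  generators act as involutive permutations on \<open>bool\<close>, on sets of group elements and on
  the integers, where only the commutation of adjacent generators has to be checked. The vertex
  \<open>w\<close> exists because of the centres: if \<open>v\<close> were adjacent to all other
  vertices, the centre of \<open>G v\<close> would be central in the graph product. Connectedness
  and the number 7 come from the graph alone: a graph with fewer than seven vertices that meets the
  star conditions, and in which no star is everything, has a non-trivial automorphism.\<close>

definition word_prod :: "('c, 'd) monoid_scheme \<Rightarrow> ('v \<Rightarrow> 'a \<Rightarrow> 'c) \<Rightarrow> ('v \<times> 'a) list \<Rightarrow> 'c" where
  "word_prod H f us = foldr (\<lambda>(v, g) acc. f v g \<otimes>\<^bsub>H\<^esub> acc) us \<one>\<^bsub>H\<^esub>"

lemma word_prod_simps [simp]:
  "word_prod H f [] = \<one>\<^bsub>H\<^esub>"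
  "word_prod H f ((v, g) # us) = f v g \<otimes>\<^bsub>H\<^esub> word_prod H f us"
  by (simp_all add: word_prod_def)

section \<open>Free products and their universal property\<close>

locale group_family =
  fixes V :: "'v set" and G :: "'v \<Rightarrow> ('a, 'b) monoid_scheme"
  assumes group_G: "v \<in> V \<Longrightarrow> group (G v)"
begin

lemma words_simps [simp]:
  "[] \<in> words V G"
  "(p # us) \<in> words V G \<longleftrightarrow> fst p \<in> V \<and> snd p \<in> carrier (G (fst p)) \<and> us \<in> words V G"
  "us @ ws \<in> words V G \<longleftrightarrow> us \<in> words V G \<and> ws \<in> words V G"
  by (auto simp: words_def) (metis SigmaI prod.collapse)

lemma one_mult_G [simp]:
  "v \<in> V \<Longrightarrow> \<one>\<^bsub>G v\<^esub> \<in> carrier (G v)"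
  "v \<in> V \<Longrightarrow> g \<in> carrier (G v) \<Longrightarrow> h \<in> carrier (G v) \<Longrightarrow> g \<otimes>\<^bsub>G v\<^esub> h \<in> carrier (G v)"
  "v \<in> V \<Longrightarrow> g \<in> carrier (G v) \<Longrightarrow> inv\<^bsub>G v\<^esub> g \<in> carrier (G v)"
  using group.is_monoid[OF group_G] group.inv_closed[OF group_G] by (auto simp: monoid.m_closed)

lemma word_rel_words: "(us, ws) \<in> word_rel V G \<Longrightarrow> us \<in> words V G \<and> ws \<in> words V G"
  by (induction rule: word_rel.induct) auto

lemma word_rel_append_left:
  "(us, ws) \<in> word_rel V G \<Longrightarrow> xs \<in> words V G \<Longrightarrow> (xs @ us, xs @ ws) \<in> word_rel V G"
proof (induction rule: word_rel.induct)
  case (one v us ws)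
  then show ?case using word_rel.one[of v V "xs @ us" G ws] by simp
next
  case (mult v g h us ws)
  then show ?case using word_rel.mult[of v V g G h "xs @ us" ws] by simp
next
  case (refl us)
  then show ?case by (intro word_rel.refl) simp
qed (blast intro: word_rel.sym word_rel.trans)+

lemma word_rel_append_right:
  "(us, ws) \<in> word_rel V G \<Longrightarrow> xs \<in> words V G \<Longrightarrow> (us @ xs, ws @ xs) \<in> word_rel V G"
proof (induction rule: word_rel.induct)
  case (one v us ws)
  then show ?case using word_rel.one[of v V us G "ws @ xs"] by simp
next
  case (mult v g h us ws)
  then show ?case using word_rel.mult[of v V g G h us "ws @ xs"] by simp
next
  case (refl us)
  then show ?case by (intro word_rel.refl) simp
qed (blast intro: word_rel.sym word_rel.trans)+

lemma word_rel_append: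
  "(us, us') \<in> word_rel V G \<Longrightarrow> (ws, ws') \<in> word_rel V G \<Longrightarrow> (us @ ws, us' @ ws') \<in> word_rel V G"
  by (meson word_rel.trans word_rel_append_left word_rel_append_right word_rel_words)

lemma equiv_word_rel: "equiv (words V G) (word_rel V G)"
  by (intro equivI refl_onI symI transI)
     (auto dest: word_rel_words intro: word_rel.intros(3-5))

abbreviation word_class :: "('v \<times> 'a) list \<Rightarrow> ('v \<times> 'a) list set" where
  "word_class us \<equiv> word_rel V G `` {us}"

lemma word_class_eq: "(us, ws) \<in> word_rel V G \<Longrightarrow> word_class us = word_class ws"
  by (rule equiv_class_eq[OF equiv_word_rel])

lemma carrier_free_product: "carrier (free_product V G) = word_class ` words V G"
  by (auto simp: free_product_def quotient_def)

lemma free_product_mult: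
  assumes "us \<in> words V G" "ws \<in> words V G"
  shows "word_class us \<otimes>\<^bsub>free_product V G\<^esub> word_class ws = word_class (us @ ws)"
proof -
  have "word_class (us' @ ws') = word_class (us @ ws)"
    if "(us, us') \<in> word_rel V G" "(ws, ws') \<in> word_rel V G" for us' ws'
    using word_class_eq[OF word_rel_append[OF that]] by simp
  then have "(\<Union>us' \<in> word_class us. \<Union>ws' \<in> word_class ws. word_class (us' @ ws')) =
      (\<Union>us' \<in> word_class us. \<Union>ws' \<in> word_class ws. word_class (us @ ws))"
    by (intro arg_cong[where f = Union] image_cong refl) auto
  moreover have "word_class us \<noteq> {}" "word_class ws \<noteq> {}"
    using assms word_rel.refl by fastforce+
  ultimately show ?thesis
    by (simp add: free_product_def)
qed

lemma free_product_one: "\<one>\<^bsub>free_product V G\<^esub> = word_class []"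
  by (simp add: free_product_def)

text \<open>Each letter is cancelled by its inverse, put at the end of the word that cancels the
  tail; a left inverse is all that \<open>groupI\<close> asks for.\<close>

lemma word_rel_cancel:
  assumes "us \<in> words V G"
  shows "\<exists>ws \<in> words V G. (ws @ us, []) \<in> word_rel V G"
  using assms
proof (induction us)
  case Nil
  then show ?case by (intro bexI[of _ "[]"]) (auto intro: word_rel.refl)
next
  case (Cons p us)
  then obtain ws where ws: "ws \<in> words V G" "(ws @ us, []) \<in> word_rel V G" by auto
  obtain v g where p: "p = (v, g)" by fastforce
  have v: "v \<in> V" "g \<in> carrier (G v)" using Cons.prems p by auto
  have "(ws @ [(v, inv\<^bsub>G v\<^esub> g), (v, g)] @ us, ws @ [(v, inv\<^bsub>G v\<^esub> g \<otimes>\<^bsub>G v\<^esub> g)] @ us) \<in> word_rel V G"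
    using v ws Cons.prems by (intro word_rel.mult) auto
  moreover have "(ws @ [(v, \<one>\<^bsub>G v\<^esub>)] @ us, ws @ us) \<in> word_rel V G"
    using v ws Cons.prems by (intro word_rel.one) auto
  moreover have "inv\<^bsub>G v\<^esub> g \<otimes>\<^bsub>G v\<^esub> g = \<one>\<^bsub>G v\<^esub>"
    using v group.l_inv[OF group_G] by blast
  ultimately have "(ws @ [(v, inv\<^bsub>G v\<^esub> g), (v, g)] @ us, []) \<in> word_rel V G"
    using ws(2) by (metis word_rel.trans)
  then show ?case
    using ws v p by (intro bexI[of _ "ws @ [(v, inv\<^bsub>G v\<^esub> g)]"]) auto
qed

lemma group_free_product: "group (free_product V G)"
proof (rule groupI)
  fix x y assume "x \<in> carrier (free_product V G)" "y \<in> carrier (free_product V G)"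
  then show "x \<otimes>\<^bsub>free_product V G\<^esub> y \<in> carrier (free_product V G)"
    by (auto simp: carrier_free_product free_product_mult)
next
  show "\<one>\<^bsub>free_product V G\<^esub> \<in> carrier (free_product V G)"
    by (auto simp: carrier_free_product free_product_one)
next
  fix x y z assume "x \<in> carrier (free_product V G)" "y \<in> carrier (free_product V G)"
    "z \<in> carrier (free_product V G)"
  then show "x \<otimes>\<^bsub>free_product V G\<^esub> y \<otimes>\<^bsub>free_product V G\<^esub> z =
      x \<otimes>\<^bsub>free_product V G\<^esub> (y \<otimes>\<^bsub>free_product V G\<^esub> z)"
    by (auto simp: carrier_free_product free_product_mult)
next
  fix x assume "x \<in> carrier (free_product V G)"
  then show "\<one>\<^bsub>free_product V G\<^esub> \<otimes>\<^bsub>free_product V G\<^esub> x = x"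
    by (auto simp: carrier_free_product free_product_mult free_product_one)
next
  fix x assume "x \<in> carrier (free_product V G)"
  then obtain us where us: "us \<in> words V G" "x = word_class us"
    by (auto simp: carrier_free_product)
  obtain ws where ws: "ws \<in> words V G" "(ws @ us, []) \<in> word_rel V G"
    using word_rel_cancel[OF us(1)] by auto
  show "\<exists>y\<in>carrier (free_product V G). y \<otimes>\<^bsub>free_product V G\<^esub> x = \<one>\<^bsub>free_product V G\<^esub>"
    using us ws word_class_eq[OF ws(2)]
    by (intro bexI[of _ "word_class ws"]) (auto simp: carrier_free_product free_product_mult free_product_one)
qed

lemma free_product_incl_hom: "v \<in> V \<Longrightarrow> free_product_incl V G v \<in> hom (G v) (free_product V G)"
  using word_rel.mult[of v V _ G _ "[]" "[]"]
  by (auto simp: hom_def free_product_incl_def carrier_free_product free_product_mult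
           intro!: word_class_eq[symmetric])

lemma word_prod_closed:
  assumes "group H" "\<And>v. v \<in> V \<Longrightarrow> f v \<in> hom (G v) H" "us \<in> words V G"
  shows "word_prod H f us \<in> carrier H"
  using assms(3)
proof (induction us)
  case (Cons p us)
  then show ?case
    using assms(1) hom_in_carrier[OF assms(2)] by (cases p) (auto simp: group.is_monoid monoid.m_closed)
qed (use assms in \<open>auto simp: group.is_monoid monoid.one_closed\<close>)

lemma word_prod_append:
  assumes "group H" "\<And>v. v \<in> V \<Longrightarrow> f v \<in> hom (G v) H" "us \<in> words V G" "ws \<in> words V G"
  shows "word_prod H f (us @ ws) = word_prod H f us \<otimes>\<^bsub>H\<^esub> word_prod H f ws"
proof -
  interpret H: group H by fact
  have cl: "us \<in> words V G \<Longrightarrow> word_prod H f us \<in> carrier H" for us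
    by (rule word_prod_closed[OF assms(1,2)])
  show ?thesis
    using assms(3)
  proof (induction us)
    case Nil
    then show ?case using cl assms(4) by simp
  next
    case (Cons p us)
    then show ?case
      using cl assms(4) hom_in_carrier[OF assms(2)] by (cases p) (auto simp: H.m_assoc)
  qed
qed

lemma word_prod_cong:
  assumes "group H" "\<And>v. v \<in> V \<Longrightarrow> f v \<in> hom (G v) H"
    and "(us, ws) \<in> word_rel V G"
  shows "word_prod H f us = word_prod H f ws"
proof -
  interpret H: group H by fact
  note app = word_prod_append[OF assms(1,2)]
  note cl = word_prod_closed[OF assms(1,2)]
  show ?thesis
    using assms(3)
  proof (induction rule: word_rel.induct)
    case (one v us ws)
    then show ?case
      using hom_one[OF assms(2) group_G assms(1)] cl by (auto simp: app)
  next
    case (mult v g h us ws)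
    then show ?case
      using hom_in_carrier[OF assms(2)] hom_mult[OF assms(2)] cl
      by (auto simp: app H.m_assoc)
  qed auto
qed

lemma free_product_universal:
  assumes "group H" "\<And>v. v \<in> V \<Longrightarrow> f v \<in> hom (G v) H"
  obtains F where "F \<in> hom (free_product V G) H"
    and "\<And>us. us \<in> words V G \<Longrightarrow> F (word_class us) = word_prod H f us"
proof
  \<comment> \<open>\<open>word_prod\<close> is constant on each class, so its image of a class is a
    singleton.\<close>
  let ?F = "\<lambda>A. the_elem (word_prod H f ` A)"
  show *: "?F (word_class us) = word_prod H f us" if "us \<in> words V G" for us
  proof -
    have "word_prod H f ` word_class us = {word_prod H f us}"
    proof (intro equalityI subsetI)
      fix z assume "z \<in> word_prod H f ` word_class us"
      then obtain ws where "(us, ws) \<in> word_rel V G" "z = word_prod H f ws" by auto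
      then show "z \<in> {word_prod H f us}" by (metis word_prod_cong[OF assms] singletonI)
    qed (use word_rel.refl[OF that] in blast)
    then show ?thesis by simp
  qed
  show "?F \<in> hom (free_product V G) H"
    by (rule homI)
       (auto simp: carrier_free_product free_product_mult * word_prod_append[OF assms] word_prod_closed[OF assms])
qed

end

lemma normal_closure_normal:
  assumes "group F" "S \<subseteq> carrier F"
  shows "normal_closure F S \<lhd> F" "S \<subseteq> normal_closure F S"
proof -
  interpret F: group F by fact
  \<comment> \<open>This member keeps the intersection from ranging over the empty family, where it
    would be \<open>UNIV\<close>.\<close>
  have c: "carrier F \<lhd> F"
    by (simp add: F.normal_inv_iff F.subgroup_self)
  have "subgroup (normal_closure F S) F"
    unfolding normal_closure_def
  proof (rule F.subgroups_Inter)
    show "subgroup N F" if "N \<in> {N. N \<lhd> F \<and> S \<subseteq> N}" for N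
      using that by (metis mem_Collect_eq normal_imp_subgroup)
    show "{N. N \<lhd> F \<and> S \<subseteq> N} \<noteq> {}"
      using c assms(2) by blast
  qed
  moreover have "x \<otimes>\<^bsub>F\<^esub> h \<otimes>\<^bsub>F\<^esub> inv\<^bsub>F\<^esub> x \<in> normal_closure F S"
    if "x \<in> carrier F" "h \<in> normal_closure F S" for x h
    unfolding normal_closure_def
  proof (intro InterI)
    fix N assume N: "N \<in> {N. N \<lhd> F \<and> S \<subseteq> N}"
    then have "h \<in> N" "N \<lhd> F" using that(2) by (auto simp: normal_closure_def)
    then show "x \<otimes>\<^bsub>F\<^esub> h \<otimes>\<^bsub>F\<^esub> inv\<^bsub>F\<^esub> x \<in> N"
      using that(1) by (metis F.normal_inv_iff)
  qed
  ultimately show "normal_closure F S \<lhd> F"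
    by (metis F.normal_inv_iff)
  show "S \<subseteq> normal_closure F S"
    by (auto simp: normal_closure_def)
qed

section \<open>Graph products as quotients and their universal property\<close>

locale graph_of_groups = group_family V G
  for V :: "'v set" and G :: "'v \<Rightarrow> ('a, 'b) monoid_scheme" +
  fixes E :: "'v set set"
begin

abbreviation W where "W \<equiv> graph_product V E G"

abbreviation relator_closure where
  "relator_closure \<equiv> normal_closure (free_product V G) (graph_product_relators V E G)"

definition gp_word :: "('v \<times> 'a) list \<Rightarrow> ('v \<times> 'a) list set set" where
  "gp_word us = relator_closure #>\<^bsub>free_product V G\<^esub> word_class us"

definition gen :: "'v \<Rightarrow> 'a \<Rightarrow> ('v \<times> 'a) list set set" where
  "gen v g = gp_word [(v, g)]"

lemma relators_carrier: "graph_product_relators V E G \<subseteq> carrier (free_product V G)"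
proof -
  interpret F: group "free_product V G" by (rule group_free_product)
  show ?thesis
    using hom_in_carrier[OF free_product_incl_hom]
    by (force simp: graph_product_relators_def commutator_def)
qed

sublocale N: normal "relator_closure" "free_product V G"
  using normal_closure_normal[OF group_free_product relators_carrier] by simp

sublocale W: group W
  unfolding graph_product_def by (rule N.factorgroup_is_group)

lemma carrier_W: "carrier W = gp_word ` words V G"
  by (auto simp: graph_product_def carrier_FactGroup carrier_free_product gp_word_def)

lemma gp_word_hom: "(\<lambda>x. relator_closure #>\<^bsub>free_product V G\<^esub> x) \<in> hom (free_product V G) W"
  unfolding graph_product_def by (rule N.r_coset_hom_Mod)

lemma gp_word_append:
  "us \<in> words V G \<Longrightarrow> ws \<in> words V G \<Longrightarrow> gp_word (us @ ws) = gp_word us \<otimes>\<^bsub>W\<^esub> gp_word ws"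
  using hom_mult[OF gp_word_hom, of "word_class us" "word_class ws"]
  by (auto simp: gp_word_def carrier_free_product free_product_mult)

lemma gp_word_Nil: "gp_word [] = \<one>\<^bsub>W\<^esub>"
  using hom_one[OF gp_word_hom group_free_product W.is_group]
  by (simp add: gp_word_def free_product_one)

lemma gp_word_closed [simp]: "us \<in> words V G \<Longrightarrow> gp_word us \<in> carrier W"
  by (auto simp: carrier_W)

lemma gen_hom: "v \<in> V \<Longrightarrow> gen v \<in> hom (G v) W"
  using Group.hom_compose[OF free_product_incl_hom gp_word_hom]
  by (simp add: gen_def[abs_def] gp_word_def free_product_incl_def[abs_def] comp_def)

lemma gen_closed [simp]: "v \<in> V \<Longrightarrow> g \<in> carrier (G v) \<Longrightarrow> gen v g \<in> carrier W"
  by (simp add: gen_def)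

lemma gen_commute:
  assumes "v \<in> V" "w \<in> V" "{v, w} \<in> E" "g \<in> carrier (G v)" "h \<in> carrier (G w)"
  shows "gen v g \<otimes>\<^bsub>W\<^esub> gen w h = gen w h \<otimes>\<^bsub>W\<^esub> gen v g"
proof -
  let ?F = "free_product V G"
  define x y where "x = free_product_incl V G v g" and "y = free_product_incl V G w h"
  have xy: "x \<in> carrier ?F" "y \<in> carrier ?F"
    using hom_in_carrier[OF free_product_incl_hom] assms by (auto simp: x_def y_def)
  have "commutator ?F x y \<in> graph_product_relators V E G"
    unfolding graph_product_relators_def x_def y_def using assms by blast
  then have "commutator ?F x y \<in> relator_closure"
    using normal_closure_normal(2)[OF group_free_product relators_carrier] by blast
  then have "relator_closure #>\<^bsub>?F\<^esub> commutator ?F x y = \<one>\<^bsub>W\<^esub>"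
    using N.coset_join2[of "commutator ?F x y" relator_closure] N.subset N.subgroup_axioms
    by (auto simp: graph_product_def)
  moreover have "relator_closure #>\<^bsub>?F\<^esub> (commutator ?F x y \<otimes>\<^bsub>?F\<^esub> (y \<otimes>\<^bsub>?F\<^esub> x)) =
      (relator_closure #>\<^bsub>?F\<^esub> commutator ?F x y) \<otimes>\<^bsub>W\<^esub> (relator_closure #>\<^bsub>?F\<^esub> (y \<otimes>\<^bsub>?F\<^esub> x))"
    using xy by (intro hom_mult[OF gp_word_hom]) (auto simp: commutator_def)
  moreover have "commutator ?F x y \<otimes>\<^bsub>?F\<^esub> (y \<otimes>\<^bsub>?F\<^esub> x) = x \<otimes>\<^bsub>?F\<^esub> y"
    using xy by (simp add: commutator_def N.m_assoc N.inv_solve_left)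
       (metis N.inv_solve_left N.inv_closed N.m_closed N.r_inv N.r_one N.m_assoc)
  ultimately have "relator_closure #>\<^bsub>?F\<^esub> (x \<otimes>\<^bsub>?F\<^esub> y) = relator_closure #>\<^bsub>?F\<^esub> (y \<otimes>\<^bsub>?F\<^esub> x)"
    using xy hom_in_carrier[OF gp_word_hom] by auto
  then show ?thesis
    using hom_mult[OF gp_word_hom xy(1) xy(2)] hom_mult[OF gp_word_hom xy(2) xy(1)]
    by (simp add: gen_def gp_word_def x_def y_def free_product_incl_def)
qed

lemma gp_word_prod: "us \<in> words V G \<Longrightarrow> gp_word us = word_prod W gen us"
proof (induction us)
  case Nil
  then show ?case by (simp add: gp_word_Nil)
next
  case (Cons p us)
  then show ?case
    using gp_word_append[of "[p]" us] by (cases p) (simp add: gen_def)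
qed

lemma W_induct [consumes 1, case_names one mult]:
  assumes "x \<in> carrier W"
    and "P \<one>\<^bsub>W\<^esub>"
    and "\<And>v g y. v \<in> V \<Longrightarrow> g \<in> carrier (G v) \<Longrightarrow> y \<in> carrier W \<Longrightarrow> P y \<Longrightarrow> P (gen v g \<otimes>\<^bsub>W\<^esub> y)"
  shows "P x"
proof -
  obtain us where us: "us \<in> words V G" "x = word_prod W gen us"
    using assms(1) by (auto simp: carrier_W gp_word_prod)
  have "P (word_prod W gen us) \<and> word_prod W gen us \<in> carrier W"
    using us(1)
  proof (induction us)
    case (Cons p us)
    then show ?case using assms(3) by (cases p) simp
  qed (use assms(2) in auto)
  then show ?thesis using us by simp
qed

lemma universal:
  assumes H: "group H" "\<And>v. v \<in> V \<Longrightarrow> f v \<in> hom (G v) H"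
    and comm: "\<And>v w g h. v \<in> V \<Longrightarrow> w \<in> V \<Longrightarrow> {v, w} \<in> E \<Longrightarrow> g \<in> carrier (G v) \<Longrightarrow> h \<in> carrier (G w)
        \<Longrightarrow> f v g \<otimes>\<^bsub>H\<^esub> f w h = f w h \<otimes>\<^bsub>H\<^esub> f v g"
  obtains F where "F \<in> hom W H" "\<And>v g. v \<in> V \<Longrightarrow> g \<in> carrier (G v) \<Longrightarrow> F (gen v g) = f v g"
proof -
  let ?F = "free_product V G"
  interpret H: group H by fact
  obtain F where F: "F \<in> hom ?F H"
    "\<And>us. us \<in> words V G \<Longrightarrow> F (word_class us) = word_prod H f us"
    using free_product_universal[OF H] by blast
  interpret F: group_hom ?F H F
    using F(1) group_free_product H(1) by (simp add: group_hom_def group_hom_axioms_def)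
  have fcl: "f v g \<in> carrier H" if "v \<in> V" "g \<in> carrier (G v)" for v g
    using hom_in_carrier[OF H(2)] that by blast
  have Fi: "F (free_product_incl V G v g) = f v g" if "v \<in> V" "g \<in> carrier (G v)" for v g
    using that F(2)[of "[(v, g)]"] fcl by (simp add: free_product_incl_def)
  have incl: "free_product_incl V G v g \<in> carrier ?F" if "v \<in> V" "g \<in> carrier (G v)" for v g
    using hom_in_carrier[OF free_product_incl_hom] that by blast
  have "graph_product_relators V E G \<subseteq> kernel ?F H F"
    using comm fcl incl
    by (auto simp: graph_product_relators_def kernel_def commutator_def Fi H.m_assoc H.inv_solve_left)
       (metis H.inv_mult_group H.m_assoc H.r_inv H.inv_closed H.m_closed)
  then have ker: "relator_closure \<subseteq> kernel ?F H F"
    unfolding normal_closure_def using F.normal_kernel by auto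
  have 1: "F z = \<one>\<^bsub>H\<^esub>" if "z \<in> relator_closure" for z
    using ker that by (auto simp: kernel_def)
  have "\<And>x y. \<lbrakk>x \<in> carrier ?F; y \<in> carrier ?F; relator_closure #>\<^bsub>?F\<^esub> x = relator_closure #>\<^bsub>?F\<^esub> y\<rbrakk> \<Longrightarrow> F x = F y"
  proof -
    fix x y assume xy: "x \<in> carrier ?F" "y \<in> carrier ?F"
      "relator_closure #>\<^bsub>?F\<^esub> x = relator_closure #>\<^bsub>?F\<^esub> y"
    have "x \<in> relator_closure #>\<^bsub>?F\<^esub> y"
      using xy N.rcos_self N.subgroup_axioms by (metis group.rcos_self group_free_product)
    then obtain z where "z \<in> relator_closure" "x = z \<otimes>\<^bsub>?F\<^esub> y"
      by (auto simp: r_coset_def)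
    then show "F x = F y" using 1 xy N.subset by auto
  qed
  then obtain F' where F': "F' \<in> hom (?F Mod relator_closure) H"
    "\<And>x. x \<in> carrier ?F \<Longrightarrow> F' (relator_closure #>\<^bsub>?F\<^esub> x) = F x"
    using FactGroup_universal[OF F(1) N.normal_axioms] by metis
  show ?thesis
  proof
    show "F' \<in> hom W H" using F'(1) by (simp add: graph_product_def)
    show "F' (gen v g) = f v g" if "v \<in> V" "g \<in> carrier (G v)" for v g
      using that F'(2)[OF incl[OF that]] Fi[OF that]
      by (simp add: gen_def gp_word_def free_product_incl_def)
  qed
qed

lemma hom_eqI:
  assumes "group H" "F \<in> hom W H" "F' \<in> hom W H"
    and "\<And>v g. v \<in> V \<Longrightarrow> g \<in> carrier (G v) \<Longrightarrow> F (gen v g) = F' (gen v g)"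
    and "x \<in> carrier W"
  shows "F x = F' x"
  using assms(5)
proof (induction rule: W_induct)
  case one
  then show ?case using hom_one[OF _ W.is_group assms(1)] assms(2,3) by metis
next
  case (mult v g y)
  then show ?case using assms(2-4) by (simp add: hom_mult)
qed

end

locale simple_graph_of_groups = graph_of_groups V G E
  for V :: "'v set" and G :: "'v \<Rightarrow> ('a, 'b) monoid_scheme" and E :: "'v set set" +
  assumes graph: "finite_simple_graph V E"
begin

lemma finite_V: "finite V"
  using graph by (simp add: finite_simple_graph_def)

lemma edgeD: "{v, w} \<in> E \<Longrightarrow> v \<in> V \<and> w \<in> V \<and> v \<noteq> w"
  using graph by (fastforce simp: finite_simple_graph_def)

end

section \<open>Right-angled Coxeter groups\<close>

lemma extensional_UNIV [simp]: "f \<in> extensional UNIV"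
  by (simp add: extensional_def)

text \<open>On \<open>UNIV\<close> the extensionality built into \<open>BijGroup\<close> is vacuous,
  so multiplication is plain composition.\<close>

lemma BijGroup_UNIV:
  "f \<in> carrier (BijGroup UNIV) \<longleftrightarrow> bij f"
  "bij f \<Longrightarrow> bij g \<Longrightarrow> f \<otimes>\<^bsub>BijGroup UNIV\<^esub> g = f \<circ> g"
  "\<one>\<^bsub>BijGroup UNIV\<^esub> = id"
  by (auto simp: BijGroup_def Bij_def compose_def comp_def restrict_def)

lemma iso_Z2_carrier:
  assumes "group G" "G \<cong> integer_mod_group 2"
  obtains t where "carrier G = {\<one>\<^bsub>G\<^esub>, t}" "t \<noteq> \<one>\<^bsub>G\<^esub>" "t \<otimes>\<^bsub>G\<^esub> t = \<one>\<^bsub>G\<^esub>"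
proof -
  interpret G: group G by fact
  have "card (carrier G) = 2"
    using iso_same_card[OF assms(2)] by (simp add: carrier_integer_mod_group)
  then obtain x y where xy: "carrier G = {x, y}" "x \<noteq> y" by (auto simp: card_2_iff)
  then obtain t where t: "carrier G = {\<one>\<^bsub>G\<^esub>, t}" "t \<noteq> \<one>\<^bsub>G\<^esub>"
    using G.one_closed by (cases "x = \<one>\<^bsub>G\<^esub>") auto
  moreover have "t \<otimes>\<^bsub>G\<^esub> t = \<one>\<^bsub>G\<^esub>"
  proof -
    have "t \<in> carrier G" using t(1) by simp
    then have "t \<otimes>\<^bsub>G\<^esub> t \<in> carrier G" by (rule G.m_closed[OF _ \<open>t \<in> carrier G\<close>])
    moreover have "t \<otimes>\<^bsub>G\<^esub> t \<noteq> t" using t(2) \<open>t \<in> carrier G\<close> G.l_cancel_one by blast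
    ultimately show ?thesis using t(1) by blast
  qed
  ultimately show ?thesis using that by blast
qed

locale racg = simple_graph_of_groups V G E
  for V :: "'v set" and G :: "'v \<Rightarrow> ('a, 'b) monoid_scheme" and E :: "'v set set" +
  assumes Z2: "v \<in> V \<Longrightarrow> G v \<cong> integer_mod_group 2"
begin

definition tau :: "'v \<Rightarrow> 'a" where
  "tau v = (SOME t. carrier (G v) = {\<one>\<^bsub>G v\<^esub>, t} \<and> t \<noteq> \<one>\<^bsub>G v\<^esub> \<and> t \<otimes>\<^bsub>G v\<^esub> t = \<one>\<^bsub>G v\<^esub>)"

lemma tau:
  assumes "v \<in> V"
  shows "carrier (G v) = {\<one>\<^bsub>G v\<^esub>, tau v}" "tau v \<noteq> \<one>\<^bsub>G v\<^esub>" "tau v \<otimes>\<^bsub>G v\<^esub> tau v = \<one>\<^bsub>G v\<^esub>"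
proof -
  have "\<exists>t. carrier (G v) = {\<one>\<^bsub>G v\<^esub>, t} \<and> t \<noteq> \<one>\<^bsub>G v\<^esub> \<and> t \<otimes>\<^bsub>G v\<^esub> t = \<one>\<^bsub>G v\<^esub>"
    using iso_Z2_carrier[OF group_G Z2] assms by metis
  from someI_ex[OF this] show "carrier (G v) = {\<one>\<^bsub>G v\<^esub>, tau v}" "tau v \<noteq> \<one>\<^bsub>G v\<^esub>" "tau v \<otimes>\<^bsub>G v\<^esub> tau v = \<one>\<^bsub>G v\<^esub>"
    by (auto simp: tau_def)
qed

abbreviation mult_W (infixl "\<cdot>" 70) where "x \<cdot> y \<equiv> x \<otimes>\<^bsub>W\<^esub> y"

definition a :: "'v \<Rightarrow> ('v \<times> 'a) list set set" where
  "a v = gen v (tau v)"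

lemma a_closed [simp]: "v \<in> V \<Longrightarrow> a v \<in> carrier W"
  using tau(1) by (auto simp: a_def)

lemma gen_one: "v \<in> V \<Longrightarrow> gen v \<one>\<^bsub>G v\<^esub> = \<one>\<^bsub>W\<^esub>"
  using hom_one[OF gen_hom group_G W.is_group] by blast

lemma a_sq [simp]: "v \<in> V \<Longrightarrow> a v \<cdot> a v = \<one>\<^bsub>W\<^esub>"
  using hom_mult[OF gen_hom, of v "tau v" "tau v"] tau[of v] by (simp add: a_def gen_one)

lemma a_inv [simp]: "v \<in> V \<Longrightarrow> inv\<^bsub>W\<^esub> (a v) = a v"
  by (simp add: W.inv_equality)

lemma W_cancel [simp]:
  "x \<in> carrier W \<Longrightarrow> y \<in> carrier W \<Longrightarrow> x \<cdot> (inv\<^bsub>W\<^esub> x \<cdot> y) = y"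
  "x \<in> carrier W \<Longrightarrow> y \<in> carrier W \<Longrightarrow> inv\<^bsub>W\<^esub> x \<cdot> (x \<cdot> y) = y"
  "v \<in> V \<Longrightarrow> y \<in> carrier W \<Longrightarrow> a v \<cdot> (a v \<cdot> y) = y"
  by (simp_all flip: W.m_assoc)

lemmas W_simps = W.m_assoc W.inv_mult_group

lemma W_lcancel: "x \<in> carrier W \<Longrightarrow> y \<in> carrier W \<Longrightarrow> z \<in> carrier W \<Longrightarrow> x \<cdot> y = x \<cdot> z \<longleftrightarrow> y = z"
  by (metis W_cancel(2))

lemma a_commute: "{v, w} \<in> E \<Longrightarrow> a v \<cdot> a w = a w \<cdot> a v"
  using gen_commute[of v w "tau v" "tau w"] tau(1) edgeD[of v w] by (auto simp: a_def)

lemma W_inv_induct [consumes 1, case_names one mult]: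
  assumes "x \<in> carrier W"
    and "P \<one>\<^bsub>W\<^esub>"
    and "\<And>v y. v \<in> V \<Longrightarrow> y \<in> carrier W \<Longrightarrow> P y \<Longrightarrow> P (a v \<cdot> y)"
  shows "P x"
  using assms(1)
proof (induction rule: W_induct)
  case (mult v g y)
  then have "g = \<one>\<^bsub>G v\<^esub> \<or> g = tau v" using tau(1) by blast
  then show ?case using mult assms(3) by (auto simp: gen_one a_def)
qed (rule assms(2))

text \<open>Universal property for the Coxeter presentation. The images only have to square to one,
  so a generator may also be sent to the identity, as retractions require.\<close>

lemma involution_hom:
  assumes "group H" and s: "\<And>v. v \<in> V \<Longrightarrow> s v \<in> carrier H"
    "\<And>v. v \<in> V \<Longrightarrow> s v \<otimes>\<^bsub>H\<^esub> s v = \<one>\<^bsub>H\<^esub>"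
    and comm: "\<And>v w. {v, w} \<in> E \<Longrightarrow> s v \<otimes>\<^bsub>H\<^esub> s w = s w \<otimes>\<^bsub>H\<^esub> s v"
  obtains F where "F \<in> hom W H" "\<And>v. v \<in> V \<Longrightarrow> F (a v) = s v"
proof -
  interpret H: group H by fact
  let ?f = "\<lambda>v g. if g = \<one>\<^bsub>G v\<^esub> then \<one>\<^bsub>H\<^esub> else s v"
  have hom: "?f v \<in> hom (G v) H" if "v \<in> V" for v
  proof (rule homI)
    fix g h assume gh: "g \<in> carrier (G v)" "h \<in> carrier (G v)"
    then have "g = \<one>\<^bsub>G v\<^esub> \<or> g = tau v" "h = \<one>\<^bsub>G v\<^esub> \<or> h = tau v" using tau(1)[OF that] by auto
    moreover have "\<one>\<^bsub>G v\<^esub> \<otimes>\<^bsub>G v\<^esub> x = x" "x \<otimes>\<^bsub>G v\<^esub> \<one>\<^bsub>G v\<^esub> = x" if "x \<in> carrier (G v)" for x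
      using group.is_monoid[OF group_G[OF \<open>v \<in> V\<close>]] that by (simp_all add: monoid.l_one monoid.r_one)
    ultimately show "?f v (g \<otimes>\<^bsub>G v\<^esub> h) = ?f v g \<otimes>\<^bsub>H\<^esub> ?f v h"
      using tau(2,3)[OF that] s[OF that] gh by (elim disjE) simp_all
  qed (use s that in auto)
  obtain F where F: "F \<in> hom W H" "\<And>v g. v \<in> V \<Longrightarrow> g \<in> carrier (G v) \<Longrightarrow> F (gen v g) = ?f v g"
    by (rule universal[OF assms(1) hom]) (use comm s(1) in auto)
  show ?thesis
  proof (rule that[OF F(1)])
    show "F (a v) = s v" if "v \<in> V" for v
      using F(2)[of v "tau v"] tau[OF that] that by (simp add: a_def)
  qed
qed

lemma BijGroup_hom:
  assumes "\<And>v x. v \<in> V \<Longrightarrow> s v (s v x) = x"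
    and "\<And>v w x. {v, w} \<in> E \<Longrightarrow> s v (s w x) = s w (s v x)"
  obtains F where "\<And>x. F \<one>\<^bsub>W\<^esub> x = x"
    "\<And>g h x. g \<in> carrier W \<Longrightarrow> h \<in> carrier W \<Longrightarrow> F (g \<cdot> h) x = F g (F h x)"
    "\<And>v. v \<in> V \<Longrightarrow> F (a v) = s v"
proof -
  have b: "bij (s v)" if "v \<in> V" for v
    using assms(1)[OF that] by (intro o_bij[of "s v"]) auto
  obtain F where F: "F \<in> hom W (BijGroup UNIV)" "\<And>v. v \<in> V \<Longrightarrow> F (a v) = s v"
    by (rule involution_hom[OF group_BijGroup, of s UNIV])
       (use assms b edgeD in \<open>auto simp: BijGroup_UNIV fun_eq_iff\<close>)
  have cl: "bij (F g)" if "g \<in> carrier W" for g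
    using hom_in_carrier[OF F(1) that] by (simp add: BijGroup_UNIV)
  show ?thesis
  proof (rule that[of F])
    show "F (g \<cdot> h) x = F g (F h x)" if "g \<in> carrier W" "h \<in> carrier W" for g h x
      using hom_mult[OF F(1) that] cl that by (simp add: BijGroup_UNIV)
    show "F \<one>\<^bsub>W\<^esub> x = x" for x
      using hom_one[OF F(1) W.is_group group_BijGroup] by (simp add: BijGroup_UNIV)
  qed (use F in auto)
qed

subsection \<open>Parity\<close>

text \<open>\<open>a v\<close> acts on \<open>bool\<close> by negation and every other generator
  trivially; \<open>p x\<close> is the image of \<open>False\<close>.\<close>

lemma ex_parity:
  assumes "v \<in> V"
  shows "\<exists>p. (\<not> p \<one>\<^bsub>W\<^esub>) \<and> (\<forall>x \<in> carrier W. \<forall>y \<in> carrier W. p (x \<cdot> y) \<longleftrightarrow> p x \<noteq> p y) \<and>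
    (\<forall>u \<in> V. p (a u) \<longleftrightarrow> u = v)"
proof -
  obtain F where F: "\<And>x. F \<one>\<^bsub>W\<^esub> x = x"
    "\<And>g h x. g \<in> carrier W \<Longrightarrow> h \<in> carrier W \<Longrightarrow> F (g \<cdot> h) x = F g (F h x)"
    "\<And>u. u \<in> V \<Longrightarrow> F (a u) = (if u = v then Not else id)"
    by (rule BijGroup_hom[of "\<lambda>u. if u = v then Not else id"]) auto
  have shift: "F x b \<longleftrightarrow> b \<noteq> F x False" if "x \<in> carrier W" for x b
    using that by (induction rule: W_inv_induct) (auto simp: F)
  have "F (x \<cdot> y) False \<longleftrightarrow> F x False \<noteq> F y False" if "x \<in> carrier W" "y \<in> carrier W" for x y
    using shift[OF that(1), of "F y False"] F(2)[OF that] by blast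
  then show ?thesis
    using F(1,3) by (intro exI[of _ "\<lambda>x. F x False"]) simp
qed

text \<open>The homomorphism to Z/2 that counts occurrences of \<open>v\<close> modulo 2, written as
  a predicate. It is invariant under conjugation, so inner automorphisms preserve it.\<close>

definition parity :: "'v \<Rightarrow> ('v \<times> 'a) list set set \<Rightarrow> bool" where
  "parity v = (SOME p. (\<not> p \<one>\<^bsub>W\<^esub>) \<and> (\<forall>x \<in> carrier W. \<forall>y \<in> carrier W. p (x \<cdot> y) \<longleftrightarrow> p x \<noteq> p y) \<and>
    (\<forall>u \<in> V. p (a u) \<longleftrightarrow> u = v))"

lemma parity [simp]:
  assumes "v \<in> V"
  shows "\<not> parity v \<one>\<^bsub>W\<^esub>"
    "x \<in> carrier W \<Longrightarrow> y \<in> carrier W \<Longrightarrow> parity v (x \<cdot> y) \<longleftrightarrow> parity v x \<noteq> parity v y"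
    "u \<in> V \<Longrightarrow> parity v (a u) \<longleftrightarrow> u = v"
  using someI_ex[OF ex_parity[OF assms]] unfolding parity_def[symmetric] by blast+

lemma parity_inv [simp]: "v \<in> V \<Longrightarrow> x \<in> carrier W \<Longrightarrow> parity v (inv\<^bsub>W\<^esub> x) = parity v x"
  using parity(2)[of v x "inv\<^bsub>W\<^esub> x"] by simp

lemma a_neq_one [simp]: "v \<in> V \<Longrightarrow> a v \<noteq> \<one>\<^bsub>W\<^esub>"
  using parity(1,3) by metis

lemma a_eq_iff [simp]: "v \<in> V \<Longrightarrow> w \<in> V \<Longrightarrow> a v = a w \<longleftrightarrow> v = w"
  using parity(3) by metis

lemma conj_a_eq:
  assumes "v \<in> V" "w \<in> V" "x \<in> carrier W" "y \<in> carrier W"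
    "x \<cdot> a v \<cdot> inv\<^bsub>W\<^esub> x = y \<cdot> a w \<cdot> inv\<^bsub>W\<^esub> y"
  shows "v = w"
proof -
  have "parity v (x \<cdot> a v \<cdot> inv\<^bsub>W\<^esub> x) = parity v (y \<cdot> a w \<cdot> inv\<^bsub>W\<^esub> y)"
    using assms(5) by simp
  then show ?thesis using assms(1-4) by auto
qed

subsection \<open>Special subgroups\<close>

lemma ex_retraction:
  "\<exists>F. F \<in> hom W W \<and> (\<forall>v \<in> V. F (a v) = (if v \<in> A then a v else \<one>\<^bsub>W\<^esub>))"
  using involution_hom[OF W.is_group, of "\<lambda>v. if v \<in> A then a v else \<one>\<^bsub>W\<^esub>"] edgeD a_commute
  by (smt (verit, best) W.l_one W.one_closed W.r_one a_closed a_sq)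

definition retraction where
  "retraction A = (SOME F. F \<in> hom W W \<and> (\<forall>v \<in> V. F (a v) = (if v \<in> A then a v else \<one>\<^bsub>W\<^esub>)))"

lemma retraction_hom: "retraction A \<in> hom W W"
  and retraction_a: "v \<in> V \<Longrightarrow> retraction A (a v) = (if v \<in> A then a v else \<one>\<^bsub>W\<^esub>)"
  using someI_ex[OF ex_retraction, of A] unfolding retraction_def[symmetric] by auto

lemma retraction_simps [simp]:
  "x \<in> carrier W \<Longrightarrow> retraction A x \<in> carrier W"
  "x \<in> carrier W \<Longrightarrow> y \<in> carrier W \<Longrightarrow> retraction A (x \<cdot> y) = retraction A x \<cdot> retraction A y"
  "retraction A \<one>\<^bsub>W\<^esub> = \<one>\<^bsub>W\<^esub>"
  using retraction_hom[of A] by (auto simp: hom_in_carrier hom_mult hom_one W.is_group)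

lemma retraction_inv [simp]: "x \<in> carrier W \<Longrightarrow> retraction A (inv\<^bsub>W\<^esub> x) = inv\<^bsub>W\<^esub> (retraction A x)"
  by (rule W.inv_equality[symmetric]) (simp_all flip: retraction_simps(2))

lemma retraction_retraction:
  "x \<in> carrier W \<Longrightarrow> retraction A (retraction B x) = retraction (A \<inter> B) x"
  by (induction rule: W_inv_induct) (auto simp: retraction_a)

text \<open>The subgroup generated by the \<open>a v\<close> with \<open>v \<in> A\<close>, encoded
  as the fixed points of a retraction. Intersections then reduce to composing retractions, and no
  words have to be compared.\<close>

definition special :: "'v set \<Rightarrow> ('v \<times> 'a) list set set set" where
  "special A = {x \<in> carrier W. retraction A x = x}"

lemma special_carrier: "x \<in> special A \<Longrightarrow> x \<in> carrier W"
  by (simp add: special_def)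

lemma special_closed [simp]:
  "\<one>\<^bsub>W\<^esub> \<in> special A"
  "x \<in> special A \<Longrightarrow> y \<in> special A \<Longrightarrow> x \<cdot> y \<in> special A"
  "x \<in> special A \<Longrightarrow> inv\<^bsub>W\<^esub> x \<in> special A"
  by (simp_all add: special_def)

lemma a_special [simp]: "v \<in> V \<Longrightarrow> a v \<in> special A \<longleftrightarrow> v \<in> A"
  using a_neq_one by (fastforce simp: special_def retraction_a)

lemma special_Int: "x \<in> special A \<Longrightarrow> x \<in> special B \<Longrightarrow> x \<in> special (A \<inter> B)"
  by (simp add: special_def) (metis retraction_retraction)

lemma special_empty: "special {} = {\<one>\<^bsub>W\<^esub>}"
proof -
  have "retraction {} x = \<one>\<^bsub>W\<^esub>" if "x \<in> carrier W" for x
    using that by (induction rule: W_inv_induct) (auto simp: retraction_a)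
  then show ?thesis by (auto simp: special_def)
qed

lemma retraction_special: "x \<in> carrier W \<Longrightarrow> retraction A x \<in> special A"
  by (simp add: special_def retraction_retraction)

lemma special_mono: "x \<in> special A \<Longrightarrow> A \<subseteq> B \<Longrightarrow> x \<in> special B"
  by (simp add: special_def) (metis retraction_retraction inf.absorb_iff2)

lemma special_V: "special V = carrier W"
proof -
  have "retraction V x = x" if "x \<in> carrier W" for x
    using that by (induction rule: W_inv_induct) (auto simp: retraction_a)
  then show ?thesis by (auto simp: special_def)
qed

subsection \<open>Inversions\<close>

text \<open>\<open>W\<close> acts on sets of group elements: \<open>a v\<close> conjugates the set
  and then toggles the membership of \<open>a v\<close>. Adjacent generators fix each other under
  conjugation, so their actions commute. The inversion set is the image of the empty set.\<close>

lemma ex_inversions: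
  "\<exists>n. n \<one>\<^bsub>W\<^esub> = {} \<and> (\<forall>v \<in> V. \<forall>y \<in> carrier W. \<forall>t \<in> carrier W.
      t \<in> n (a v \<cdot> y) \<longleftrightarrow> (t = a v) \<noteq> (a v \<cdot> t \<cdot> a v \<in> n y)) \<and> (\<forall>x. n x \<subseteq> carrier W)"
proof -
  \<comment> \<open>Extended by the identity outside the carrier to be a permutation of the whole
    type.\<close>
  define k where "k v t = (if t \<in> carrier W then a v \<cdot> t \<cdot> a v else t)" for v t
  define s where "s v A = {t. (t = a v) \<noteq> (k v t \<in> A)}" for v A
  have kk: "k v (k v t) = t" if "v \<in> V" for v t
    using that by (simp add: k_def W_simps)
  have ka: "k v t = a v \<longleftrightarrow> t = a v" if "v \<in> V" for v t
    using that kk[OF that, of t] by (auto simp: k_def W_simps)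
  have kcomm: "k v (k w t) = k w (k v t)" if "{v, w} \<in> E" for v w t
  proof -
    have "a v \<cdot> (a w \<cdot> t \<cdot> a w) \<cdot> a v = (a v \<cdot> a w) \<cdot> t \<cdot> (a w \<cdot> a v)" if "t \<in> carrier W"
      using that edgeD[OF \<open>{v, w} \<in> E\<close>] by (simp add: W_simps)
    moreover have "a w \<cdot> (a v \<cdot> t \<cdot> a v) \<cdot> a w = (a w \<cdot> a v) \<cdot> t \<cdot> (a v \<cdot> a w)" if "t \<in> carrier W"
      using that edgeD[OF \<open>{v, w} \<in> E\<close>] by (simp add: W_simps)
    ultimately show ?thesis
      using a_commute[OF that] edgeD[OF that] by (simp add: k_def)
  qed
  have kw: "k v t = a w \<longleftrightarrow> t = a w" if "{v, w} \<in> E" for v w t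
  proof -
    have "k v (a w) = a w"
      using a_commute[OF that] edgeD[OF that] by (simp add: k_def W_simps)
    then show ?thesis using kk edgeD[OF that] by metis
  qed
  have "s v (s v A) = A" if "v \<in> V" for v A
    using kk[OF that] ka[OF that] by (auto simp: s_def)
  moreover have "s v (s w A) = s w (s v A)" if "{v, w} \<in> E" for v w A
    using kcomm[OF that] kw[OF that] kw[of w v] that by (auto simp: s_def insert_commute)
  ultimately obtain F where F: "\<And>x. F \<one>\<^bsub>W\<^esub> x = x"
    "\<And>g h x. g \<in> carrier W \<Longrightarrow> h \<in> carrier W \<Longrightarrow> F (g \<cdot> h) x = F g (F h x)"
    "\<And>u. u \<in> V \<Longrightarrow> F (a u) = s u"
    by (rule BijGroup_hom[of s]) blast+
  have "t \<in> F (a v \<cdot> y) {} \<inter> carrier W \<longleftrightarrow> (t = a v) \<noteq> (a v \<cdot> t \<cdot> a v \<in> F y {} \<inter> carrier W)"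
    if "v \<in> V" "y \<in> carrier W" "t \<in> carrier W" for v y t
    using that by (auto simp: F s_def k_def)
  then show ?thesis
    using F(1) by (intro exI[of _ "\<lambda>x. F x {} \<inter> carrier W"]) auto
qed

text \<open>
  The set \<open>inversions x\<close> consists of the reflections whose walls separate the chambers \<open>1\<close> and \<open>x\<close>.
  It is a cocycle: \<open>inversions (x \<cdot> y)\<close> is the symmetric difference of \<open>inversions x\<close> and the
  conjugate of \<open>inversions y\<close> by \<open>x\<close>.
\<close>

definition inversions where
  "inversions = (SOME n. n \<one>\<^bsub>W\<^esub> = {} \<and> (\<forall>v \<in> V. \<forall>y \<in> carrier W. \<forall>t \<in> carrier W.
      t \<in> n (a v \<cdot> y) \<longleftrightarrow> (t = a v) \<noteq> (a v \<cdot> t \<cdot> a v \<in> n y)) \<and> (\<forall>x. n x \<subseteq> carrier W))"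

lemma inversions_one [simp]: "inversions \<one>\<^bsub>W\<^esub> = {}"
  and inversions_a_mult: "v \<in> V \<Longrightarrow> y \<in> carrier W \<Longrightarrow> t \<in> carrier W \<Longrightarrow>
      t \<in> inversions (a v \<cdot> y) \<longleftrightarrow> (t = a v) \<noteq> (a v \<cdot> t \<cdot> a v \<in> inversions y)"
  and inversions_closed: "t \<in> inversions x \<Longrightarrow> t \<in> carrier W"
  using someI_ex[OF ex_inversions] unfolding inversions_def[symmetric] by auto

lemma inversions_mult:
  "x \<in> carrier W \<Longrightarrow> y \<in> carrier W \<Longrightarrow> t \<in> carrier W \<Longrightarrow>
    t \<in> inversions (x \<cdot> y) \<longleftrightarrow> (t \<in> inversions x) \<noteq> (inv\<^bsub>W\<^esub> x \<cdot> t \<cdot> x \<in> inversions y)"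
proof (induction x arbitrary: t rule: W_inv_induct)
  case (mult v x)
  then show ?case by (simp add: inversions_a_mult W_simps) blast
qed auto

lemma inversions_a: "v \<in> V \<Longrightarrow> inversions (a v) = {a v}"
  using inversions_a_mult[of v "\<one>\<^bsub>W\<^esub>"] inversions_closed by auto

text \<open>Passing from the chamber \<open>x\<close> to its neighbour \<open>x \<cdot> a v\<close>
  crosses a single wall, that of the conjugate of \<open>a v\<close> by \<open>x\<close>.\<close>

lemma inversions_mult_a:
  "x \<in> carrier W \<Longrightarrow> v \<in> V \<Longrightarrow> t \<in> carrier W \<Longrightarrow>
    t \<in> inversions (x \<cdot> a v) \<longleftrightarrow> (t \<in> inversions x) \<noteq> (t = x \<cdot> a v \<cdot> inv\<^bsub>W\<^esub> x)"
  by (simp add: inversions_mult inversions_a) (metis W.inv_closed W.inv_solve_left W.inv_solve_right W.m_closed a_closed W.m_assoc)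

text \<open>Prepending a letter of \<open>A\<close> toggles \<open>a v\<close> and conjugates by it,
  both inside the subgroup; the retraction erases all other letters.\<close>

lemma inversions_special:
  assumes "x \<in> special A" shows "inversions x \<subseteq> special A"
proof -
  have "inversions (retraction A x) \<subseteq> special A" if "x \<in> carrier W" for x
    using that
  proof (induction rule: W_inv_induct)
    case (mult v y)
    show ?case
    proof (cases "v \<in> A")
      case True
      show ?thesis
      proof
        fix t assume t: "t \<in> inversions (retraction A (a v \<cdot> y))"
        then have tc: "t \<in> carrier W" by (rule inversions_closed)
        with t mult True have "t = a v \<or> a v \<cdot> t \<cdot> a v \<in> special A"
          by (auto simp: retraction_a inversions_a_mult)
        moreover have "a v \<cdot> (a v \<cdot> t \<cdot> a v) \<cdot> a v = t" using tc mult by (simp add: W_simps)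
        ultimately show "t \<in> special A"
          using mult True special_closed(2) a_special by metis
      qed
    qed (use mult in \<open>simp add: retraction_a\<close>)
  qed simp
  moreover have "x \<in> carrier W" "retraction A x = x" using assms by (simp_all add: special_def)
  ultimately show ?thesis by metis
qed

subsection \<open>Length and the exchange condition\<close>

definition wp :: "'v list \<Rightarrow> ('v \<times> 'a) list set set" where
  "wp us = foldr (\<lambda>v x. a v \<cdot> x) us \<one>\<^bsub>W\<^esub>"

lemma wp_simps [simp]: "wp [] = \<one>\<^bsub>W\<^esub>" "wp (v # us) = a v \<cdot> wp us"
  by (simp_all add: wp_def)

lemma wp_closed [simp]: "set us \<subseteq> V \<Longrightarrow> wp us \<in> carrier W"
  by (induction us) auto

lemma wp_append: "set us \<subseteq> V \<Longrightarrow> set ws \<subseteq> V \<Longrightarrow> wp (us @ ws) = wp us \<cdot> wp ws"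
  by (induction us) (auto simp: W.m_assoc)

lemma wp_rev: "set us \<subseteq> V \<Longrightarrow> wp (rev us) = inv\<^bsub>W\<^esub> (wp us)"
  by (induction us) (auto simp: W.inv_mult_group wp_append)

lemma ex_wp: "x \<in> carrier W \<Longrightarrow> \<exists>us. set us \<subseteq> V \<and> wp us = x"
proof (induction rule: W_inv_induct)
  case one
  then show ?case by (intro exI[of _ "[]"]) simp
next
  case (mult v y)
  then obtain us where "set us \<subseteq> V" "wp us = y" by blast
  then show ?case using mult by (intro exI[of _ "v # us"]) simp
qed

definition len :: "('v \<times> 'a) list set set \<Rightarrow> nat" where
  "len x = (LEAST k. \<exists>us. set us \<subseteq> V \<and> wp us = x \<and> length us = k)"

lemma len_le: "set us \<subseteq> V \<Longrightarrow> len (wp us) \<le> length us"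
  unfolding len_def by (rule Least_le) blast

lemma ex_reduced:
  assumes "x \<in> carrier W"
  obtains us where "set us \<subseteq> V" "wp us = x" "length us = len x"
proof -
  have "\<exists>k us. set us \<subseteq> V \<and> wp us = x \<and> length us = k" using ex_wp[OF assms] by blast
  from LeastI_ex[OF this] show ?thesis using that unfolding len_def by blast
qed

lemma len_inv: "x \<in> carrier W \<Longrightarrow> len (inv\<^bsub>W\<^esub> x) = len x"
proof -
  have "len (inv\<^bsub>W\<^esub> x) \<le> len x" if "x \<in> carrier W" for x
    using ex_reduced[OF that] by (metis len_le length_rev set_rev wp_rev)
  then show "x \<in> carrier W \<Longrightarrow> len (inv\<^bsub>W\<^esub> x) = len x"
    by (metis W.inv_closed W.inv_inv le_antisym)
qed

text \<open>Strong exchange: along the word, \<open>t\<close> is conjugated by each letter passed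
  until it equals the next letter; left multiplication by \<open>t\<close> deletes exactly that
  letter.\<close>

lemma exchange_word:
  "set us \<subseteq> V \<Longrightarrow> t \<in> inversions (wp us) \<Longrightarrow>
    \<exists>ws. set ws \<subseteq> V \<and> wp ws = t \<cdot> wp us \<and> length ws < length us"
proof (induction us arbitrary: t)
  case (Cons v us)
  then have tc: "t \<in> carrier W" and v: "v \<in> V" and us: "set us \<subseteq> V"
    using inversions_closed by auto
  show ?case
  proof (cases "t = a v")
    case True
    then show ?thesis using v us by (intro exI[of _ us]) simp
  next
    case False
    then have "a v \<cdot> t \<cdot> a v \<in> inversions (wp us)"
      using Cons.prems tc v by (simp add: inversions_a_mult)
    then obtain ws where "set ws \<subseteq> V" "wp ws = a v \<cdot> t \<cdot> a v \<cdot> wp us" "length ws < length us"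
      using Cons.IH us by blast
    then show ?thesis using v us tc by (intro exI[of _ "v # ws"]) (simp add: W_simps)
  qed
qed simp

lemma exchange: "x \<in> carrier W \<Longrightarrow> t \<in> inversions x \<Longrightarrow> len (t \<cdot> x) < len x"
proof -
  assume x: "x \<in> carrier W" "t \<in> inversions x"
  obtain us where us: "set us \<subseteq> V" "wp us = x" "length us = len x"
    by (rule ex_reduced[OF x(1)])
  then obtain ws where "set ws \<subseteq> V" "wp ws = t \<cdot> x" "length ws < len x"
    using exchange_word[OF us(1), of t] x(2) by auto
  then show "len (t \<cdot> x) < len x" using len_le[of ws] by simp
qed

lemma descent_iff: "v \<in> V \<Longrightarrow> x \<in> carrier W \<Longrightarrow> a v \<in> inversions (a v \<cdot> x) \<longleftrightarrow> a v \<notin> inversions x"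
  by (simp add: inversions_a_mult)

text \<open>The first letter of a reduced word is a descent: left multiplication by it shortens the
  element, and if it were not an inversion, \<open>exchange\<close> would make the way back shorter
  as well.\<close>

lemma ex_descent:
  assumes "x \<in> carrier W" "x \<noteq> \<one>\<^bsub>W\<^esub>"
  obtains v where "v \<in> V" "a v \<in> inversions x"
proof -
  obtain us where us: "set us \<subseteq> V" "wp us = x" "length us = len x"
    by (rule ex_reduced[OF assms(1)])
  then obtain v ws where ws: "us = v # ws" using assms(2) by (cases us) auto
  have "len (a v \<cdot> x) < len x"
    using us ws len_le[of ws] by auto
  moreover have "len (a v \<cdot> (a v \<cdot> x)) < len (a v \<cdot> x)" if "a v \<notin> inversions x"
    using that us(1) ws assms(1) by (intro exchange) (auto simp: descent_iff)
  ultimately have "a v \<in> inversions x"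
    using us(1) ws assms(1) by fastforce
  then show ?thesis using that us(1) ws by auto
qed

subsection \<open>Centralisers of generators\<close>

text \<open>\<open>r\<close> and \<open>s\<close> act on the integers by the reflections in 0 and
  1/2, all other generators trivially; without an edge no relation links the two. Only
  \<open>a s\<close> changes the parity of an integer, so the image of 0 records the parity of
  \<open>s\<close>.\<close>

lemma dihedral_action:
  assumes "r \<in> V" "s \<in> V" "r \<noteq> s" "{r, s} \<notin> E"
  obtains F :: "_ \<Rightarrow> int \<Rightarrow> int" where
    "\<And>g h x. g \<in> carrier W \<Longrightarrow> h \<in> carrier W \<Longrightarrow> F (g \<cdot> h) x = F g (F h x)"
    "\<And>x. F (a r) x = - x" "\<And>x. F (a s) x = 1 - x"
    "\<And>g. g \<in> carrier W \<Longrightarrow> odd (F g 0) \<longleftrightarrow> parity s g"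
proof -
  let ?f = "\<lambda>v. if v = r then uminus else if v = s then (\<lambda>x::int. 1 - x) else id"
  obtain F where F: "\<And>x. F \<one>\<^bsub>W\<^esub> x = x"
    "\<And>g h x. g \<in> carrier W \<Longrightarrow> h \<in> carrier W \<Longrightarrow> F (g \<cdot> h) x = F g (F h x)"
    "\<And>v. v \<in> V \<Longrightarrow> F (a v) = ?f v"
    by (rule BijGroup_hom[of ?f]) (use assms edgeD in \<open>auto simp: insert_commute\<close>)
  have "odd (F g 0) \<longleftrightarrow> parity s g" if "g \<in> carrier W" for g
    using that by (induction rule: W_inv_induct) (use assms in \<open>auto simp: F\<close>)
  then show ?thesis using that[of F] F assms by auto
qed

text \<open>In the picture of \<open>dihedral_action\<close> the chamber \<open>1\<close> lies
  between the wall 0 of \<open>r\<close> and the wall 1/2 of \<open>s\<close>, so \<open>d\<close>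
  cannot be beyond both.\<close>

lemma special_inversions_disjoint:
  assumes rs: "r \<in> V" "s \<in> V" "r \<noteq> s" "{r, s} \<notin> E"
    and "d \<in> special {r, s}"
  shows "\<not> (a r \<in> inversions d \<and> a s \<in> inversions d)"
proof -
  obtain F :: "_ \<Rightarrow> int \<Rightarrow> int" where
    F: "\<And>g h x. g \<in> carrier W \<Longrightarrow> h \<in> carrier W \<Longrightarrow> F (g \<cdot> h) x = F g (F h x)"
      "\<And>x. F (a r) x = - x" "\<And>x. F (a s) x = 1 - x"
    by (rule dihedral_action[OF rs]) blast
  \<comment> \<open>Every inversion acts as the reflection in the point \<open>F t 0 / 2\<close>.
    The claim places all these points at or left of 0 if \<open>a r\<close> is an inversion, and at
    or right of 1/2 if \<open>a s\<close> is.\<close>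
  have "(\<forall>t \<in> inversions d. \<forall>x. F t x = F t 0 - x) \<and>
      (a r \<in> inversions d \<longrightarrow> (\<forall>t \<in> inversions d. F t 0 \<le> 0)) \<and>
      (a s \<in> inversions d \<longrightarrow> (\<forall>t \<in> inversions d. F t 0 \<ge> 1))"
    using assms(5)
  proof (induction "len d" arbitrary: d rule: less_induct)
    case less
    have dc: "d \<in> carrier W" using less.prems by (rule special_carrier)
    have desc: "\<exists>v \<in> {r, s}. a v \<in> inversions d"
      if "d \<in> special {r, s}" "d \<noteq> \<one>\<^bsub>W\<^esub>" for d
      using ex_descent[OF special_carrier[OF that(1)] that(2)] inversions_special[OF that(1)]
      by (metis a_special subsetD)
    show ?case
    proof (cases "d = \<one>\<^bsub>W\<^esub>")
      case False
      then obtain v where v: "v \<in> {r, s}" "a v \<in> inversions d" using desc less.prems by blast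
      have vV: "v \<in> V" using v rs by auto
      define y where "y = a v \<cdot> d"
      have y: "y \<in> carrier W" "y \<in> special {r, s}" "d = a v \<cdot> y" "len y < len d"
        using vV dc less.prems v exchange[OF dc v(2)] by (auto simp: y_def)
      have ny: "a v \<notin> inversions y" using v y vV by (simp add: descent_iff)
      have IH: "\<And>t x. t \<in> inversions y \<Longrightarrow> F t x = F t 0 - x"
        "\<And>t. a r \<in> inversions y \<Longrightarrow> t \<in> inversions y \<Longrightarrow> F t 0 \<le> 0"
        "\<And>t. a s \<in> inversions y \<Longrightarrow> t \<in> inversions y \<Longrightarrow> F t 0 \<ge> 1"
        using less.hyps[OF y(4,2)] by blast+
      have inv_d: "t = a v \<or> (\<exists>u \<in> inversions y. t = a v \<cdot> u \<cdot> a v \<and> u \<in> carrier W)"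
        if "t \<in> inversions d" for t
      proof -
        have tc: "t \<in> carrier W" using that inversions_closed by blast
        moreover have "t = a v \<cdot> (a v \<cdot> t \<cdot> a v) \<cdot> a v" using tc vV by (simp add: W_simps)
        moreover have "t = a v \<or> a v \<cdot> t \<cdot> a v \<in> inversions y"
          using that tc vV y by (auto simp: inversions_a_mult)
        ultimately show ?thesis using vV inversions_closed by blast
      qed
      \<comment> \<open>Since \<open>v\<close> is no descent of \<open>y\<close>, a non-trivial
        \<open>y\<close> has the other generator as a descent, which makes the opposite bound
        available.\<close>
      have dy: "\<exists>v' \<in> {r, s}. v' \<noteq> v \<and> a v' \<in> inversions y" if "u \<in> inversions y" for u
        using desc[OF y(2)] ny that by (cases "y = \<one>\<^bsub>W\<^esub>") auto
      consider "v = r" | "v = s" using v by auto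
      then show ?thesis
      proof cases
        case 1
        have "F t 0 \<le> 0 \<and> (\<forall>x. F t x = F t 0 - x)" if "t \<in> inversions d" for t
          using inv_d[OF that]
        proof (elim disjE bexE conjE)
          fix u assume u: "u \<in> inversions y" "t = a v \<cdot> u \<cdot> a v" "u \<in> carrier W"
          have "a s \<in> inversions y" using dy[OF u(1)] 1 by auto
          then have "F u 0 \<ge> 1" using IH(3) u(1) by blast
          have "F t x = - F u (- x)" for x using u rs 1 by (simp add: F)
          then have "F t x = - F u 0 - x" for x using IH(1)[OF u(1), of "- x"] by simp
          then show ?thesis using \<open>F u 0 \<ge> 1\<close> by simp
        qed (use 1 F in simp)
        moreover have "a s \<notin> inversions d" using calculation[of "a s"] F(3) by auto
        ultimately show ?thesis by blast
      next
        case 2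
        have "F t 0 \<ge> 1 \<and> (\<forall>x. F t x = F t 0 - x)" if "t \<in> inversions d" for t
          using inv_d[OF that]
        proof (elim disjE bexE conjE)
          fix u assume u: "u \<in> inversions y" "t = a v \<cdot> u \<cdot> a v" "u \<in> carrier W"
          have "a r \<in> inversions y" using dy[OF u(1)] 2 by auto
          then have "F u 0 \<le> 0" using IH(2) u(1) by blast
          have "F t x = 1 - F u (1 - x)" for x using u rs 2 by (simp add: F)
          then have "F t x = 2 - F u 0 - x" for x using IH(1)[OF u(1), of "1 - x"] by simp
          then show ?thesis using \<open>F u 0 \<le> 0\<close> by simp
        qed (use 2 F in simp)
        moreover have "a r \<notin> inversions d" using calculation[of "a r"] F(2) by auto
        ultimately show ?thesis by blast
      qed
    qed simp
  qed
  then have "a r \<in> inversions d \<longrightarrow> a s \<in> inversions d \<longrightarrow> F (a s) 0 \<le> 0" by blast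
  then show ?thesis using F(3)[of 0] by auto
qed

text \<open>Choose \<open>d\<close> in the subgroup of \<open>r\<close> and \<open>s\<close> such
  that \<open>d \<cdot> x\<close> is shortest. Then \<open>d \<cdot> x\<close> has no inversions in
  this subgroup, so by the cocycle rule a generator that is an inversion of \<open>x\<close> is one
  of the inverse of \<open>d\<close>. Without an edge this cannot hold for both generators.\<close>

lemma descents_adjacent:
  assumes rs: "r \<in> V" "s \<in> V" "r \<noteq> s" and x: "x \<in> carrier W"
    and desc: "a r \<in> inversions x" "a s \<in> inversions x"
  shows "{r, s} \<in> E"
proof (rule ccontr)
  assume nE: "{r, s} \<notin> E"
  define d where "d = arg_min (\<lambda>d. len (d \<cdot> x)) (\<lambda>d. d \<in> special {r, s})"
  have d: "d \<in> special {r, s}" and dmin: "\<And>e. e \<in> special {r, s} \<Longrightarrow> len (d \<cdot> x) \<le> len (e \<cdot> x)"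
    using arg_min_nat_lemma[of "\<lambda>d. d \<in> special {r, s}" "\<one>\<^bsub>W\<^esub>" "\<lambda>d. len (d \<cdot> x)"]
    by (auto simp: d_def)
  have dc: "d \<in> carrier W" using d by (rule special_carrier)
  have no: "t \<notin> inversions (d \<cdot> x)" if t: "t \<in> special {r, s}" for t
  proof
    assume "t \<in> inversions (d \<cdot> x)"
    then have "len (t \<cdot> (d \<cdot> x)) < len (d \<cdot> x)" using exchange x dc by simp
    moreover have "t \<cdot> (d \<cdot> x) = t \<cdot> d \<cdot> x" using special_carrier[OF t] x dc by (simp add: W.m_assoc)
    ultimately show False using dmin[of "t \<cdot> d"] t d by (simp add: not_less[symmetric])
  qed
  have "a v \<in> inversions (inv\<^bsub>W\<^esub> d)" if v: "v \<in> {r, s}" "a v \<in> inversions x" for v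
  proof -
    have vV: "v \<in> V" using v rs by auto
    have "d \<cdot> a v \<cdot> inv\<^bsub>W\<^esub> d \<notin> inversions (d \<cdot> x)"
      using v(1) d vV by (intro no) auto
    then show ?thesis
      using inversions_mult[of "inv\<^bsub>W\<^esub> d" "d \<cdot> x" "a v"] v(2) vV dc x by auto
  qed
  then show False
    using special_inversions_disjoint[OF rs nE, of "inv\<^bsub>W\<^esub> d"] d desc by auto
qed

lemma a_mult_commute:
  assumes "u \<in> V" "z \<in> carrier W" "x \<in> carrier W" "a u \<cdot> z = z \<cdot> a u" "x \<cdot> z = z \<cdot> x"
  shows "(a u \<cdot> x) \<cdot> z = z \<cdot> (a u \<cdot> x)"
  using assms by (metis W.m_assoc a_closed)

lemma special_star_commute:
  assumes "v \<in> V" "x \<in> special (star V E v)"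
  shows "x \<cdot> a v = a v \<cdot> x"
proof -
  have "retraction (star V E v) y \<cdot> a v = a v \<cdot> retraction (star V E v) y" if "y \<in> carrier W" for y
    using that
  proof (induction rule: W_inv_induct)
    case (mult u y)
    have "a u \<cdot> a v = a v \<cdot> a u" if "u \<in> star V E v"
      using that a_commute[of v u] by (auto simp: star_def)
    then show ?case
      using mult assms(1) a_mult_commute[of u "a v" "retraction (star V E v) y"]
      by (simp add: retraction_a)
  qed (use assms in simp)
  moreover have "x \<in> carrier W" "retraction (star V E v) x = x"
    using assms(2) by (simp_all add: special_def)
  ultimately show ?thesis by metis
qed

text \<open>Descents in the star are stripped off by induction on the length. If \<open>s\<close>
  itself is no descent, every descent \<open>r\<close> is adjacent to \<open>s\<close>: otherwise
  \<open>r\<close> and \<open>s\<close> would both be descents of \<open>a s \<cdot> x\<close>,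
  against \<open>descents_adjacent\<close>.\<close>

lemma centralizer_a:
  assumes "s \<in> V" "x \<in> carrier W" "x \<cdot> a s = a s \<cdot> x"
  shows "x \<in> special (star V E s)"
  using assms(2,3)
proof (induction "len x" arbitrary: x rule: less_induct)
  case less
  have step: "x \<in> special (star V E s)"
    if r: "r \<in> star V E s" "r \<in> V" "a r \<in> inversions x" for r
  proof -
    have "a r \<cdot> a s = a s \<cdot> a r" using r a_commute[of s r] by (auto simp: star_def)
    then have "(a r \<cdot> x) \<cdot> a s = a s \<cdot> (a r \<cdot> x)"
      using a_mult_commute[of r "a s" x] r less.prems assms(1) by simp
    then have "a r \<cdot> x \<in> special (star V E s)"
      using less.hyps[of "a r \<cdot> x"] exchange[OF less.prems(1) r(3)] r less.prems by simp
    then have "a r \<cdot> (a r \<cdot> x) \<in> special (star V E s)" using r by simp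
    then show ?thesis using r less.prems by simp
  qed
  show ?case
  proof (cases "x = \<one>\<^bsub>W\<^esub> \<or> a s \<in> inversions x")
    case True
    then show ?thesis using step[of s] assms(1) by (auto simp: star_def)
  next
    case False
    then obtain r where r: "r \<in> V" "a r \<in> inversions x"
      using ex_descent[OF less.prems(1)] by blast
    have "r \<noteq> s" using r False by auto
    have "{r, s} \<in> E"
    proof (rule ccontr)
      assume nE: "{r, s} \<notin> E"
      let ?t = "a s \<cdot> a r \<cdot> a s"
      \<comment> \<open>As \<open>x\<close> commutes with \<open>a s\<close> and \<open>a s\<close> is not an inversion of it, conjugation by \<open>a s\<close> preserves its inversions.\<close>
      have "?t \<noteq> a s" using \<open>r \<noteq> s\<close> conj_a_eq[of r s "a s" "\<one>\<^bsub>W\<^esub>"] r assms(1) by auto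
      have "?t \<noteq> x \<cdot> a s \<cdot> inv\<^bsub>W\<^esub> x"
        using \<open>r \<noteq> s\<close> conj_a_eq[of r s "a s" x] r assms(1) less.prems by auto
      then have "?t \<in> inversions (x \<cdot> a s) \<longleftrightarrow> ?t \<in> inversions x"
        using inversions_mult_a[of x s ?t] less.prems(1) r assms(1) by simp
      moreover have "?t \<in> inversions (a s \<cdot> x) \<longleftrightarrow> a r \<in> inversions x"
        using less.prems r assms(1) \<open>?t \<noteq> a s\<close> by (simp add: inversions_a_mult W_simps)
      ultimately have "?t \<in> inversions x" using r less.prems(2) by simp
      then have "a r \<in> inversions (a s \<cdot> x)"
        using \<open>r \<noteq> s\<close> less.prems r assms(1) by (simp add: inversions_a_mult)
      moreover have "a s \<in> inversions (a s \<cdot> x)"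
        using False less.prems assms(1) by (simp add: descent_iff)
      ultimately show False
        using descents_adjacent[of r s "a s \<cdot> x"] \<open>r \<noteq> s\<close> nE r assms(1) less.prems by simp
    qed
    then show ?thesis using step[of r] r by (simp add: star_def insert_commute)
  qed
qed

lemma a_commute_iff:
  assumes "v \<in> V" "w \<in> V"
  shows "a v \<cdot> a w = a w \<cdot> a v \<longleftrightarrow> v = w \<or> {v, w} \<in> E"
proof
  assume "a v \<cdot> a w = a w \<cdot> a v"
  then have "a v \<in> special (star V E w)" using assms centralizer_a by simp
  then show "v = w \<or> {v, w} \<in> E" using assms by (auto simp: star_def insert_commute)
qed (use a_commute in auto)

lemma special_INT:
  assumes "finite U" "U \<noteq> {}" "\<And>u. u \<in> U \<Longrightarrow> x \<in> special (B u)"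
  shows "x \<in> special (\<Inter>u \<in> U. B u)"
  using assms
proof (induction rule: finite_ne_induct)
  case (insert u U)
  then have "x \<in> special (B u \<inter> (\<Inter>u \<in> U. B u))" by (intro special_Int) blast+
  then show ?case by simp
qed simp

lemma special_singleton: "v \<in> V \<Longrightarrow> x \<in> special {v} \<Longrightarrow> x = \<one>\<^bsub>W\<^esub> \<or> x = a v"
proof -
  assume v: "v \<in> V" and x: "x \<in> special {v}"
  have "retraction {v} y = \<one>\<^bsub>W\<^esub> \<or> retraction {v} y = a v" if "y \<in> carrier W" for y
    using that
  proof (induction rule: W_inv_induct)
    case (mult u y)
    then show ?case using v by (cases "u = v"; elim disjE) (simp_all add: retraction_a)
  qed simp
  moreover have "x \<in> carrier W" "retraction {v} x = x" using x by (simp_all add: special_def)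
  ultimately show ?thesis by metis
qed

subsection \<open>Involutions\<close>

text \<open>The star subgroup is generated by its central involution \<open>a s\<close> and the
  link; which of the two cosets of the link subgroup contains \<open>x\<close> is seen from whether
  \<open>a s\<close> is an inversion.\<close>

lemma special_star_cases:
  assumes "s \<in> V" "x \<in> special (star V E s)" "a s \<notin> inversions x"
  shows "x \<in> special (star V E s - {s})"
proof -
  let ?L = "star V E s - {s}"
  have cases: "retraction (star V E s) y = retraction ?L y \<or>
      retraction (star V E s) y = a s \<cdot> retraction ?L y" if "y \<in> carrier W" for y
    using that
  proof (induction rule: W_inv_induct)
    case (mult u y)
    have sS: "s \<in> star V E s" by (simp add: star_def)
    have "a u \<cdot> (a s \<cdot> z) = a s \<cdot> (a u \<cdot> z)" if "u \<in> ?L" "z \<in> carrier W" for z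
    proof -
      have "a u \<cdot> a s = a s \<cdot> a u" using that a_commute[of s u] by (auto simp: star_def)
      then show ?thesis using that mult assms(1) by (simp flip: W.m_assoc)
    qed
    moreover have "retraction ?L y \<in> carrier W" using mult by simp
    ultimately show ?case
      using mult.hyps mult.IH assms(1) sS
      by (cases "u = s"; cases "u \<in> star V E s") (auto simp only: retraction_a retraction_simps W_cancel W.l_one a_closed Diff_iff singleton_iff if_True if_False simp_thms)
  qed simp
  have x: "x \<in> carrier W" "retraction (star V E s) x = x"
    using assms(2) by (simp_all add: special_def)
  let ?y = "retraction ?L x"
  have y: "?y \<in> special ?L" using retraction_special x by simp
  then have "a s \<notin> inversions ?y"
    using inversions_special[OF y] a_special[OF assms(1), of ?L] by blast
  then have "a s \<in> inversions (a s \<cdot> ?y)" using assms(1) x by (simp add: descent_iff)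
  then have "x \<noteq> a s \<cdot> ?y" using assms(3) by metis
  then have "x = ?y" using cases[OF x(1)] x(2) by metis
  then show ?thesis using y by metis
qed

definition clique_word :: "'v list \<Rightarrow> bool" where
  "clique_word ds \<longleftrightarrow> distinct ds \<and> set ds \<subseteq> V \<and> (\<forall>d \<in> set ds. \<forall>e \<in> set ds. d \<noteq> e \<longrightarrow> {d, e} \<in> E)"

lemma clique_word_Cons:
  "clique_word (s # ds) \<longleftrightarrow> s \<in> V \<and> clique_word ds \<and> set ds \<subseteq> star V E s - {s}"
proof
  assume "clique_word (s # ds)"
  then show "s \<in> V \<and> clique_word ds \<and> set ds \<subseteq> star V E s - {s}"
    by (simp add: clique_word_def star_def subset_iff) metis
next
  assume *: "s \<in> V \<and> clique_word ds \<and> set ds \<subseteq> star V E s - {s}"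
  then have "{s, d} \<in> E" "{d, s} \<in> E" if "d \<in> set ds" for d
    using that by (auto simp: star_def insert_commute)
  then show "clique_word (s # ds)" using * by (auto simp: clique_word_def)
qed

text \<open>
  If \<open>x\<close> is an involution with descent \<open>s\<close>, either conjugation by \<open>s\<close> shortens \<open>x\<close> or \<open>s\<close> commutes
  with \<open>x\<close> and can be split off.
\<close>

lemma involution_conj_clique:
  assumes "A \<subseteq> V" "x \<in> special A" "x \<cdot> x = \<one>\<^bsub>W\<^esub>"
  shows "\<exists>g ds. g \<in> special A \<and> clique_word ds \<and> set ds \<subseteq> A \<and> x = g \<cdot> wp ds \<cdot> inv\<^bsub>W\<^esub> g"
  using assms
proof (induction "len x" arbitrary: x A rule: less_induct)
  case less
  have xc: "x \<in> carrier W" using less.prems(2) by (rule special_carrier)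
  have xinv: "inv\<^bsub>W\<^esub> x = x" using less.prems(3) xc by (simp add: W.inv_equality)
  show ?case
  proof (cases "x = \<one>\<^bsub>W\<^esub>")
    case True
    then show ?thesis
      by (intro exI[of _ "\<one>\<^bsub>W\<^esub>"] exI[of _ "[]"]) (simp add: clique_word_def)
  next
    case False
    then obtain s where s: "s \<in> V" "a s \<in> inversions x" using ex_descent xc by blast
    have sA: "s \<in> A" using inversions_special[OF less.prems(2)] s by auto
    show ?thesis
    \<comment> \<open>If so, \<open>s\<close> can be removed on both sides, and the conjugate is
      shorter than \<open>x\<close>.\<close>
    proof (cases "a s \<in> inversions (x \<cdot> a s)")
      case True
      let ?y = "a s \<cdot> (x \<cdot> a s)"
      have "len ?y < len (x \<cdot> a s)" using exchange[OF _ True] xc s by simp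
      also have "\<dots> = len (a s \<cdot> x)"
        using len_inv[of "x \<cdot> a s"] xc s xinv by (simp add: W.inv_mult_group)
      also have "\<dots> < len x" using exchange[OF xc s(2)] .
      finally have "len ?y < len x" .
      moreover have "?y \<in> special A" using less.prems s sA by simp
      moreover have "?y \<cdot> ?y = \<one>\<^bsub>W\<^esub>"
      proof -
        have "?y \<cdot> ?y = a s \<cdot> (x \<cdot> x) \<cdot> a s" using xc s by (simp add: W_simps)
        then show ?thesis using less.prems(3) s by simp
      qed
      ultimately obtain g ds where g: "g \<in> special A" "clique_word ds" "set ds \<subseteq> A"
        "?y = g \<cdot> wp ds \<cdot> inv\<^bsub>W\<^esub> g"
        using less.hyps less.prems(1) by blast
      have gc: "g \<in> carrier W" "wp ds \<in> carrier W"
        using g(1,3) less.prems(1) special_carrier by auto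
      have "x = a s \<cdot> ?y \<cdot> a s" using xc s by (simp add: W_simps)
      also have "\<dots> = (a s \<cdot> g) \<cdot> wp ds \<cdot> inv\<^bsub>W\<^esub> (a s \<cdot> g)"
        unfolding g(4) using gc s by (simp add: W_simps)
      finally show ?thesis using g s sA
        by (intro exI[of _ "a s \<cdot> g"] exI[of _ ds]) simp
    next
      case False
      \<comment> \<open>The step from \<open>x\<close> to \<open>x \<cdot> a s\<close> crosses only
        one wall; as it loses the inversion \<open>a s\<close>, that wall belongs to
        \<open>a s\<close>.\<close>
      then have "a s = x \<cdot> a s \<cdot> inv\<^bsub>W\<^esub> x" using xc s by (simp add: inversions_mult_a)
      then have comm: "x \<cdot> a s = a s \<cdot> x" using xc s by (metis W.inv_solve_right W.m_closed a_closed)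
      let ?L = "star V E s - {s}"
      let ?y = "a s \<cdot> x"
      have ly: "len ?y < len x" using exchange[OF xc s(2)] .
      have "?y \<cdot> a s = a s \<cdot> ?y" using comm xc s by (simp add: W_simps)
      then have "?y \<in> special (star V E s)" using centralizer_a xc s by simp
      moreover have "a s \<notin> inversions ?y" using s xc descent_iff[of s ?y] by simp
      ultimately have "?y \<in> special ?L" using special_star_cases s by simp
      \<comment> \<open>Keeping track of \<open>A\<close> in the induction puts the conjugator
        \<open>g\<close> into the link subgroup of \<open>s\<close>. So \<open>g\<close> commutes
        with \<open>a s\<close>, which can be moved inside the conjugation.\<close>
      then have yL: "?y \<in> special (A \<inter> ?L)" using less.prems(2) sA s by (intro special_Int) simp_all
      have "?y \<cdot> ?y = \<one>\<^bsub>W\<^esub>"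
      proof -
        have "?y \<cdot> ?y = a s \<cdot> (x \<cdot> a s) \<cdot> x" using xc s by (simp add: W_simps)
        also have "\<dots> = x \<cdot> x" unfolding comm using xc s by (simp add: W_simps)
        finally show ?thesis using less.prems(3) by simp
      qed
      then obtain g ds where g: "g \<in> special (A \<inter> ?L)" "clique_word ds" "set ds \<subseteq> A \<inter> ?L"
        "?y = g \<cdot> wp ds \<cdot> inv\<^bsub>W\<^esub> g"
        using less.hyps[OF ly _ yL] less.prems(1) by blast
      have gc: "g \<in> carrier W" "wp ds \<in> carrier W"
        using g(1,3) less.prems(1) special_carrier by auto
      have "g \<in> special (star V E s)" by (rule special_mono[OF g(1)]) blast
      then have "g \<cdot> a s = a s \<cdot> g" using special_star_commute s by simp
      then have "a s \<cdot> (g \<cdot> z) = g \<cdot> (a s \<cdot> z)" if "z \<in> carrier W" for z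
        using gc s that by (simp flip: W.m_assoc)
      then have "a s \<cdot> ?y = g \<cdot> wp (s # ds) \<cdot> inv\<^bsub>W\<^esub> g"
        unfolding g(4) using gc s by (simp add: W_simps)
      then have "x = g \<cdot> wp (s # ds) \<cdot> inv\<^bsub>W\<^esub> g" using xc s by simp
      moreover have "g \<in> special A" by (rule special_mono[OF g(1)]) blast
      moreover have "clique_word (s # ds)" using g s by (simp add: clique_word_Cons)
      ultimately show ?thesis using g sA by (intro exI[of _ g] exI[of _ "s # ds"]) auto
    qed
  qed
qed

lemma clique_word_commute:
  "clique_word ds \<Longrightarrow> d \<in> set ds \<Longrightarrow> wp ds \<cdot> a d = a d \<cdot> wp ds"
proof -
  assume ds: "clique_word ds" "d \<in> set ds"
  have "set es \<subseteq> set ds \<Longrightarrow> wp es \<cdot> a d = a d \<cdot> wp es" for es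
  proof (induction es)
    case Nil
    then show ?case using ds by (auto simp: clique_word_def)
  next
    case (Cons e es)
    then have "a e \<cdot> a d = a d \<cdot> a e"
      using ds a_commute[of e d] by (cases "e = d") (auto simp: clique_word_def)
    moreover have "set es \<subseteq> V" "e \<in> V" "d \<in> V" using ds Cons.prems by (auto simp: clique_word_def)
    ultimately show ?case using Cons a_mult_commute[of e "a d" "wp es"] by simp
  qed
  then show ?thesis by simp
qed

text \<open>Letters of a clique fix one another under conjugation, so each contributes just itself,
  and distinct letters do not cancel.\<close>

lemma inversions_clique_word: "clique_word ds \<Longrightarrow> inversions (wp ds) = a ` set ds"
proof (induction ds)
  case (Cons s ds)
  then have s: "s \<in> V" "clique_word ds" "set ds \<subseteq> star V E s - {s}" and V: "set ds \<subseteq> V"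
    using Cons.prems by (simp_all add: clique_word_Cons) (simp add: clique_word_def)
  have fix_d: "a s \<cdot> a d \<cdot> a s = a d" if "d \<in> set ds" for d
  proof -
    have "{s, d} \<in> E" "d \<in> V" using that s(3) by (auto simp: star_def)
    then show ?thesis using a_commute[of s d] s(1) by (simp add: W_simps)
  qed
  have iff: "t \<in> inversions (a s \<cdot> wp ds) \<longleftrightarrow> t \<in> insert (a s) (a ` set ds)" if t: "t \<in> carrier W" for t
  proof -
    have "a s \<cdot> t \<cdot> a s \<in> a ` set ds \<longleftrightarrow> t \<in> a ` set ds"
    proof
      assume "a s \<cdot> t \<cdot> a s \<in> a ` set ds"
      then obtain d where d: "d \<in> set ds" "a s \<cdot> t \<cdot> a s = a d" by blast
      have "t = a s \<cdot> (a s \<cdot> t \<cdot> a s) \<cdot> a s" using t s by (simp add: W_simps)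
      then have "t = a d" using d fix_d by simp
      then show "t \<in> a ` set ds" using d by blast
    qed (use fix_d in auto)
    moreover have "a s \<notin> a ` set ds"
    proof
      assume "a s \<in> a ` set ds"
      then obtain d where "d \<in> set ds" "a s = a d" by blast
      then show False using s V a_eq_iff[of s d] by blast
    qed
    ultimately show ?thesis
      using inversions_a_mult[OF s(1) wp_closed[OF V] t] Cons.IH s(2) by auto
  qed
  have sub: "insert (a s) (a ` set ds) \<subseteq> carrier W" using s(1) V by auto
  have "inversions (a s \<cdot> wp ds) = insert (a s) (a ` set ds)"
  proof (rule subset_antisym; rule subsetI)
    fix t assume t: "t \<in> inversions (a s \<cdot> wp ds)"
    show "t \<in> insert (a s) (a ` set ds)" by (rule iffD1[OF iff[OF inversions_closed[OF t]] t])
  next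
    fix t assume t: "t \<in> insert (a s) (a ` set ds)"
    show "t \<in> inversions (a s \<cdot> wp ds)" by (rule iffD2[OF iff[OF subsetD[OF sub t]] t])
  qed
  then show ?case by simp
qed simp

text \<open>Once descents in the clique are stripped, no letter is an inversion of \<open>x\<close>.
  Comparing the inversions of \<open>wp ds \<cdot> x\<close> and \<open>x \<cdot> wp ds\<close>
  shows that the conjugate of \<open>a d\<close> by the inverse of \<open>x\<close> is again a
  letter; by parity it is \<open>a d\<close> itself.\<close>

lemma centralizer_clique_word:
  assumes "clique_word ds" "x \<in> carrier W" "x \<cdot> wp ds = wp ds \<cdot> x" "d \<in> set ds"
  shows "x \<cdot> a d = a d \<cdot> x"
  using assms(2-)
proof (induction "len x" arbitrary: x d rule: less_induct)
  case less
  have V: "set ds \<subseteq> V" using assms(1) by (simp add: clique_word_def)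
  then have wc: "wp ds \<in> carrier W" by simp
  show ?case
  proof (cases "\<exists>e \<in> set ds. a e \<in> inversions x")
    case True
    then obtain e where e: "e \<in> set ds" "a e \<in> inversions x" by blast
    have eV: "e \<in> V" "d \<in> V" using e V less.prems by auto
    have "a e \<cdot> wp ds = wp ds \<cdot> a e" using clique_word_commute[OF assms(1) e(1)] by simp
    then have "(a e \<cdot> x) \<cdot> wp ds = wp ds \<cdot> (a e \<cdot> x)"
      using a_mult_commute[of e "wp ds" x] eV wc less.prems by simp
    then have "(a e \<cdot> x) \<cdot> a d = a d \<cdot> (a e \<cdot> x)"
      using less.hyps[OF exchange[OF less.prems(1) e(2)]] less.prems eV by simp
    moreover have "a e \<cdot> a d = a d \<cdot> a e"
      using e(1) less.prems(3) assms(1) a_commute[of e d] by (cases "e = d") (auto simp: clique_word_def)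
    ultimately show ?thesis
      using a_mult_commute[of e "a d" "a e \<cdot> x"] eV less.prems by simp
  next
    case False
    have dV: "d \<in> V" using V less.prems by auto
    have "inv\<^bsub>W\<^esub> (wp ds) \<cdot> a d \<cdot> wp ds = a d"
      using wc dV by (simp add: W.m_assoc clique_word_commute[OF assms(1) less.prems(3), symmetric])
    then have "a d \<in> inversions (wp ds \<cdot> x)"
      using inversions_mult[OF wc less.prems(1) a_closed[OF dV]] False less.prems
      by (simp add: inversions_clique_word[OF assms(1)])
    then have "a d \<in> inversions (x \<cdot> wp ds)" using less.prems by simp
    then have "inv\<^bsub>W\<^esub> x \<cdot> a d \<cdot> x \<in> inversions (wp ds)"
      using inversions_mult[OF less.prems(1) wc a_closed[OF dV]] False less.prems by simp
    then obtain e where e: "e \<in> set ds" "inv\<^bsub>W\<^esub> x \<cdot> a d \<cdot> x = a e"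
      by (auto simp: inversions_clique_word[OF assms(1)])
    then have "d = e"
      using conj_a_eq[of d e "inv\<^bsub>W\<^esub> x" "\<one>\<^bsub>W\<^esub>"] V dV less.prems(1) by auto
    then have "x \<cdot> (inv\<^bsub>W\<^esub> x \<cdot> a d \<cdot> x) = x \<cdot> a d" using e by simp
    then show ?thesis using less.prems(1) dV by (simp add: W_simps)
  qed
qed

subsection \<open>Half-spaces\<close>

definition reflections where
  "reflections = {g \<cdot> a v \<cdot> inv\<^bsub>W\<^esub> g | g v. g \<in> carrier W \<and> v \<in> V}"

lemma reflections_closed: "t \<in> reflections \<Longrightarrow> t \<in> carrier W"
  by (auto simp: reflections_def)

lemma reflection_sq: "t \<in> reflections \<Longrightarrow> t \<cdot> t = \<one>\<^bsub>W\<^esub>"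
  by (auto simp: reflections_def W_simps)

lemma reflection_inv: "t \<in> reflections \<Longrightarrow> inv\<^bsub>W\<^esub> t = t"
  by (simp add: W.inv_equality reflection_sq reflections_closed)

text \<open>Compare the inversions of the two sides of \<open>t \<cdot> g = g \<cdot> a v\<close>:
  on the left, conjugation by \<open>t\<close> fixes \<open>u\<close>; on the right, only the wall
  of \<open>t\<close> is crossed.\<close>

lemma inversions_reflection:
  assumes t: "t \<in> reflections" and u: "u \<in> carrier W" "u \<cdot> t = t \<cdot> u"
  shows "u \<in> inversions t \<longleftrightarrow> u = t"
proof -
  obtain g v where gv: "t = g \<cdot> a v \<cdot> inv\<^bsub>W\<^esub> g" "g \<in> carrier W" "v \<in> V"
    using t by (auto simp: reflections_def)
  have tc: "t \<in> carrier W" by (rule reflections_closed[OF t])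
  have tg: "t \<cdot> g = g \<cdot> a v" using gv by (simp add: W_simps)
  have "inv\<^bsub>W\<^esub> t \<cdot> u \<cdot> t = u" using u tc by (simp add: W.m_assoc)
  then have "u \<in> inversions (t \<cdot> g) \<longleftrightarrow> (u \<in> inversions t) \<noteq> (u \<in> inversions g)"
    using inversions_mult[OF tc gv(2) u(1)] by simp
  moreover have "u \<in> inversions (g \<cdot> a v) \<longleftrightarrow> (u \<in> inversions g) \<noteq> (u = t)"
    using inversions_mult_a[OF gv(2,3) u(1)] gv(1) by simp
  ultimately show ?thesis using tg by auto
qed

lemma reflection_side:
  assumes t: "t \<in> reflections" and u: "u \<in> carrier W" "u \<cdot> t = t \<cdot> u" and x: "x \<in> carrier W"
  shows "u \<in> inversions (t \<cdot> x) \<longleftrightarrow> (u = t) \<noteq> (u \<in> inversions x)"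
proof -
  have tc: "t \<in> carrier W" by (rule reflections_closed[OF t])
  have "inv\<^bsub>W\<^esub> t \<cdot> u \<cdot> t = u" using u tc by (simp add: W.m_assoc)
  then show ?thesis
    using inversions_mult[OF tc x u(1)] inversions_reflection[OF t u] by simp
qed

text \<open>The chambers \<open>1\<close>, \<open>t\<close>, \<open>u\<close> and
  \<open>t \<cdot> u\<close> realise the four combinations.\<close>

lemma commuting_quadrants:
  assumes t: "t \<in> reflections" "u \<in> reflections" "t \<noteq> u" "t \<cdot> u = u \<cdot> t"
  shows "\<exists>x \<in> carrier W. (t \<in> inversions x) = b \<and> (u \<in> inversions x) = c"
proof -
  have cl: "t \<in> carrier W" "u \<in> carrier W" using t reflections_closed by auto
  let ?x = "(if b then t else \<one>\<^bsub>W\<^esub>) \<cdot> (if c then u else \<one>\<^bsub>W\<^esub>)"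
  have "t \<in> inversions t" "u \<in> inversions u" "t \<notin> inversions u" "u \<notin> inversions t"
    using inversions_reflection[OF t(1), of t] inversions_reflection[OF t(1), of u]
      inversions_reflection[OF t(2), of t] inversions_reflection[OF t(2), of u] cl t(3,4) by simp_all
  moreover from this have "t \<in> inversions (t \<cdot> u)" "u \<in> inversions (t \<cdot> u)"
    using reflection_side[OF t(1), of t u] reflection_side[OF t(1), of u u] cl t(3,4) by simp_all
  ultimately have "?x \<in> carrier W" "(t \<in> inversions ?x) = b" "(u \<in> inversions ?x) = c"
    using cl by (cases b; cases c; simp)+
  then show ?thesis by blast
qed

text \<open>A gallery from \<open>x\<close> to \<open>y\<close> inside a half-space of \<open>u\<close> crosses the wall of \<open>t\<close> at some chamber \<open>z\<close>.\<close>

lemma crossing_chamber: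
  assumes "x \<in> carrier W" "y \<in> carrier W" and tu: "t \<in> carrier W" "u \<in> carrier W"
    and "(t \<in> inversions x) \<noteq> (t \<in> inversions y)"
    and "(u \<in> inversions x) = b" "(u \<in> inversions y) = b"
  shows "\<exists>z \<in> carrier W. \<exists>v \<in> V. (u \<in> inversions z) = b \<and> z \<cdot> a v \<cdot> inv\<^bsub>W\<^esub> z = t"
  using assms
proof (induction "len (inv\<^bsub>W\<^esub> x \<cdot> y)" arbitrary: x rule: less_induct)
  case less
  let ?w = "inv\<^bsub>W\<^esub> x \<cdot> y"
  have wc: "?w \<in> carrier W" using less.prems by simp
  have y: "y = x \<cdot> ?w" using less.prems by simp
  have "?w \<noteq> \<one>\<^bsub>W\<^esub>"
  proof
    assume "?w = \<one>\<^bsub>W\<^esub>"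
    then have "x = y" using y less.prems(1) by simp
    then show False using less.prems by simp
  qed
  then obtain v where v: "v \<in> V" "a v \<in> inversions ?w" using ex_descent wc by blast
  let ?x = "x \<cdot> a v" and ?t = "x \<cdot> a v \<cdot> inv\<^bsub>W\<^esub> x"
  have side: "s \<in> inversions ?x \<longleftrightarrow> (s \<in> inversions x) \<noteq> (s = ?t)" if "s \<in> carrier W" for s
    using inversions_mult_a less.prems v that by simp
  have "inv\<^bsub>W\<^esub> x \<cdot> ?t \<cdot> x = a v" using less.prems v by (simp add: W_simps)
  \<comment> \<open>The first wall crossed separates \<open>x\<close> from \<open>y\<close>, whereas
    the wall of \<open>u\<close> does not.\<close>
  then have "?t \<in> inversions y \<longleftrightarrow> ?t \<notin> inversions x"
    using inversions_mult[of x ?w ?t] v less.prems wc y by simp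
  then have u: "u \<noteq> ?t" using less.prems(6,7) by metis
  show ?case
  proof (cases "t = ?t")
    case True
    then show ?thesis using less.prems v by blast
  next
    case False
    have "inv\<^bsub>W\<^esub> ?x \<cdot> y = a v \<cdot> ?w" using less.prems v by (simp add: W_simps)
    then have "len (inv\<^bsub>W\<^esub> ?x \<cdot> y) < len ?w" using exchange[OF wc v(2)] by simp
    then show ?thesis
      using less.hyps[of ?x] less.prems v side u False by simp
  qed
qed

text \<open>If all four quadrants had chambers, the wall of \<open>t\<close> would be crossed on
  both sides of the wall of \<open>u\<close>, at \<open>y\<close> and at
  \<open>z = y \<cdot> c\<close>. Then \<open>c\<close> centralises \<open>a v\<close>, so it lies
  in a star subgroup together with its inversions. One of these is \<open>u\<close> conjugated by
  the inverse of \<open>y\<close>; it commutes with \<open>a v\<close>, hence \<open>u\<close> with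
  \<open>t\<close>.\<close>

lemma noncommuting_quadrant:
  assumes t: "t \<in> reflections" "u \<in> reflections" and nc: "t \<cdot> u \<noteq> u \<cdot> t"
  shows "\<exists>b c. \<forall>x \<in> carrier W. \<not> ((t \<in> inversions x) = b \<and> (u \<in> inversions x) = c)"
proof (rule ccontr)
  assume "\<not> ?thesis"
  then have all: "\<exists>x \<in> carrier W. (t \<in> inversions x) = b \<and> (u \<in> inversions x) = c" for b c
    by blast
  have cl: "t \<in> carrier W" "u \<in> carrier W" using t reflections_closed by auto
  have "\<exists>z \<in> carrier W. \<exists>v \<in> V. (u \<in> inversions z) = c \<and> z \<cdot> a v \<cdot> inv\<^bsub>W\<^esub> z = t" for c
    using all[of True c] all[of False c] crossing_chamber[OF _ _ cl] by metis
  then obtain y z v w where yz: "y \<in> carrier W" "z \<in> carrier W" "v \<in> V" "w \<in> V"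
    "u \<in> inversions y" "u \<notin> inversions z"
    "y \<cdot> a v \<cdot> inv\<^bsub>W\<^esub> y = t" "z \<cdot> a w \<cdot> inv\<^bsub>W\<^esub> z = t"
    by metis
  have "v = w" using conj_a_eq yz by metis
  define c where "c = inv\<^bsub>W\<^esub> y \<cdot> z"
  have c: "c \<in> carrier W" "z = y \<cdot> c" using yz by (auto simp: c_def)
  have "y \<cdot> (c \<cdot> a v) = y \<cdot> (a v \<cdot> c)"
  proof -
    have "t \<cdot> y = y \<cdot> a v" unfolding yz(7)[symmetric] using yz(1,3) by (simp add: W_simps)
    then have "y \<cdot> (a v \<cdot> c) = t \<cdot> y \<cdot> c" using yz(1,3) c(1) by (simp add: W.m_assoc)
    also have "\<dots> = t \<cdot> z" unfolding c(2) using c(1) yz(1) cl by (simp add: W.m_assoc)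
    also have "\<dots> = z \<cdot> a v"
      unfolding yz(8)[symmetric] using yz(2-4) \<open>v = w\<close> by (simp add: W_simps)
    also have "\<dots> = y \<cdot> (c \<cdot> a v)" unfolding c(2) using c(1) yz(1,3) by (simp add: W.m_assoc)
    finally show ?thesis by simp
  qed
  then have "c \<cdot> a v = a v \<cdot> c" using W_lcancel[of y] c yz by simp
  then have "c \<in> special (star V E v)" using centralizer_a c yz by simp
  moreover have uy: "inv\<^bsub>W\<^esub> y \<cdot> u \<cdot> y \<in> inversions c"
    using inversions_mult[of y c u] c yz cl by simp
  ultimately have "inv\<^bsub>W\<^esub> y \<cdot> u \<cdot> y \<in> special (star V E v)"
    using inversions_special by blast
  then have "(inv\<^bsub>W\<^esub> y \<cdot> u \<cdot> y) \<cdot> a v = a v \<cdot> (inv\<^bsub>W\<^esub> y \<cdot> u \<cdot> y)"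
    using special_star_commute yz by simp
  then have "y \<cdot> ((inv\<^bsub>W\<^esub> y \<cdot> u \<cdot> y) \<cdot> a v) \<cdot> inv\<^bsub>W\<^esub> y = y \<cdot> (a v \<cdot> (inv\<^bsub>W\<^esub> y \<cdot> u \<cdot> y)) \<cdot> inv\<^bsub>W\<^esub> y"
    by simp
  then have "u \<cdot> (y \<cdot> a v \<cdot> inv\<^bsub>W\<^esub> y) = (y \<cdot> a v \<cdot> inv\<^bsub>W\<^esub> y) \<cdot> u"
    using yz(1-4) cl by (simp add: W_simps)
  then show False using nc yz by metis
qed

text \<open>The chambers \<open>g\<close> and \<open>g \<cdot> a v\<close> differ in the side of
  \<open>t\<close> but not in that of \<open>u\<close>. So two empty quadrants agree in the side of
  \<open>u\<close>; if they disagreed in that of \<open>t\<close>, a whole half-space of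
  \<open>u\<close> would be empty.\<close>

lemma noncommuting_quadrant_unique:
  assumes t: "t \<in> reflections" "u \<in> reflections" and nc: "t \<cdot> u \<noteq> u \<cdot> t"
    and bc: "\<And>x. x \<in> carrier W \<Longrightarrow> \<not> ((t \<in> inversions x) = b \<and> (u \<in> inversions x) = c)"
    and bc': "\<And>x. x \<in> carrier W \<Longrightarrow> \<not> ((t \<in> inversions x) = b' \<and> (u \<in> inversions x) = c')"
  shows "b = b' \<and> c = c'"
proof -
  have cl: "t \<in> carrier W" "u \<in> carrier W" using t reflections_closed by auto
  have "t \<noteq> u" using nc by auto
  obtain g v where gv: "t = g \<cdot> a v \<cdot> inv\<^bsub>W\<^esub> g" "g \<in> carrier W" "v \<in> V"
    using t by (auto simp: reflections_def)
  have both: "\<exists>x \<in> carrier W. (r \<in> inversions x) = e" if "r \<in> reflections" for r e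
    using inversions_reflection[OF that reflections_closed[OF that]] reflections_closed[OF that]
    by (cases e) (auto intro: bexI[of _ "\<one>\<^bsub>W\<^esub>"])
  have "(t \<in> inversions (g \<cdot> a v)) = (t \<notin> inversions g)" "(u \<in> inversions (g \<cdot> a v)) = (u \<in> inversions g)"
    using inversions_mult_a[OF gv(2,3)] gv(1) cl \<open>t \<noteq> u\<close> by auto
  moreover have "g \<cdot> a v \<in> carrier W" using gv by simp
  ultimately show ?thesis
    using both[OF t(1)] both[OF t(2)] bc bc' gv(2) by metis
qed

end

section \<open>Automorphisms of right-angled Coxeter groups\<close>

context racg
begin

text \<open>A central element lies in the subgroup of every star, hence in that of their
  intersection, which is empty because non-adjacency is symmetric.\<close>

lemma center_trivial:
  assumes "V \<noteq> {}" and "\<And>v. v \<in> V \<Longrightarrow> \<exists>w \<in> V. w \<notin> star V E v"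
  shows "center W = {\<one>\<^bsub>W\<^esub>}"
proof -
  have "z = \<one>\<^bsub>W\<^esub>" if z: "z \<in> carrier W" "\<And>g. g \<in> carrier W \<Longrightarrow> z \<cdot> g = g \<cdot> z" for z
  proof -
    have "z \<in> special (star V E v)" if "v \<in> V" for v
      using centralizer_a that z by simp
    then have "z \<in> special (\<Inter>v \<in> V. star V E v)"
      by (rule special_INT[OF finite_V assms(1)])
    moreover have "(\<Inter>v \<in> V. star V E v) = {}"
    proof -
      have False if x: "\<And>v. v \<in> V \<Longrightarrow> x \<in> star V E v" for x
      proof -
        have "x \<in> V" using x assms(1) by (auto simp: star_def)
        then obtain w where w: "w \<in> V" "w \<notin> star V E x" using assms(2) by blast
        then show False using x[OF w(1)] \<open>x \<in> V\<close> by (auto simp: star_def insert_commute)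
      qed
      then show ?thesis by blast
    qed
    ultimately show ?thesis by (simp add: special_empty)
  qed
  then show ?thesis by (auto simp: center_def)
qed

lemma inner_autoI:
  assumes f: "f \<in> auto W" and g: "g \<in> carrier W"
    and eq: "\<And>v. v \<in> V \<Longrightarrow> f (a v) = g \<cdot> a v \<cdot> inv\<^bsub>W\<^esub> g"
  shows "f \<in> inner_auto W"
proof -
  have hom: "f \<in> hom W W" and ext: "f \<in> extensional (carrier W)"
    using f by (auto simp: auto_def Bij_def)
  have "f x = g \<cdot> x \<cdot> inv\<^bsub>W\<^esub> g" if "x \<in> carrier W" for x
    using that
  proof (induction rule: W_inv_induct)
    case one
    then show ?case using hom_one[OF hom W.is_group W.is_group] g by simp
  next
    case (mult v y)
    then show ?case using hom_mult[OF hom, of "a v" y] eq g by (simp add: W_simps)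
  qed
  then have "f = (\<lambda>x \<in> carrier W. g \<cdot> x \<cdot> inv\<^bsub>W\<^esub> g)"
    using ext by (intro extensionalityI[of f "carrier W"]) auto
  then show ?thesis using g unfolding inner_auto_def by blast
qed

text \<open>\<open>y\<close> commutes with \<open>a u\<close> for all \<open>u\<close> in the star
  of \<open>v\<close>, so it lies in the subgroup of the intersection of their stars. A vertex
  \<open>w\<close> of this intersection satisfies \<open>star V E v \<subseteq> star V E w\<close>,
  so it is \<open>v\<close>.\<close>

lemma double_centralizer_a:
  assumes anti: "\<And>v w. v \<in> V \<Longrightarrow> w \<in> V \<Longrightarrow> v \<noteq> w \<Longrightarrow> \<not> star V E v \<subseteq> star V E w"
    and v: "v \<in> V" and y: "y \<in> carrier W"
    and comm: "\<And>x. x \<in> carrier W \<Longrightarrow> x \<cdot> a v = a v \<cdot> x \<Longrightarrow> y \<cdot> x = x \<cdot> y"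
  shows "y = \<one>\<^bsub>W\<^esub> \<or> y = a v"
proof -
  have sV: "star V E v \<subseteq> V" using v by (auto simp: star_def)
  have "y \<in> special (star V E u)" if "u \<in> star V E v" for u
  proof -
    have "a u \<cdot> a v = a v \<cdot> a u" using that sV v a_commute_iff[of u v]
      by (auto simp: star_def insert_commute)
    moreover have "u \<in> V" using that sV by blast
    ultimately have "y \<cdot> a u = a u \<cdot> y" by (intro comm) simp
    then show ?thesis using centralizer_a[OF \<open>u \<in> V\<close> y] by simp
  qed
  then have "y \<in> special (\<Inter>u \<in> star V E v. star V E u)"
    using finite_subset[OF sV finite_V] by (intro special_INT) (auto simp: star_def)
  moreover have "(\<Inter>u \<in> star V E v. star V E u) \<subseteq> {v}"
  proof
    fix w assume w: "w \<in> (\<Inter>u \<in> star V E v. star V E u)"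
    moreover have "v \<in> star V E v" by (simp add: star_def)
    ultimately have "w \<in> V" using sV by blast
    have "star V E v \<subseteq> star V E w"
      using w sV by (auto simp: star_def insert_commute)
    then show "w \<in> {v}" using anti[OF v \<open>w \<in> V\<close>] by blast
  qed
  ultimately have "y \<in> special {v}" by (rule special_mono)
  then show ?thesis using special_singleton v by blast
qed

text \<open>Write the image as a conjugate of a clique product and pick a letter \<open>d\<close>.
  What commutes with the product commutes with \<open>a d\<close>, so the preimage \<open>y\<close>
  of the corresponding conjugate of \<open>a d\<close> is in the double centraliser of
  \<open>a v\<close>; as \<open>y\<close> is not the identity, it is \<open>a v\<close>.\<close>

lemma auto_reflection:
  assumes anti: "\<And>v w. v \<in> V \<Longrightarrow> w \<in> V \<Longrightarrow> v \<noteq> w \<Longrightarrow> \<not> star V E v \<subseteq> star V E w"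
    and f: "f \<in> auto W" and v: "v \<in> V"
  shows "f (a v) \<in> reflections"
proof -
  have hom: "f \<in> hom W W" and bij: "bij_betw f (carrier W) (carrier W)"
    using f by (auto simp: auto_def Bij_def)
  note fm = hom_mult[OF hom]
  have fc: "f x \<in> carrier W" if "x \<in> carrier W" for x using hom_in_carrier[OF hom that] .
  have f1: "f \<one>\<^bsub>W\<^esub> = \<one>\<^bsub>W\<^esub>" using hom_one[OF hom W.is_group W.is_group] .
  have inj: "f x = f y \<longleftrightarrow> x = y" if "x \<in> carrier W" "y \<in> carrier W" for x y
    using bij that by (auto simp: bij_betw_def inj_on_def)
  let ?t = "f (a v)"
  have tc: "?t \<in> carrier W" using fc v by simp
  have "?t \<cdot> ?t = \<one>\<^bsub>W\<^esub>" using fm[of "a v" "a v"] f1 v by simp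
  then obtain g ds where g: "g \<in> carrier W" "clique_word ds" "?t = g \<cdot> wp ds \<cdot> inv\<^bsub>W\<^esub> g"
    using involution_conj_clique[of V ?t] tc by (auto simp: special_V)
  have "ds \<noteq> []"
  proof
    assume "ds = []"
    then have "?t = f \<one>\<^bsub>W\<^esub>" using g f1 by simp
    then show False using inj v by simp
  qed
  then obtain d where d: "d \<in> set ds" by fastforce
  have V: "set ds \<subseteq> V" "d \<in> V" using g(2) d by (auto simp: clique_word_def)
  let ?u = "g \<cdot> a d \<cdot> inv\<^bsub>W\<^esub> g"
  have "?u \<in> carrier W" using g V by simp
  then obtain y where y: "y \<in> carrier W" "f y = ?u"
    using bij unfolding bij_betw_def by (metis (no_types, lifting) imageE)
  have "y \<cdot> x = x \<cdot> y" if x: "x \<in> carrier W" "x \<cdot> a v = a v \<cdot> x" for x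
  proof -
    let ?z = "inv\<^bsub>W\<^esub> g \<cdot> f x \<cdot> g"
    have "f x \<cdot> ?t = ?t \<cdot> f x" using fm[of x "a v"] fm[of "a v" x] x v by simp
    then have *: "f x \<cdot> (g \<cdot> wp ds \<cdot> inv\<^bsub>W\<^esub> g) = (g \<cdot> wp ds \<cdot> inv\<^bsub>W\<^esub> g) \<cdot> f x" unfolding g(3) .
    have "?z \<cdot> wp ds = inv\<^bsub>W\<^esub> g \<cdot> (f x \<cdot> (g \<cdot> wp ds \<cdot> inv\<^bsub>W\<^esub> g)) \<cdot> g"
      using fc[OF x(1)] g(1) V by (simp add: W_simps)
    also have "\<dots> = wp ds \<cdot> ?z" unfolding * using fc[OF x(1)] g(1) V by (simp add: W_simps)
    finally have "?z \<cdot> a d = a d \<cdot> ?z"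
      using centralizer_clique_word[OF g(2) _ _ d] fc[OF x(1)] g(1) by simp
    then have "g \<cdot> (a d \<cdot> ?z) \<cdot> inv\<^bsub>W\<^esub> g = g \<cdot> (?z \<cdot> a d) \<cdot> inv\<^bsub>W\<^esub> g" by simp
    then have "?u \<cdot> f x = f x \<cdot> ?u" using fc[OF x(1)] g(1) V by (simp add: W_simps)
    then have "f (y \<cdot> x) = f (x \<cdot> y)" using fm y x by simp
    then show ?thesis using inj y x by simp
  qed
  note yx = this
  have "y = \<one>\<^bsub>W\<^esub> \<or> y = a v" by (rule double_centralizer_a[OF anti v y(1) yx])
  moreover have "y \<noteq> \<one>\<^bsub>W\<^esub>"
  proof
    assume "y = \<one>\<^bsub>W\<^esub>"
    then have "g \<cdot> a d \<cdot> inv\<^bsub>W\<^esub> g = \<one>\<^bsub>W\<^esub>" using y f1 by simp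
    then have "parity d (g \<cdot> a d \<cdot> inv\<^bsub>W\<^esub> g) = parity d \<one>\<^bsub>W\<^esub>" by simp
    then show False using V g(1) by simp
  qed
  ultimately show ?thesis using y g(1) V by (auto simp: reflections_def)
qed

end

text \<open>
  Below, \<open>side v\<close> is the value of \<open>r v \<in> inversions x\<close> on the half-space that contains no wall
  disjoint from that of \<open>r v\<close>; the preferred chambers are those avoiding all these half-spaces.
\<close>

locale racg_automorphism = racg V G E
  for V :: "'v set" and G :: "'v \<Rightarrow> ('a, 'b) monoid_scheme" and E :: "'v set set" +
  fixes f
  assumes f: "f \<in> auto W"
    and anti: "\<And>v w. v \<in> V \<Longrightarrow> w \<in> V \<Longrightarrow> v \<noteq> w \<Longrightarrow> \<not> star V E v \<subseteq> star V E w"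
    and nonempty: "\<And>v. v \<in> V \<Longrightarrow> \<exists>w \<in> V. w \<notin> star V E v"
    and nosep: "\<And>v. v \<in> V \<Longrightarrow> induced_connected E (V - star V E v)"
begin

definition r where "r v = f (a v)"

lemma f_hom: "f \<in> hom W W" and f_bij: "bij_betw f (carrier W) (carrier W)"
  using f by (auto simp: auto_def Bij_def)

lemma f_mult: "x \<in> carrier W \<Longrightarrow> y \<in> carrier W \<Longrightarrow> f (x \<cdot> y) = f x \<cdot> f y"
  by (rule hom_mult[OF f_hom])

lemma f_closed [simp]: "x \<in> carrier W \<Longrightarrow> f x \<in> carrier W"
  by (rule hom_in_carrier[OF f_hom])

lemma f_eq_iff: "x \<in> carrier W \<Longrightarrow> y \<in> carrier W \<Longrightarrow> f x = f y \<longleftrightarrow> x = y"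
  using f_bij by (auto simp: bij_betw_def inj_on_def)

lemma f_one: "f \<one>\<^bsub>W\<^esub> = \<one>\<^bsub>W\<^esub>"
  by (rule hom_one[OF f_hom W.is_group W.is_group])

lemma r_reflection: "v \<in> V \<Longrightarrow> r v \<in> reflections"
  unfolding r_def by (rule auto_reflection[OF anti f])

lemma r_closed [simp]: "v \<in> V \<Longrightarrow> r v \<in> carrier W"
  by (simp add: r_def)

lemma r_eq_iff: "v \<in> V \<Longrightarrow> w \<in> V \<Longrightarrow> r v = r w \<longleftrightarrow> v = w"
  by (simp add: r_def f_eq_iff)

lemma r_commute_iff: "v \<in> V \<Longrightarrow> w \<in> V \<Longrightarrow> r v \<cdot> r w = r w \<cdot> r v \<longleftrightarrow> v = w \<or> {v, w} \<in> E"
  by (simp add: r_def f_eq_iff flip: f_mult a_commute_iff)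

lemma r_side:
  assumes "v \<in> V" "w \<in> V" "v = w \<or> {v, w} \<in> E" "x \<in> carrier W"
  shows "r w \<in> inversions (r v \<cdot> x) \<longleftrightarrow> (v = w) \<noteq> (r w \<in> inversions x)"
proof -
  have "r w \<cdot> r v = r v \<cdot> r w" using assms r_commute_iff[of v w] by metis
  then show ?thesis
    using reflection_side[OF r_reflection[OF assms(1)] r_closed[OF assms(2)]] assms r_eq_iff[of w v]
    by auto
qed

section \<open>Empty quadrants and preferred sides\<close>

definition no_chamber where
  "no_chamber v w b c \<longleftrightarrow> (\<forall>x \<in> carrier W. \<not> ((r v \<in> inversions x) = b \<and> (r w \<in> inversions x) = c))"

lemma no_chamberD:
  "no_chamber v w b c \<Longrightarrow> x \<in> carrier W \<Longrightarrow> (r v \<in> inversions x) = b \<Longrightarrow> (r w \<in> inversions x) \<noteq> c"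
  by (auto simp: no_chamber_def)

lemma no_chamber_unique:
  assumes "v \<in> V" "w \<in> V" "w \<notin> star V E v" "no_chamber v w b c" "no_chamber v w b' c'"
  shows "b = b' \<and> c = c'"
proof -
  have nc: "r v \<cdot> r w \<noteq> r w \<cdot> r v" using r_commute_iff assms(1-3) by (auto simp: star_def)
  show ?thesis
    by (rule noncommuting_quadrant_unique[OF r_reflection[OF assms(1)] r_reflection[OF assms(2)] nc])
       (use assms(4,5) in \<open>unfold no_chamber_def, blast+\<close>)
qed

lemma no_chamber_ex:
  assumes "v \<in> V" "w \<in> V" "w \<notin> star V E v"
  shows "\<exists>b c. no_chamber v w b c"
  using noncommuting_quadrant[OF r_reflection[OF assms(1)] r_reflection[OF assms(2)]]
    r_commute_iff assms by (auto simp: no_chamber_def star_def)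

text \<open>The commuting walls of \<open>r w\<close> and \<open>r w'\<close> admit a chamber on the
  sides \<open>c\<close> and \<open>c'\<close>. If \<open>b\<close> and \<open>b'\<close> differed,
  this chamber would have no side of the wall of \<open>r v\<close> left.\<close>

lemma no_chamber_edge:
  assumes v: "v \<in> V" and w: "{w, w'} \<in> E"
    and "no_chamber v w b c" "no_chamber v w' b' c'"
  shows "b = b'"
proof (rule ccontr)
  assume "b \<noteq> b'"
  have "w \<in> V" "w' \<in> V" "w \<noteq> w'" using edgeD[OF w] by auto
  then obtain x where "x \<in> carrier W" "(r w \<in> inversions x) = c" "(r w' \<in> inversions x) = c'"
    using commuting_quadrants[OF r_reflection[of w] r_reflection[of w'], of c c']
      r_commute_iff[of w w'] w r_eq_iff[of w w'] by auto
  then show False using assms(3,4) \<open>b \<noteq> b'\<close> unfolding no_chamber_def by blast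
qed

text \<open>By \<open>no_chamber_edge\<close> the side of \<open>r v\<close> is constant along paths
  outside the star of \<open>v\<close>, and these reach every vertex there because the star does not
  separate.\<close>

lemma ex_side:
  assumes v: "v \<in> V"
  shows "\<exists>b. \<forall>w \<in> V - star V E v. \<exists>c. no_chamber v w b c"
proof -
  let ?U = "V - star V E v"
  obtain w0 where w0: "w0 \<in> ?U" using nonempty[OF v] by blast
  then obtain b c where b: "no_chamber v w0 b c" using no_chamber_ex[OF v] by blast
  have "\<exists>c. no_chamber v w b c" if "w \<in> ?U" for w
  proof -
    have "(w0, w) \<in> {(x, y). x \<in> ?U \<and> y \<in> ?U \<and> {x, y} \<in> E}\<^sup>*"
      using nosep[OF v] w0 that by (simp add: induced_connected_def)
    then show ?thesis
    proof (induction rule: rtrancl_induct)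
      case base
      then show ?case using b by blast
    next
      case (step y z)
      then obtain c where "no_chamber v y b c" by blast
      moreover obtain b' c' where "no_chamber v z b' c'" using no_chamber_ex[OF v, of z] step by blast
      ultimately show ?case using no_chamber_edge[OF v, of y z] step.hyps by blast
    qed
  qed
  then show ?thesis by blast
qed

definition side where
  "side v = (SOME b. \<forall>w \<in> V - star V E v. \<exists>c. no_chamber v w b c)"

lemma no_chamber_side:
  assumes v: "v \<in> V" "w \<in> V" "w \<notin> star V E v"
  shows "no_chamber v w (side v) (side w)"
proof -
  have w: "v \<notin> star V E w" using v by (auto simp: star_def insert_commute)
  obtain c where c: "no_chamber v w (side v) c"
    using someI_ex[OF ex_side[OF v(1)]] v unfolding side_def by blast
  obtain b where "no_chamber w v (side w) b"
    using someI_ex[OF ex_side[OF v(2)]] v w unfolding side_def by blast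
  then have "no_chamber v w b (side w)" unfolding no_chamber_def by blast
  then show ?thesis using no_chamber_unique[OF v c] c by blast
qed

text \<open>
  Take a preferred chamber \<open>c\<close> for \<open>F\<close> and a chamber \<open>y\<close> on the preferred side of \<open>r v\<close> at minimal
  distance. If \<open>c\<close> is not on that side, the first step of a gallery from \<open>c\<close> to \<open>y\<close> crosses a wall
  \<open>r u\<close> with \<open>u \<in> F\<close>, and reflecting \<open>y\<close> in it decreases the distance.
\<close>

lemma ex_preferred:
  assumes "finite F" "F \<subseteq> V"
  shows "\<exists>c \<in> carrier W. \<forall>v \<in> F. (r v \<in> inversions c) \<noteq> side v"
  using assms
proof (induction rule: finite_induct)
  case (insert v F)
  \<comment> \<open>Both chambers vary in the minimisation: one comparison below replaces
    \<open>c\<close>, the other one \<open>y\<close>.\<close>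
  let ?P = "\<lambda>(c, y). c \<in> carrier W \<and> y \<in> carrier W \<and> (\<forall>v \<in> F. (r v \<in> inversions c) \<noteq> side v) \<and>
    (r v \<in> inversions y) \<noteq> side v"
  have v: "v \<in> V" and F: "F \<subseteq> V" using insert.prems by auto
  obtain c0 where c0: "c0 \<in> carrier W" "\<forall>v \<in> F. (r v \<in> inversions c0) \<noteq> side v"
    using insert.IH F by blast
  have "r v \<in> inversions (r v)" using inversions_reflection[OF r_reflection[OF v] r_closed[OF v]] by simp
  then have "\<exists>y \<in> carrier W. (r v \<in> inversions y) \<noteq> side v"
    using v by (cases "side v") (auto intro: bexI[of _ "\<one>\<^bsub>W\<^esub>"] bexI[of _ "r v"])
  then obtain y0 where "?P (c0, y0)" using c0 by auto
  then obtain c y where P: "?P (c, y)"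
    and min: "\<And>c' y'. ?P (c', y') \<Longrightarrow> len (inv\<^bsub>W\<^esub> c \<cdot> y) \<le> len (inv\<^bsub>W\<^esub> c' \<cdot> y')"
    using ex_has_least_nat[of ?P "(c0, y0)" "\<lambda>(c, y). len (inv\<^bsub>W\<^esub> c \<cdot> y)"]
    by (metis (no_types, lifting) case_prod_conv surj_pair)
  have cy: "c \<in> carrier W" "y \<in> carrier W" using P by auto
  show ?case
  proof (cases "(r v \<in> inversions c) \<noteq> side v")
    case True
    then show ?thesis using P by auto
  next
    case False
    let ?w = "inv\<^bsub>W\<^esub> c \<cdot> y"
    have w: "?w \<in> carrier W" "y = c \<cdot> ?w" using cy by auto
    have "?w \<noteq> \<one>\<^bsub>W\<^esub>"
    proof
      assume "?w = \<one>\<^bsub>W\<^esub>"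
      then have "y = c" using w cy by simp
      then show False using P False by auto
    qed
    then obtain s where s: "s \<in> V" "a s \<in> inversions ?w" using ex_descent w by blast
    let ?c = "c \<cdot> a s"
    have "inv\<^bsub>W\<^esub> ?c \<cdot> y = a s \<cdot> ?w" using cy s by (simp add: W_simps)
    then have less: "len (inv\<^bsub>W\<^esub> ?c \<cdot> y) < len ?w" using exchange[OF w(1) s(2)] by simp
    then have "\<not> ?P (?c, y)" using min by fastforce
    \<comment> \<open>By minimality the closer chamber \<open>?c\<close> is not preferred for
      \<open>F\<close>. It differs from \<open>c\<close> in just one wall, which is therefore that
      of some \<open>r u\<close>.\<close>
    then obtain u where u: "u \<in> F" "(r u \<in> inversions ?c) = side u" using P s by auto
    have uV: "u \<in> V" "u \<noteq> v" using u F insert.hyps by auto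
    have cside: "t \<in> inversions ?c \<longleftrightarrow> (t \<in> inversions c) \<noteq> (t = ?c \<cdot> inv\<^bsub>W\<^esub> c)" if "t \<in> carrier W" for t
      using inversions_mult_a[OF cy(1) s(1) that] .
    have ru: "r u = ?c \<cdot> inv\<^bsub>W\<^esub> c"
      using cside[OF r_closed[OF uV(1)]] u P by auto
    have "r v \<noteq> r u" using r_eq_iff uV v by metis
    then have vc: "(r v \<in> inversions ?c) = side v"
      using cside[OF r_closed[OF v]] ru False by auto
    \<comment> \<open>\<open>?c\<close> lies on the wrong side of both \<open>r u\<close> and
      \<open>r v\<close>, so their quadrant is not empty.\<close>
    have "{u, v} \<in> E"
    proof (rule ccontr)
      assume "{u, v} \<notin> E"
      then have "u \<notin> star V E v" using uV by (auto simp: star_def insert_commute)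
      from no_chamberD[OF no_chamber_side[OF v uV(1) this] _ vc] show False
        using u(2) cy s by simp
    qed
    then have "?P (c, r u \<cdot> y)" using P r_side[OF uV(1) v _ cy(2)] uV by auto
    then have "len ?w \<le> len (inv\<^bsub>W\<^esub> c \<cdot> (r u \<cdot> y))" by (rule min)
    \<comment> \<open>\<open>?c\<close> is the mirror image of \<open>c\<close> under
      \<open>r u\<close>, so \<open>c\<close> is as far from \<open>r u \<cdot> y\<close> as
      \<open>?c\<close> is from \<open>y\<close>.\<close>
    moreover have "inv\<^bsub>W\<^esub> ?c = inv\<^bsub>W\<^esub> c \<cdot> r u"
    proof -
      have "?c = r u \<cdot> c" unfolding ru using cy s by (simp add: W_simps)
      then show ?thesis using reflection_inv[OF r_reflection[OF uV(1)]] cy uV by (simp add: W.inv_mult_group)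
    qed
    ultimately show ?thesis using less cy uV by (simp add: W.m_assoc)
  qed
qed (auto intro: bexI[of _ "\<one>\<^bsub>W\<^esub>"])

text \<open>Strip a descent \<open>u\<close> of \<open>x\<close>: by induction
  \<open>f x \<cdot> c\<close> lies on the wrong side of \<open>r u\<close>. If \<open>u\<close> and
  \<open>v\<close> are not adjacent, the quadrant wrong for both is empty; if they are, reflecting
  in \<open>r u\<close> does not change the side of \<open>r v\<close>.\<close>

lemma ping_pong:
  assumes c: "c \<in> carrier W" "\<And>v. v \<in> V \<Longrightarrow> (r v \<in> inversions c) \<noteq> side v"
    and "x \<in> carrier W" "v \<in> V" "a v \<notin> inversions x"
  shows "(r v \<in> inversions (f x \<cdot> c)) \<noteq> side v"
  using assms(3-)
proof (induction "len x" arbitrary: x v rule: less_induct)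
  case less
  show ?case
  proof (cases "x = \<one>\<^bsub>W\<^esub>")
    case True
    then show ?thesis using c less.prems by (simp add: f_one)
  next
    case False
    then obtain u where u: "u \<in> V" "a u \<in> inversions x" using ex_descent less.prems by blast
    let ?y = "a u \<cdot> x"
    have uv: "u \<noteq> v" using u less.prems by auto
    have y: "?y \<in> carrier W" "a u \<notin> inversions ?y" "len ?y < len x" "x = a u \<cdot> ?y"
      using u less.prems exchange descent_iff[of u x] by auto
    have fx: "f x \<cdot> c = r u \<cdot> (f ?y \<cdot> c)"
    proof -
      have "f x = r u \<cdot> f ?y" using f_mult[of "a u" ?y] y(1,4) u(1) by (simp add: r_def)
      then show ?thesis using u y c by (simp add: W.m_assoc)
    qed
    have yc: "f ?y \<cdot> c \<in> carrier W" using y c by simp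
    have "(r u \<in> inversions (f ?y \<cdot> c)) \<noteq> side u" using less.hyps[OF y(3,1) u(1) y(2)] .
    then have ru: "(r u \<in> inversions (f x \<cdot> c)) = side u"
      unfolding fx using r_side[OF u(1) u(1) _ yc] by auto
    show ?thesis
    proof (cases "{u, v} \<in> E")
      case True
      have "a u \<cdot> a v \<cdot> a u = a v"
        using a_commute[OF True] u less.prems by (simp add: W_simps)
      then have "a v \<notin> inversions ?y"
        using inversions_a_mult[OF u(1) less.prems(1) a_closed[OF less.prems(2)]] less.prems u uv by simp
      then have "(r v \<in> inversions (f ?y \<cdot> c)) \<noteq> side v"
        using less.hyps[OF y(3,1) less.prems(2)] by blast
      then show ?thesis unfolding fx using r_side[OF u(1) less.prems(2) _ yc] True uv by auto
    next
      case False
      then have "v \<notin> star V E u" using uv by (auto simp: star_def)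
      then show ?thesis
        using no_chamberD[OF no_chamber_side[OF u(1) less.prems(2)] _ ru] less.prems c by simp
    qed
  qed
qed

text \<open>By surjectivity the neighbour \<open>c \<cdot> a s\<close> of a preferred chamber
  \<open>c\<close> is \<open>f x \<cdot> c\<close> for some \<open>x\<close>. Ping-pong puts it on
  the wrong side of \<open>r v\<close> for a descent \<open>v\<close> of \<open>x\<close>, so the
  single wall between the two chambers is that of \<open>r v\<close>.\<close>

lemma f_permutes_generators:
  "\<exists>c \<in> carrier W. \<forall>s \<in> V. \<exists>v \<in> V. f (a v) = c \<cdot> a s \<cdot> inv\<^bsub>W\<^esub> c"
proof -
  obtain c where c: "c \<in> carrier W" "\<And>v. v \<in> V \<Longrightarrow> (r v \<in> inversions c) \<noteq> side v"
    using ex_preferred[OF finite_V] by blast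
  have "\<exists>v \<in> V. f (a v) = c \<cdot> a s \<cdot> inv\<^bsub>W\<^esub> c" if s: "s \<in> V" for s
  proof -
    let ?t = "c \<cdot> a s \<cdot> inv\<^bsub>W\<^esub> c"
    have "?t \<in> carrier W" using c s by simp
    then obtain x where x: "x \<in> carrier W" "f x = ?t"
      using f_bij unfolding bij_betw_def by (metis (no_types, lifting) imageE)
    have "x \<noteq> \<one>\<^bsub>W\<^esub>"
    proof
      assume "x = \<one>\<^bsub>W\<^esub>"
      then have "parity s ?t = parity s \<one>\<^bsub>W\<^esub>" using x f_one by simp
      then show False using s c by simp
    qed
    then obtain v where v: "v \<in> V" "a v \<in> inversions x" using ex_descent x by blast
    let ?y = "a v \<cdot> x"
    have y: "?y \<in> carrier W" "a v \<notin> inversions ?y" using v x descent_iff[of v x] by auto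
    have yc: "f ?y \<cdot> c \<in> carrier W" using y c by simp
    have "x = a v \<cdot> ?y" using v x by simp
    then have "f x = r v \<cdot> f ?y" using f_mult[of "a v" ?y] y(1) v(1) by (simp add: r_def)
    then have fx: "f x \<cdot> c = r v \<cdot> (f ?y \<cdot> c)" using v y c by (simp add: W.m_assoc)
    have "(r v \<in> inversions (f ?y \<cdot> c)) \<noteq> side v" using ping_pong[OF c y(1) v(1) y(2)] .
    then have "(r v \<in> inversions (f x \<cdot> c)) = side v"
      unfolding fx using r_side[OF v(1) v(1) _ yc] by auto
    moreover have "f x \<cdot> c = c \<cdot> a s" using x c s by (simp add: W_simps)
    ultimately have "(r v \<in> inversions (c \<cdot> a s)) \<noteq> (r v \<in> inversions c)" using c(2)[OF v(1)] by simp
    then have "r v = ?t" using inversions_mult_a[OF c(1) s r_closed[OF v(1)]] by auto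
    then show ?thesis using v by (auto simp: r_def)
  qed
  then show ?thesis using c by blast
qed

lemma inner:
  assumes "asymmetric_graph V E"
  shows "f \<in> inner_auto W"
proof -
  obtain c p where c: "c \<in> carrier W"
    and p: "\<And>s. s \<in> V \<Longrightarrow> p s \<in> V" "\<And>s. s \<in> V \<Longrightarrow> r (p s) = c \<cdot> a s \<cdot> inv\<^bsub>W\<^esub> c"
    using f_permutes_generators unfolding r_def by metis
  have "inj_on p V"
  proof (rule inj_onI)
    fix s s' assume s: "s \<in> V" "s' \<in> V" "p s = p s'"
    then have "c \<cdot> a s \<cdot> inv\<^bsub>W\<^esub> c = c \<cdot> a s' \<cdot> inv\<^bsub>W\<^esub> c" using p(2) by metis
    then show "s = s'" using conj_a_eq s c by blast
  qed
  then have "bij_betw p V V"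
    using p(1) finite_V by (simp add: bij_betw_def endo_inj_surj image_subset_iff)
  moreover have "{p v, p w} \<in> E \<longleftrightarrow> {v, w} \<in> E" if vw: "v \<in> V" "w \<in> V" for v w
  proof -
    have "r (p v) \<cdot> r (p w) = r (p w) \<cdot> r (p v) \<longleftrightarrow> a v \<cdot> a w = a w \<cdot> a v"
    proof -
      have 1: "r (p v) \<cdot> r (p w) = c \<cdot> (a v \<cdot> a w) \<cdot> inv\<^bsub>W\<^esub> c" "r (p w) \<cdot> r (p v) = c \<cdot> (a w \<cdot> a v) \<cdot> inv\<^bsub>W\<^esub> c"
        using vw c by (simp_all add: p(2) W_simps)
      show ?thesis unfolding 1 using vw c W_lcancel[of c] by (simp add: W.right_cancel)
    qed
    then have "p v = p w \<or> {p v, p w} \<in> E \<longleftrightarrow> v = w \<or> {v, w} \<in> E"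
      using r_commute_iff a_commute_iff p(1) vw by metis
    moreover have "p v = p w \<longleftrightarrow> v = w" using \<open>inj_on p V\<close> vw by (auto dest: inj_onD)
    ultimately show ?thesis using edgeD[of v w] edgeD[of "p v" "p w"] by metis
  qed
  ultimately have "p v = v" if "v \<in> V" for v
    using assms that by (auto simp: asymmetric_graph_def graph_automorphism_def)
  then show ?thesis using inner_autoI[OF f c] p(2) by (simp add: r_def)
qed

end

context group
begin

lemma inner_auto_subset_auto: "inner_auto G \<subseteq> auto G"
proof
  fix f assume "f \<in> inner_auto G"
  then obtain g where g: "g \<in> carrier G" and f: "f = (\<lambda>x \<in> carrier G. g \<otimes> x \<otimes> inv g)"
    unfolding inner_auto_def by blast
  have cancel: "inv g \<otimes> (g \<otimes> x) = x" "g \<otimes> (inv g \<otimes> x) = x" if "x \<in> carrier G" for x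
    using g that by (simp_all flip: m_assoc)
  have "f \<in> hom G G"
    by (rule homI) (use g in \<open>auto simp: f m_assoc cancel\<close>)
  moreover have "bij_betw f (carrier G) (carrier G)"
    by (rule bij_betwI[of _ _ _ "\<lambda>x. inv g \<otimes> x \<otimes> g"]) (use g in \<open>auto simp: f m_assoc cancel\<close>)
  ultimately show "f \<in> auto G" by (simp add: auto_def Bij_def f)
qed

end

lemma (in racg) racg_complete:
  assumes "V \<noteq> {}"
    and anti: "\<And>v w. v \<in> V \<Longrightarrow> w \<in> V \<Longrightarrow> v \<noteq> w \<Longrightarrow> \<not> star V E v \<subseteq> star V E w"
    and nonempty: "\<And>v. v \<in> V \<Longrightarrow> \<exists>w \<in> V. w \<notin> star V E v"
    and nosep: "\<not> has_separating_star V E" and "asymmetric_graph V E"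
  shows "complete_group W"
proof -
  have "f \<in> inner_auto W" if "f \<in> auto W" for f
  proof -
    interpret racg_automorphism V G E f
      by unfold_locales (use that anti nonempty nosep in \<open>auto simp: has_separating_star_def\<close>)
    show ?thesis using inner assms by blast
  qed
  then show ?thesis
    using center_trivial assms W.inner_auto_subset_auto by (auto simp: complete_group_def)
qed

section \<open>Transvections, graph automorphisms and partial conjugations\<close>

text \<open>The elements of \<open>auto G\<close> are extensional, whereas homomorphisms obtained
  from a universal property need not be, hence the \<open>restrict\<close>.\<close>

lemma (in group) complete_inner:
  assumes complete: "complete_group G" and F: "F \<in> hom G G" "F' \<in> hom G G"
    and inverse: "\<And>x. x \<in> carrier G \<Longrightarrow> F (F' x) = x" "\<And>x. x \<in> carrier G \<Longrightarrow> F' (F x) = x"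
  obtains g where "g \<in> carrier G" "\<And>x. x \<in> carrier G \<Longrightarrow> F x = g \<otimes> x \<otimes> inv g"
proof -
  let ?f = "restrict F (carrier G)"
  have "bij_betw F (carrier G) (carrier G)"
    by (rule bij_betwI[of F _ _ F']) (use F inverse in \<open>auto simp: hom_def\<close>)
  then have "bij_betw ?f (carrier G) (carrier G)"
    using bij_betw_cong[of "carrier G" ?f F] by simp
  moreover have "?f \<in> hom G G" using F(1) by (simp add: hom_restrict)
  ultimately have "?f \<in> inner_auto G"
    using complete by (auto simp: complete_group_def auto_def Bij_def)
  then obtain g where g: "g \<in> carrier G" "?f = (\<lambda>x \<in> carrier G. g \<otimes> x \<otimes> inv g)"
    unfolding inner_auto_def by blast
  have "F x = g \<otimes> x \<otimes> inv g" if "x \<in> carrier G" for x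
    using fun_cong[OF g(2), of x] that by simp
  then show ?thesis using that g by blast
qed

context racg
begin

lemma hom_inverse:
  assumes "F \<in> hom W W" "F' \<in> hom W W" "\<And>v. v \<in> V \<Longrightarrow> F (F' (a v)) = a v" "x \<in> carrier W"
  shows "F (F' x) = x"
  using assms(4)
proof (induction rule: W_inv_induct)
  case one
  then show ?case using hom_one[OF _ W.is_group W.is_group] assms(1,2) by metis
next
  case (mult v y)
  then show ?case
    using hom_mult[OF assms(2), of "a v" y] hom_mult[OF assms(1), of "F' (a v)" "F' y"]
      hom_in_carrier[OF assms(2)] assms(3) by simp
qed

text \<open>The transvection taking \<open>a v\<close> to \<open>a v \<cdot> a w\<close> respects
  the relations because every neighbour of \<open>v\<close> commutes with \<open>a w\<close>, and it
  is its own inverse. It changes the parity of \<open>w\<close> on \<open>a v\<close>, which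
  conjugation cannot do.\<close>

lemma complete_not_star_subset:
  assumes complete: "complete_group W" and v: "v \<in> V" and w: "w \<in> V" and "v \<noteq> w"
  shows "\<not> star V E v \<subseteq> star V E w"
proof
  assume sub: "star V E v \<subseteq> star V E w"
  have "v \<in> star V E v" by (simp add: star_def)
  with sub \<open>v \<noteq> w\<close> have "{v, w} \<in> E" by (auto simp: star_def insert_commute)
  then have vw: "a v \<cdot> a w = a w \<cdot> a v" by (rule a_commute)
  let ?s = "\<lambda>u. if u = v then a v \<cdot> a w else a u"
  have comm: "(a v \<cdot> a w) \<cdot> a u = a u \<cdot> (a v \<cdot> a w)" if "{v, u} \<in> E" for u
  proof -
    have u: "u \<in> V" "u \<in> star V E v" using that edgeD[OF that] by (auto simp: star_def)
    then have "w = u \<or> {w, u} \<in> E" using sub by (auto simp: star_def insert_commute)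
    then have "a w \<cdot> a u = a u \<cdot> a w" using a_commute by auto
    then show ?thesis using a_mult_commute[of v "a u" "a w"] a_commute[OF that] u v w by simp
  qed
  obtain F where F: "F \<in> hom W W" "\<And>u. u \<in> V \<Longrightarrow> F (a u) = ?s u"
  proof (rule involution_hom[OF W.is_group, of ?s])
    show "?s u \<in> carrier W" if "u \<in> V" for u using that v w by simp
    have "(a v \<cdot> a w) \<cdot> (a w \<cdot> a v) = \<one>\<^bsub>W\<^esub>" using v w by (simp add: W.m_assoc)
    then show "?s u \<cdot> ?s u = \<one>\<^bsub>W\<^esub>" if "u \<in> V" for u using that vw by simp
    show "?s u \<cdot> ?s u' = ?s u' \<cdot> ?s u" if "{u, u'} \<in> E" for u u'
      using comm[of u] comm[of u'] a_commute[OF that] that edgeD[OF that]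
      by (auto simp: insert_commute)
  qed blast
  have FF: "F (F (a u)) = a u" if "u \<in> V" for u
    using that v w \<open>v \<noteq> w\<close> hom_mult[OF F(1), of "a v" "a w"] by (simp add: F(2) W.m_assoc)
  obtain g where g: "g \<in> carrier W" "\<And>x. x \<in> carrier W \<Longrightarrow> F x = g \<cdot> x \<cdot> inv\<^bsub>W\<^esub> g"
    using W.complete_inner[OF complete F(1) F(1)] hom_inverse[OF F(1) F(1) FF] by blast
  have "parity w (F (a v)) \<longleftrightarrow> w = v" using g v w by auto
  then show False using F(2)[OF v] v w \<open>v \<noteq> w\<close> by simp
qed

lemma complete_asymmetric:
  assumes complete: "complete_group W"
  shows "asymmetric_graph V E"
  unfolding asymmetric_graph_def
proof (intro allI impI ballI)
  fix f v assume f: "graph_automorphism V E f" and v: "v \<in> V"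
  have bij: "bij_betw f V V" and edge: "\<And>u w. u \<in> V \<Longrightarrow> w \<in> V \<Longrightarrow> {f u, f w} \<in> E \<longleftrightarrow> {u, w} \<in> E"
    using f by (auto simp: graph_automorphism_def)
  have ex: "\<exists>F \<in> hom W W. \<forall>u \<in> V. F (a u) = a (h u)"
    if h: "\<And>u. u \<in> V \<Longrightarrow> h u \<in> V" "\<And>u w. {u, w} \<in> E \<Longrightarrow> {h u, h w} \<in> E" for h
  proof -
    have "a (h u) \<cdot> a (h w) = a (h w) \<cdot> a (h u)" if "{u, w} \<in> E" for u w
      by (rule a_commute[OF h(2)[OF that]])
    then obtain F where "F \<in> hom W W" "\<And>u. u \<in> V \<Longrightarrow> F (a u) = a (h u)"
      using involution_hom[OF W.is_group, of "\<lambda>u. a (h u)"] h(1) a_closed a_sq by metis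
    then show ?thesis by blast
  qed
  have fV: "f u \<in> V" if "u \<in> V" for u using bij that by (auto simp: bij_betw_def)
  let ?h = "inv_into V f"
  have hV: "?h u \<in> V" and fh: "f (?h u) = u" and hf: "?h (f u) = u" if "u \<in> V" for u
    using bij that by (auto simp: bij_betw_def inv_into_into f_inv_into_f)
  have "{f u, f w} \<in> E" if "{u, w} \<in> E" for u w
    using edge[of u w] edgeD[OF that] that by simp
  then obtain F where F: "F \<in> hom W W" "\<And>u. u \<in> V \<Longrightarrow> F (a u) = a (f u)"
    using ex[of f] fV by blast
  have "{?h u, ?h w} \<in> E" if "{u, w} \<in> E" for u w
    using edge[of "?h u" "?h w"] hV fh edgeD[OF that] that by simp
  then obtain F' where F': "F' \<in> hom W W" "\<And>u. u \<in> V \<Longrightarrow> F' (a u) = a (?h u)"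
    using ex[of ?h] hV by blast
  have FF: "F (F' (a u)) = a u" "F' (F (a u)) = a u" if "u \<in> V" for u
    using that F F' fV hV fh hf by simp_all
  obtain g where g: "g \<in> carrier W" "\<And>x. x \<in> carrier W \<Longrightarrow> F x = g \<cdot> x \<cdot> inv\<^bsub>W\<^esub> g"
    using W.complete_inner[OF complete F(1) F'(1)] hom_inverse[OF F(1) F'(1) FF(1)]
      hom_inverse[OF F'(1) F(1) FF(2)] by blast
  have "parity v (F (a v))" using g v by simp
  then show "f v = v" using F(2)[OF v] fV v by simp
qed

text \<open>Conjugate by \<open>a v\<close> just the generators of a component \<open>K\<close> of
  the complement of the star. If this were conjugation by \<open>g\<close>, then \<open>g\<close>
  would centralise \<open>a y\<close> and \<open>a v \<cdot> g\<close> would centralise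
  \<open>a x\<close>. Both would have even parity in \<open>v\<close>, although they differ by
  \<open>a v\<close>.\<close>

lemma complete_no_separating_star:
  assumes complete: "complete_group W"
  shows "\<not> has_separating_star V E"
proof
  assume "has_separating_star V E"
  then obtain v x y where v: "v \<in> V" and x: "x \<in> V" "x \<notin> star V E v" and y: "y \<in> V" "y \<notin> star V E v"
    and xy: "(x, y) \<notin> {(p, q). p \<in> V - star V E v \<and> q \<in> V - star V E v \<and> {p, q} \<in> E}\<^sup>*"
    by (auto simp: has_separating_star_def induced_connected_def)
  let ?R = "{(p, q). p \<in> V - star V E v \<and> q \<in> V - star V E v \<and> {p, q} \<in> E}"
  define K where "K = {k. (x, k) \<in> ?R\<^sup>*}"
  have xK: "x \<in> K" and yK: "y \<notin> K" using xy by (auto simp: K_def)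
  have KV: "k \<in> V" "k \<notin> star V E v" if "k \<in> K" for k
  proof -
    have "(x, k) \<in> ?R\<^sup>*" using that by (simp add: K_def)
    then have "k \<in> V \<and> k \<notin> star V E v" by (induction rule: rtrancl_induct) (use x in auto)
    then show "k \<in> V" "k \<notin> star V E v" by auto
  qed
  have vK: "v \<notin> K" using KV(2)[of v] by (auto simp: star_def)
  let ?s = "\<lambda>u. if u \<in> K then a v \<cdot> a u \<cdot> a v else a u"
  \<comment> \<open>A neighbour of \<open>K\<close> outside \<open>K\<close> lies in the star of
    \<open>v\<close>, so it commutes with \<open>a v\<close>.\<close>
  have comm: "(a v \<cdot> a k \<cdot> a v) \<cdot> a u = a u \<cdot> (a v \<cdot> a k \<cdot> a v)"
    if e: "{k, u} \<in> E" and k: "k \<in> K" and u: "u \<notin> K" for k u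
  proof -
    have V: "k \<in> V" "u \<in> V" using edgeD[OF e] by auto
    have "u \<in> star V E v"
    proof (rule ccontr)
      assume "u \<notin> star V E v"
      then have "(k, u) \<in> ?R" using e V KV(2)[OF k] by blast
      then show False using k u unfolding K_def by (auto intro: rtrancl_into_rtrancl)
    qed
    moreover have "u \<noteq> v" using e KV[OF k] by (auto simp: star_def insert_commute)
    ultimately have vu: "a v \<cdot> a u = a u \<cdot> a v" using a_commute by (auto simp: star_def)
    have "a k \<cdot> a u = a u \<cdot> a k" using a_commute[OF e] .
    then have "(a k \<cdot> a v) \<cdot> a u = a u \<cdot> (a k \<cdot> a v)"
      using a_mult_commute[of k "a u" "a v"] vu V v by simp
    then show ?thesis
      using a_mult_commute[of v "a u" "a k \<cdot> a v"] vu V v by (simp add: W.m_assoc)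
  qed
  obtain F where F: "F \<in> hom W W" "\<And>u. u \<in> V \<Longrightarrow> F (a u) = ?s u"
  proof (rule involution_hom[OF W.is_group, of ?s])
    show "?s u \<in> carrier W" if "u \<in> V" for u using that v by simp
    show "?s u \<cdot> ?s u = \<one>\<^bsub>W\<^esub>" if "u \<in> V" for u using that v by (simp add: W.m_assoc)
    show "?s u \<cdot> ?s u' = ?s u' \<cdot> ?s u" if e: "{u, u'} \<in> E" for u u'
    proof (cases "u \<in> K \<and> u' \<in> K")
      case True
      have "(a v \<cdot> a u \<cdot> a v) \<cdot> (a v \<cdot> a u' \<cdot> a v) = a v \<cdot> (a u \<cdot> a u') \<cdot> a v"
        "(a v \<cdot> a u' \<cdot> a v) \<cdot> (a v \<cdot> a u \<cdot> a v) = a v \<cdot> (a u' \<cdot> a u) \<cdot> a v"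
        using v edgeD[OF e] by (simp_all add: W.m_assoc)
      then show ?thesis using True a_commute[OF e] by simp
    next
      case False
      then show ?thesis
        using comm[of u u'] comm[of u' u] e a_commute[OF e] by (auto simp: insert_commute)
    qed
  qed blast
  have FF: "F (F (a u)) = a u" if "u \<in> V" for u
  proof (cases "u \<in> K")
    case True
    then have "F (F (a u)) = F (a v) \<cdot> F (a u) \<cdot> F (a v)"
      using that v hom_mult[OF F(1)] by (simp add: F(2))
    then show ?thesis using that v vK True by (simp add: F(2) W.m_assoc)
  qed (use that in \<open>simp add: F(2)\<close>)
  obtain g where g: "g \<in> carrier W" "\<And>x. x \<in> carrier W \<Longrightarrow> F x = g \<cdot> x \<cdot> inv\<^bsub>W\<^esub> g"
    using W.complete_inner[OF complete F(1) F(1)] hom_inverse[OF F(1) F(1) FF] by blast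
  \<comment> \<open>The infinite dihedral group generated by \<open>u\<close> and \<open>v\<close> acts on the integers, and \<open>h\<close> fixes \<open>0\<close>.\<close>
  have even: "\<not> parity v h"
    if u: "u \<in> V" "u \<notin> star V E v" and h: "h \<in> carrier W" "h \<cdot> a u = a u \<cdot> h" for u h
  proof -
    have nE: "u \<noteq> v" "{u, v} \<notin> E" using u by (auto simp: star_def insert_commute)
    obtain A :: "_ \<Rightarrow> int \<Rightarrow> int" where A: "\<And>g h x. g \<in> carrier W \<Longrightarrow> h \<in> carrier W \<Longrightarrow> A (g \<cdot> h) x = A g (A h x)"
      "\<And>x. A (a u) x = - x" "\<And>g. g \<in> carrier W \<Longrightarrow> odd (A g 0) \<longleftrightarrow> parity v g"
      by (rule dihedral_action[OF u(1) v nE]) blast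
    have "A h 0 = - A h 0"
      using A(1)[OF h(1) a_closed[OF u(1)], of 0] A(1)[OF a_closed[OF u(1)] h(1), of 0] A(2) h(2) by simp
    then show ?thesis using A(3)[OF h(1)] by simp
  qed
  have "g \<cdot> a y = a y \<cdot> g"
  proof -
    have "a y = g \<cdot> a y \<cdot> inv\<^bsub>W\<^esub> g" using g(2)[of "a y"] F(2)[OF y(1)] y yK by simp
    then have "a y \<cdot> g = g \<cdot> a y \<cdot> inv\<^bsub>W\<^esub> g \<cdot> g" by simp
    then show ?thesis using g y by (simp add: W.m_assoc)
  qed
  then have "\<not> parity v g" using even y g by blast
  moreover have "(a v \<cdot> g) \<cdot> a x = a x \<cdot> (a v \<cdot> g)"
  proof -
    have "a v \<cdot> a x \<cdot> a v = g \<cdot> a x \<cdot> inv\<^bsub>W\<^esub> g" using g(2)[of "a x"] F(2)[OF x(1)] x xK by simp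
    then have "a v \<cdot> (a v \<cdot> a x \<cdot> a v) \<cdot> g = a v \<cdot> (g \<cdot> a x \<cdot> inv\<^bsub>W\<^esub> g) \<cdot> g" by simp
    then show ?thesis using g x v by (simp add: W.m_assoc)
  qed
  then have "\<not> parity v (a v \<cdot> g)" by (rule even[OF x W.m_closed[OF a_closed[OF v] g(1)]])
  ultimately show False using g v by simp
qed

end

section \<open>Graphs with at most six vertices\<close>

lemma set_enumeration: "finite V \<Longrightarrow> set xs \<subseteq> V \<Longrightarrow> distinct xs \<Longrightarrow> length xs = card V \<Longrightarrow> V = set xs"
  by (metis card_subset_eq distinct_card)

text \<open>
  The only graphs with 4 to 6 vertices satisfying \<open>anti\<close> and \<open>conn\<close>, where \<open>conn\<close> forbids isolated
  vertices in the complement of a star, are the cycles, the prism and the octahedron. Each of them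
  has an automorphism interchanging the vertices of disjoint pairs, excluded by \<open>asym\<close>.
\<close>

lemma no_asymmetric_4:
  assumes sym: "\<And>x y. adj x y = adj y x" and dist: "distinct [a, b, c, d]" and V: "V = {a, b, c, d}"
    and anti: "\<forall>v \<in> V. \<forall>w \<in> V. v \<noteq> w \<longrightarrow> (\<exists>x \<in> V. (x = v \<or> adj v x) \<and> x \<noteq> w \<and> \<not> adj w x)"
    and conn: "\<forall>v \<in> V. \<forall>p \<in> V. \<forall>q \<in> V. p \<noteq> v \<longrightarrow> q \<noteq> v \<longrightarrow> p \<noteq> q \<longrightarrow>
      \<not> adj v p \<longrightarrow> \<not> adj v q \<longrightarrow> (\<exists>c \<in> V. c \<noteq> v \<and> c \<noteq> p \<and> \<not> adj v c \<and> adj p c)"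
    and asym: "\<And>a b c d. distinct [a, b, c, d] \<Longrightarrow> V = {a, b, c, d} \<Longrightarrow>
      \<not> ((adj a c = adj b d) \<and> (adj a d = adj b c))"
  shows False
proof -
  have neq: "a \<noteq> b" "b \<noteq> a" "a \<noteq> c" "c \<noteq> a" "a \<noteq> d" "d \<noteq> a" "b \<noteq> c"
    "c \<noteq> b" "b \<noteq> d" "d \<noteq> b" "c \<noteq> d" "d \<noteq> c"
    using dist by auto
  note swap =
    sym[of b a] sym[of c a] sym[of d a] sym[of c b] sym[of d b] sym[of d c]
  have card: "card V = 4" "finite V"
    using dist V by simp_all
  have asym': "a \<in> V \<Longrightarrow> b \<in> V \<Longrightarrow> c \<in> V \<Longrightarrow> d \<in> V \<Longrightarrow> distinct [a, b, c, d] \<Longrightarrow>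
      \<not> ((adj a c = adj b d) \<and> (adj a d = adj b c))" for a b c d
    by (rule asym) (use set_enumeration[of V "[a, b, c, d]"] card in simp_all)
  \<comment> \<open>The three ways of splitting the vertices into two pairs.\<close>
  note q =
    asym'[of a b c d] asym'[of a c b d] asym'[of a d b c]
  \<comment> \<open>With \<open>V\<close> written out and each edge oriented by \<open>swap\<close>,
    the six possible edges become propositional variables.\<close>
  note expand = neq swap ball_simps bex_simps simp_thms insert_iff empty_iff distinct.simps list.set
  show False
    using anti[unfolded V, simplified expand] conn[unfolded V, simplified expand]
      q[unfolded V, simplified expand] by sat
qed

lemma no_asymmetric_5:
  assumes sym: "\<And>x y. adj x y = adj y x" and dist: "distinct [a, b, c, d, e]" and V: "V = {a, b, c, d, e}"
    and anti: "\<forall>v \<in> V. \<forall>w \<in> V. v \<noteq> w \<longrightarrow> (\<exists>x \<in> V. (x = v \<or> adj v x) \<and> x \<noteq> w \<and> \<not> adj w x)"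
    and conn: "\<forall>v \<in> V. \<forall>p \<in> V. \<forall>q \<in> V. p \<noteq> v \<longrightarrow> q \<noteq> v \<longrightarrow> p \<noteq> q \<longrightarrow>
      \<not> adj v p \<longrightarrow> \<not> adj v q \<longrightarrow> (\<exists>c \<in> V. c \<noteq> v \<and> c \<noteq> p \<and> \<not> adj v c \<and> adj p c)"
    and asym: "\<And>a b c d e. distinct [a, b, c, d, e] \<Longrightarrow> V = {a, b, c, d, e} \<Longrightarrow>
      \<not> ((adj a c = adj b d) \<and> (adj a d = adj b c) \<and> (adj a e = adj b e) \<and> (adj c e = adj d e))"
  shows False
proof -
  have neq: "a \<noteq> b" "b \<noteq> a" "a \<noteq> c" "c \<noteq> a" "a \<noteq> d" "d \<noteq> a" "a \<noteq> e"
    "e \<noteq> a" "b \<noteq> c" "c \<noteq> b" "b \<noteq> d" "d \<noteq> b" "b \<noteq> e" "e \<noteq> b"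
    "c \<noteq> d" "d \<noteq> c" "c \<noteq> e" "e \<noteq> c" "d \<noteq> e" "e \<noteq> d"
    using dist by auto
  note swap =
    sym[of b a] sym[of c a] sym[of d a] sym[of e a] sym[of c b] sym[of d b] sym[of e b]
    sym[of d c] sym[of e c] sym[of e d]
  have card: "card V = 5" "finite V"
    using dist V by simp_all
  have asym': "a \<in> V \<Longrightarrow> b \<in> V \<Longrightarrow> c \<in> V \<Longrightarrow> d \<in> V \<Longrightarrow> e \<in> V \<Longrightarrow> distinct [a, b, c, d, e] \<Longrightarrow>
      \<not> ((adj a c = adj b d) \<and> (adj a d = adj b c) \<and> (adj a e = adj b e) \<and> (adj c e = adj d e))" for a b c d e
    by (rule asym) (use set_enumeration[of V "[a, b, c, d, e]"] card in simp_all)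
  \<comment> \<open>Five choices of the fixed vertex, listed last, times three pairings of the
    others.\<close>
  note q =
    asym'[of b c d e a] asym'[of b d c e a] asym'[of b e c d a] asym'[of a c d e b]
    asym'[of a d c e b] asym'[of a e c d b] asym'[of a b d e c] asym'[of a d b e c]
    asym'[of a e b d c] asym'[of a b c e d] asym'[of a c b e d] asym'[of a e b c d]
    asym'[of a b c d e] asym'[of a c b d e] asym'[of a d b c e]
  note expand = neq swap ball_simps bex_simps simp_thms insert_iff empty_iff distinct.simps list.set
  show False
    using anti[unfolded V, simplified expand] conn[unfolded V, simplified expand]
      q[unfolded V, simplified expand] by sat
qed

lemma no_asymmetric_6:
  assumes sym: "\<And>x y. adj x y = adj y x" and dist: "distinct [a, b, c, d, e, f]" and V: "V = {a, b, c, d, e, f}"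
    and anti: "\<forall>v \<in> V. \<forall>w \<in> V. v \<noteq> w \<longrightarrow> (\<exists>x \<in> V. (x = v \<or> adj v x) \<and> x \<noteq> w \<and> \<not> adj w x)"
    and conn: "\<forall>v \<in> V. \<forall>p \<in> V. \<forall>q \<in> V. p \<noteq> v \<longrightarrow> q \<noteq> v \<longrightarrow> p \<noteq> q \<longrightarrow>
      \<not> adj v p \<longrightarrow> \<not> adj v q \<longrightarrow> (\<exists>c \<in> V. c \<noteq> v \<and> c \<noteq> p \<and> \<not> adj v c \<and> adj p c)"
    and asym: "\<And>a b c d e f. distinct [a, b, c, d, e, f] \<Longrightarrow> V = {a, b, c, d, e, f} \<Longrightarrow>
      \<not> ((adj a c = adj b d) \<and> (adj a d = adj b c) \<and> (adj a e = adj b f) \<and> (adj a f = adj b e) \<and>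
        (adj c e = adj d f) \<and> (adj c f = adj d e))"
  shows False
proof -
  have neq: "a \<noteq> b" "b \<noteq> a" "a \<noteq> c" "c \<noteq> a" "a \<noteq> d" "d \<noteq> a" "a \<noteq> e"
    "e \<noteq> a" "a \<noteq> f" "f \<noteq> a" "b \<noteq> c" "c \<noteq> b" "b \<noteq> d" "d \<noteq> b"
    "b \<noteq> e" "e \<noteq> b" "b \<noteq> f" "f \<noteq> b" "c \<noteq> d" "d \<noteq> c" "c \<noteq> e"
    "e \<noteq> c" "c \<noteq> f" "f \<noteq> c" "d \<noteq> e" "e \<noteq> d" "d \<noteq> f" "f \<noteq> d"
    "e \<noteq> f" "f \<noteq> e"
    using dist by auto
  note swap =
    sym[of b a] sym[of c a] sym[of d a] sym[of e a] sym[of f a] sym[of c b] sym[of d b]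
    sym[of e b] sym[of f b] sym[of d c] sym[of e c] sym[of f c] sym[of e d] sym[of f d]
    sym[of f e]
  have card: "card V = 6" "finite V"
    using dist V by simp_all
  have asym': "a \<in> V \<Longrightarrow> b \<in> V \<Longrightarrow> c \<in> V \<Longrightarrow> d \<in> V \<Longrightarrow> e \<in> V \<Longrightarrow> f \<in> V \<Longrightarrow> distinct [a, b, c, d, e, f] \<Longrightarrow>
      \<not> ((adj a c = adj b d) \<and> (adj a d = adj b c) \<and> (adj a e = adj b f) \<and> (adj a f = adj b e) \<and>
        (adj c e = adj d f) \<and> (adj c f = adj d e))" for a b c d e f
    by (rule asym) (use set_enumeration[of V "[a, b, c, d, e, f]"] card in simp_all)
  \<comment> \<open>The fifteen perfect matchings of six vertices.\<close>
  note q =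
    asym'[of a b c d e f] asym'[of a b c e d f] asym'[of a b c f d e] asym'[of a c b d e f]
    asym'[of a c b e d f] asym'[of a c b f d e] asym'[of a d b c e f] asym'[of a d b e c f]
    asym'[of a d b f c e] asym'[of a e b c d f] asym'[of a e b d c f] asym'[of a e b f c d]
    asym'[of a f b c d e] asym'[of a f b d c e] asym'[of a f b e c d]
  note expand = neq swap ball_simps bex_simps simp_thms insert_iff empty_iff distinct.simps list.set
  show False
    using anti[unfolded V, simplified expand] conn[unfolded V, simplified expand]
      q[unfolded V, simplified expand] by sat
qed

lemma asymmetric_involution:
  assumes "asymmetric_graph V E"
    and "\<And>v. v \<in> V \<Longrightarrow> h v \<in> V" "\<And>v. v \<in> V \<Longrightarrow> h (h v) = v"
    and "\<And>v w. v \<in> V \<Longrightarrow> w \<in> V \<Longrightarrow> {h v, h w} \<in> E \<longleftrightarrow> {v, w} \<in> E"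
    and "v \<in> V"
  shows "h v = v"
proof -
  have "bij_betw h V V"
    by (rule bij_betwI[of h V V h]) (use assms(2,3) in auto)
  then have "graph_automorphism V E h"
    using assms(4) by (simp add: graph_automorphism_def)
  then show ?thesis using assms(1,5) by (simp add: asymmetric_graph_def)
qed

text \<open>In a disconnected graph every component is complete: a vertex of the component of
  \<open>u\<close> outside the star of \<open>u\<close> and a vertex of another component would be
  joined in the complement of that star. As no star contains another one, complete components are
  single vertices. A third vertex would have a star separating the other two, and two isolated
  vertices can be interchanged.\<close>

lemma asymmetric_connected_card:
  assumes graph: "finite_simple_graph V E" and ne: "V \<noteq> {}"
    and nonempty: "\<And>v. v \<in> V \<Longrightarrow> \<exists>w \<in> V. w \<notin> star V E v"
    and anti: "\<And>v w. v \<in> V \<Longrightarrow> w \<in> V \<Longrightarrow> v \<noteq> w \<Longrightarrow> \<not> star V E v \<subseteq> star V E w"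
    and nosep: "\<not> has_separating_star V E"
    and asym: "asymmetric_graph V E"
  shows "induced_connected E V" "card V \<ge> 7"
proof -
  have finV: "finite V" using graph by (simp add: finite_simple_graph_def)
  have edgeD: "v \<in> V \<and> w \<in> V \<and> v \<noteq> w" if "{v, w} \<in> E" for v w
    using graph that by (fastforce simp: finite_simple_graph_def)
  have conn: "(x, y) \<in> {(x, y). x \<in> V - star V E v \<and> y \<in> V - star V E v \<and> {x, y} \<in> E}\<^sup>*"
    if "v \<in> V" "x \<in> V" "y \<in> V" "x \<notin> star V E v" "y \<notin> star V E v" for v x y
    using nosep that by (auto simp: has_separating_star_def induced_connected_def)
  let ?R = "{(x, y). x \<in> V \<and> y \<in> V \<and> {x, y} \<in> E}"
  have conn': "(x, y) \<in> ?R\<^sup>*"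
    if "v \<in> V" "x \<in> V" "y \<in> V" "x \<notin> star V E v" "y \<notin> star V E v" for v x y
    by (rule subsetD[OF rtrancl_mono conn[OF that]]) auto
  have symR: "(y, x) \<in> ?R\<^sup>*" if "(x, y) \<in> ?R\<^sup>*" for x y
  proof -
    have "sym ?R" by (auto simp: sym_def insert_commute)
    then show ?thesis using that by (meson sym_rtrancl symD)
  qed
  show connected: "induced_connected E V"
  proof (rule ccontr)
    assume "\<not> induced_connected E V"
    then obtain x y where xy: "x \<in> V" "y \<in> V" "(x, y) \<notin> ?R\<^sup>*"
      by (auto simp: induced_connected_def)
    have isolated: "star V E x = {x}" if xy: "x \<in> V" "y \<in> V" "(x, y) \<notin> ?R\<^sup>*" for x y
    proof -
      have clique: "star V E u = {u'. (x, u') \<in> ?R\<^sup>*}" if u: "(x, u) \<in> ?R\<^sup>*" for u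
      proof
        have uV: "u \<in> V" using u xy by (induction rule: rtrancl_induct) auto
        show "star V E u \<subseteq> {u'. (x, u') \<in> ?R\<^sup>*}"
          using u uV by (auto simp: star_def intro: rtrancl_into_rtrancl)
        show "{u'. (x, u') \<in> ?R\<^sup>*} \<subseteq> star V E u"
        proof (rule ccontr)
          assume "\<not> ?thesis"
          then obtain u' where u': "(x, u') \<in> ?R\<^sup>*" "u' \<notin> star V E u" by blast
          have "u' \<in> V" using u'(1) xy by (induction rule: rtrancl_induct) auto
          moreover have "y \<notin> star V E u"
            using \<open>star V E u \<subseteq> _\<close> xy(3) by blast
          ultimately have "(u', y) \<in> ?R\<^sup>*" using conn'[OF uV _ xy(2)] u'(2) by blast
          then show False using u'(1) xy(3) by (meson rtrancl_trans)
        qed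
      qed
      have "u = x" if "u \<in> star V E x" for u
      proof (rule ccontr)
        assume "u \<noteq> x"
        have u: "(x, u) \<in> ?R\<^sup>*" using that clique[of x] by blast
        have "u \<in> V" using that xy(1) by (auto simp: star_def)
        moreover have "star V E u = star V E x" using clique[OF u] clique[of x] by blast
        ultimately show False using anti[of u x] xy(1) \<open>u \<noteq> x\<close> by blast
      qed
      then show ?thesis by (auto simp: star_def)
    qed
    have sx: "star V E x = {x}" and sy: "star V E y = {y}"
      using isolated[OF xy] isolated[OF xy(2,1)] xy(3) symR by blast+
    have "V \<subseteq> {x, y}"
    proof
      fix z assume z: "z \<in> V"
      show "z \<in> {x, y}"
      proof (rule ccontr)
        assume nz: "z \<notin> {x, y}"
        then have "x \<notin> star V E z" "y \<notin> star V E z"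
          using sx sy z by (auto simp: star_def insert_commute)
        then show False using conn'[OF z xy(1,2)] xy(3) by blast
      qed
    qed
    then have V: "V = {x, y}" using xy by blast
    have "{v, w} \<notin> E" if "v \<in> V" "w \<in> V" for v w
    proof
      assume e: "{v, w} \<in> E"
      then have "{x, y} \<in> E" using that edgeD[of v w] by (auto simp: V insert_commute)
      then have "y \<in> star V E x" using xy by (simp add: star_def)
      then show False using sx edgeD[OF \<open>{x, y} \<in> E\<close>] by simp
    qed
    note noedge = this
    let ?h = "\<lambda>v. if v = x then y else x"
    have "?h x = x"
    proof (rule asymmetric_involution[OF asym, of ?h x])
      show "?h v \<in> V" for v using xy by simp
      show "?h (?h v) = v" if "v \<in> V" for v using that V by auto
      show "{?h v, ?h w} \<in> E \<longleftrightarrow> {v, w} \<in> E" if "v \<in> V" "w \<in> V" for v w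
        using noedge that xy(1,2) by presburger
    qed (rule xy(1))
    then show False using xy(3) by auto
  qed
  define adj where "adj x y \<longleftrightarrow> {x, y} \<in> E" for x y
  have sym: "adj x y = adj y x" for x y by (simp add: adj_def insert_commute)
  have irrefl: "\<not> adj x x" for x using edgeD[of x x] by (auto simp: adj_def)
  have anti': "\<forall>v \<in> V. \<forall>w \<in> V. v \<noteq> w \<longrightarrow> (\<exists>x \<in> V. (x = v \<or> adj v x) \<and> x \<noteq> w \<and> \<not> adj w x)"
  proof (intro ballI impI)
    fix v w assume vw: "v \<in> V" "w \<in> V" "v \<noteq> w"
    then obtain x where "x \<in> star V E v" "x \<notin> star V E w" using anti by blast
    then show "\<exists>x \<in> V. (x = v \<or> adj v x) \<and> x \<noteq> w \<and> \<not> adj w x"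
      using vw by (intro bexI[of _ x]) (auto simp: star_def adj_def)
  qed
  \<comment> \<open>Non-separation as a local condition: if at least two vertices lie outside a
    star, none of them is isolated there.\<close>
  have co: "\<forall>v \<in> V. \<forall>p \<in> V. \<forall>q \<in> V. p \<noteq> v \<longrightarrow> q \<noteq> v \<longrightarrow> p \<noteq> q \<longrightarrow>
      \<not> adj v p \<longrightarrow> \<not> adj v q \<longrightarrow> (\<exists>c \<in> V. c \<noteq> v \<and> c \<noteq> p \<and> \<not> adj v c \<and> adj p c)"
  proof (intro ballI impI)
    fix v p q assume *: "v \<in> V" "p \<in> V" "q \<in> V" "p \<noteq> v" "q \<noteq> v" "p \<noteq> q" "\<not> adj v p" "\<not> adj v q"
    then have "(p, q) \<in> {(x, y). x \<in> V - star V E v \<and> y \<in> V - star V E v \<and> {x, y} \<in> E}\<^sup>*"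
      by (intro conn) (auto simp: star_def adj_def)
    then obtain c where "{p, c} \<in> E" "c \<in> V - star V E v"
      using \<open>p \<noteq> q\<close> by (auto elim: converse_rtranclE)
    then show "\<exists>c \<in> V. c \<noteq> v \<and> c \<noteq> p \<and> \<not> adj v c \<and> adj p c"
      using edgeD[of p c] by (intro bexI[of _ c]) (auto simp: star_def adj_def)
  qed
  have invol: "h v = v" if "\<forall>v \<in> V. h v \<in> V \<and> h (h v) = v" "\<forall>v \<in> V. \<forall>w \<in> V. adj (h v) (h w) = adj v w" "v \<in> V" for h v
    using asymmetric_involution[OF asym, of h v] that by (simp add: adj_def)
  obtain xs where xs: "distinct xs" "set xs = V" using finite_distinct_list[OF finV] by blast
  show "card V \<ge> 7"
  proof (rule ccontr)
    assume "\<not> 7 \<le> card V"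
    then have "length xs < 7" using xs distinct_card by fastforce
    moreover have "length xs \<noteq> 0" using xs ne by auto
    ultimately consider "length xs = 1" | "length xs = 2" | "length xs = 3" | "length xs = 4"
      | "length xs = 5" | "length xs = 6" by linarith
    then show False
    proof cases
      case 1
      then obtain a where "V = {a}" using xs by (auto simp: length_Suc_conv)
      then show False using nonempty by (auto simp: star_def)
    next
      case 2
      then obtain a b where ab: "V = {a, b}" "a \<noteq> b" using xs by (auto simp: length_Suc_conv numeral_2_eq_2)
      then have "(a, b) \<in> ?R\<^sup>*" using connected by (auto simp: induced_connected_def)
      then obtain c where "{a, c} \<in> E" using ab(2) by (auto elim: converse_rtranclE)
      then have "{a, b} \<in> E" using edgeD[of a c] ab by auto
      then show False using nonempty[of a] ab by (auto simp: star_def)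
    next
      case 3
      then obtain a b c where V: "V = {a, b, c}" "a \<noteq> b" "a \<noteq> c" "b \<noteq> c"
        using xs by (auto simp: length_Suc_conv numeral_3_eq_3)
      note expand = V(2-4) V(2-4)[symmetric] sym[of b a] sym[of c a] sym[of c b] ball_simps bex_simps simp_thms
      show False
        using anti'[unfolded V(1), simplified expand] co[unfolded V(1), simplified expand] by sat
    next
      case 4
      then obtain a b c d where abcd: "distinct [a, b, c, d]" "V = {a, b, c, d}"
        using xs by (auto simp: length_Suc_conv numeral_eq_Suc)
      show False
      proof (rule no_asymmetric_4[OF sym abcd anti' co])
        fix a b c d assume dist: "distinct [a, b, c, d]" and V: "V = {a, b, c, d}"
        show "\<not> ((adj a c = adj b d) \<and> (adj a d = adj b c))"
        proof
          assume *: "(adj a c = adj b d) \<and> (adj a d = adj b c)"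
          have neq: "b \<noteq> a" "c \<noteq> a" "d \<noteq> a" "c \<noteq> b" "d \<noteq> b"
            "d \<noteq> c"
            using dist by auto
          note swap = sym[of b a] sym[of c a] sym[of d a] sym[of c b] sym[of d b] sym[of d c]
          have "(id(a := b, b := a, c := d, d := c)) a = a"
            by (rule invol) (use dist * in \<open>simp_all add: V irrefl swap neq\<close>)
          then show False using dist by auto
        qed
      qed
    next
      case 5
      then obtain a b c d e where abcd: "distinct [a, b, c, d, e]" "V = {a, b, c, d, e}"
        using xs by (auto simp: length_Suc_conv numeral_eq_Suc)
      show False
      proof (rule no_asymmetric_5[OF sym abcd anti' co])
        fix a b c d e assume dist: "distinct [a, b, c, d, e]" and V: "V = {a, b, c, d, e}"
        show "\<not> ((adj a c = adj b d) \<and> (adj a d = adj b c) \<and> (adj a e = adj b e) \<and> (adj c e = adj d e))"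
        proof
          assume *: "(adj a c = adj b d) \<and> (adj a d = adj b c) \<and> (adj a e = adj b e) \<and> (adj c e = adj d e)"
          have neq: "b \<noteq> a" "c \<noteq> a" "d \<noteq> a" "e \<noteq> a" "c \<noteq> b"
            "d \<noteq> b" "e \<noteq> b" "d \<noteq> c" "e \<noteq> c" "e \<noteq> d"
            using dist by auto
          note swap = sym[of b a] sym[of c a] sym[of d a] sym[of e a] sym[of c b] sym[of d b]
            sym[of e b] sym[of d c] sym[of e c] sym[of e d]
          have "(id(a := b, b := a, c := d, d := c)) a = a"
            by (rule invol) (use dist * in \<open>simp_all add: V irrefl swap neq\<close>)
          then show False using dist by auto
        qed
      qed
    next
      case 6
      then obtain a b c d e f where abcd: "distinct [a, b, c, d, e, f]" "V = {a, b, c, d, e, f}"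
        using xs by (auto simp: length_Suc_conv numeral_eq_Suc)
      show False
      proof (rule no_asymmetric_6[OF sym abcd anti' co])
        fix a b c d e f assume dist: "distinct [a, b, c, d, e, f]" and V: "V = {a, b, c, d, e, f}"
        show "\<not> ((adj a c = adj b d) \<and> (adj a d = adj b c) \<and> (adj a e = adj b f) \<and> (adj a f = adj b e) \<and>
            (adj c e = adj d f) \<and> (adj c f = adj d e))"
        proof
          assume *: "(adj a c = adj b d) \<and> (adj a d = adj b c) \<and> (adj a e = adj b f) \<and> (adj a f = adj b e) \<and>
            (adj c e = adj d f) \<and> (adj c f = adj d e)"
          have neq: "b \<noteq> a" "c \<noteq> a" "d \<noteq> a" "e \<noteq> a" "f \<noteq> a"
            "c \<noteq> b" "d \<noteq> b" "e \<noteq> b" "f \<noteq> b" "d \<noteq> c"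
            "e \<noteq> c" "f \<noteq> c" "e \<noteq> d" "f \<noteq> d" "f \<noteq> e"
            using dist by auto
          note swap = sym[of b a] sym[of c a] sym[of d a] sym[of e a] sym[of f a] sym[of c b]
            sym[of d b] sym[of e b] sym[of f b] sym[of d c] sym[of e c] sym[of f c] sym[of e d]
            sym[of f d] sym[of f e]
          have "(id(a := b, b := a, c := d, d := c, e := f, f := e)) a = a"
            by (rule invol) (use dist * in \<open>simp_all add: V irrefl swap neq\<close>)
          then show False using dist by auto
        qed
      qed
    qed
  qed
qed

section \<open>Vertex groups of a complete graph product\<close>

text \<open>
  The free product of \<open>G v\<close> and \<open>G w\<close> acts on its left cosets modulo \<open>G w\<close>, represented by the
  reduced words that do not end with a letter from \<open>G w\<close>. A non-trivial element of \<open>G w\<close> fixes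
  only the empty word.
\<close>

locale coset_words =
  fixes G :: "'v \<Rightarrow> ('a, 'b) monoid_scheme" and v w :: 'v
  assumes grp: "i \<in> {v, w} \<Longrightarrow> group (G i)" and vw: "v \<noteq> w"
begin

definition cosets :: "('v \<times> 'a) list set" where
  "cosets = {us. (\<forall>(i, g) \<in> set us. i \<in> {v, w} \<and> g \<in> carrier (G i) \<and> g \<noteq> \<one>\<^bsub>G i\<^esub>) \<and>
     successively (\<lambda>p q. fst p \<noteq> fst q) us \<and> (us \<noteq> [] \<longrightarrow> fst (last us) = v)}"

text \<open>The leading letter from \<open>G i\<close> is taken to be the identity if there is none,
  so that \<open>act\<close> needs no case distinction.\<close>

definition split :: "'v \<Rightarrow> ('v \<times> 'a) list \<Rightarrow> 'a \<times> ('v \<times> 'a) list" where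
  "split i us = (case us of [] \<Rightarrow> (\<one>\<^bsub>G i\<^esub>, [])
     | (j, h) # ws \<Rightarrow> if j = i then (h, ws) else (\<one>\<^bsub>G i\<^esub>, us))"

text \<open>The empty word stands for the coset \<open>G w\<close> itself, so a letter of
  \<open>G w\<close> in front of it is absorbed.\<close>

definition join :: "'v \<Rightarrow> 'a \<Rightarrow> ('v \<times> 'a) list \<Rightarrow> ('v \<times> 'a) list" where
  "join i g us = (if g = \<one>\<^bsub>G i\<^esub> \<or> (i = w \<and> us = []) then us else (i, g) # us)"

definition act :: "'v \<Rightarrow> 'a \<Rightarrow> ('v \<times> 'a) list \<Rightarrow> ('v \<times> 'a) list" where
  "act i g us = join i (g \<otimes>\<^bsub>G i\<^esub> fst (split i us)) (snd (split i us))"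

lemma G_simps [simp]:
  assumes "i \<in> {v, w}"
  shows "\<one>\<^bsub>G i\<^esub> \<in> carrier (G i)" "g \<in> carrier (G i) \<Longrightarrow> \<one>\<^bsub>G i\<^esub> \<otimes>\<^bsub>G i\<^esub> g = g"
    "g \<in> carrier (G i) \<Longrightarrow> g \<otimes>\<^bsub>G i\<^esub> \<one>\<^bsub>G i\<^esub> = g"
    "g \<in> carrier (G i) \<Longrightarrow> h \<in> carrier (G i) \<Longrightarrow> g \<otimes>\<^bsub>G i\<^esub> h \<in> carrier (G i)"
    "g \<in> carrier (G i) \<Longrightarrow> inv\<^bsub>G i\<^esub> g \<in> carrier (G i)"
    "g \<in> carrier (G i) \<Longrightarrow> inv\<^bsub>G i\<^esub> g \<otimes>\<^bsub>G i\<^esub> g = \<one>\<^bsub>G i\<^esub>"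
    "g \<in> carrier (G i) \<Longrightarrow> g \<otimes>\<^bsub>G i\<^esub> inv\<^bsub>G i\<^esub> g = \<one>\<^bsub>G i\<^esub>"
  using grp[OF assms] group.is_monoid[OF grp[OF assms]]
  by (simp_all add: monoid.one_closed monoid.l_one monoid.r_one monoid.m_closed group.l_inv group.r_inv)

definition free :: "'v \<Rightarrow> ('v \<times> 'a) list \<Rightarrow> bool" where
  "free i us \<longleftrightarrow> us = [] \<or> fst (hd us) \<noteq> i"

lemma Nil_cosets [simp]: "[] \<in> cosets"
  by (simp add: cosets_def)

lemma Cons_cosets:
  "(j, h) # us \<in> cosets \<longleftrightarrow> j \<in> {v, w} \<and> h \<in> carrier (G j) \<and> h \<noteq> \<one>\<^bsub>G j\<^esub> \<and> us \<in> cosets \<and> free j us \<and> (us = [] \<longrightarrow> j = v)"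
  by (cases us) (auto simp: cosets_def free_def)

lemma split_cosets:
  assumes "us \<in> cosets" "i \<in> {v, w}"
  shows "fst (split i us) \<in> carrier (G i)" "snd (split i us) \<in> cosets" "free i (snd (split i us))"
    "join i (fst (split i us)) (snd (split i us)) = us"
proof -
  have "fst (split i us) \<in> carrier (G i) \<and> snd (split i us) \<in> cosets \<and> free i (snd (split i us)) \<and>
    join i (fst (split i us)) (snd (split i us)) = us"
  proof (cases us)
    case (Cons p ws)
    then show ?thesis
      using assms vw by (cases p) (auto simp: split_def join_def Cons_cosets free_def)
  qed (use assms in \<open>simp add: split_def join_def free_def\<close>)
  then show "fst (split i us) \<in> carrier (G i)" "snd (split i us) \<in> cosets" "free i (snd (split i us))"
    "join i (fst (split i us)) (snd (split i us)) = us" by blast+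
qed

lemma join_cosets:
  "us \<in> cosets \<Longrightarrow> i \<in> {v, w} \<Longrightarrow> free i us \<Longrightarrow> g \<in> carrier (G i) \<Longrightarrow> join i g us \<in> cosets"
  by (auto simp: join_def Cons_cosets)

lemma split_join:
  "free i us \<Longrightarrow> split i (join i g us) = (if i = w \<and> us = [] then \<one>\<^bsub>G i\<^esub> else g, us)"
  by (cases us) (auto simp: split_def join_def free_def)

lemma act_cosets: "us \<in> cosets \<Longrightarrow> i \<in> {v, w} \<Longrightarrow> g \<in> carrier (G i) \<Longrightarrow> act i g us \<in> cosets"
  unfolding act_def by (intro join_cosets split_cosets G_simps(4))

lemma act_one: "us \<in> cosets \<Longrightarrow> i \<in> {v, w} \<Longrightarrow> act i \<one>\<^bsub>G i\<^esub> us = us"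
  unfolding act_def using split_cosets[of us i] by (simp del: insert_iff)

lemma act_mult:
  assumes "us \<in> cosets" "i \<in> {v, w}" "g \<in> carrier (G i)" "h \<in> carrier (G i)"
  shows "act i (g \<otimes>\<^bsub>G i\<^esub> h) us = act i g (act i h us)"
proof (cases "i = w \<and> snd (split i us) = []")
  case True
  then show ?thesis by (auto simp: act_def join_def split_def)
next
  case False
  have "act i g (act i h us) = join i (g \<otimes>\<^bsub>G i\<^esub> (h \<otimes>\<^bsub>G i\<^esub> fst (split i us))) (snd (split i us))"
    unfolding act_def[of i g] unfolding act_def[of i h]
    using split_join[OF split_cosets(3)[OF assms(1,2)]] False by auto
  also have "g \<otimes>\<^bsub>G i\<^esub> (h \<otimes>\<^bsub>G i\<^esub> fst (split i us)) = g \<otimes>\<^bsub>G i\<^esub> h \<otimes>\<^bsub>G i\<^esub> fst (split i us)"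
    using group.is_monoid[OF grp[OF assms(2)]] split_cosets(1)[OF assms(1,2)] assms(3,4)
    by (simp add: monoid.m_assoc)
  finally show ?thesis by (simp add: act_def)
qed

lemma act_hom:
  assumes i: "i \<in> {v, w}"
  shows "(\<lambda>g. restrict (act i g) cosets) \<in> hom (G i) (BijGroup cosets)"
proof -
  have cl: "restrict (act i g) cosets \<in> Bij cosets" if g: "g \<in> carrier (G i)" for g
  proof -
    have "bij_betw (act i g) cosets cosets"
      by (rule bij_betwI[of _ _ _ "act i (inv\<^bsub>G i\<^esub> g)"])
         (use g i act_cosets act_one act_mult[symmetric] in \<open>auto simp del: insert_iff\<close>)
    then show ?thesis
      using bij_betw_cong[of cosets "restrict (act i g) cosets" "act i g"] by (simp add: Bij_def)
  qed
  show ?thesis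
  proof (rule homI)
    fix g h assume gh: "g \<in> carrier (G i)" "h \<in> carrier (G i)"
    have "restrict (act i (g \<otimes>\<^bsub>G i\<^esub> h)) cosets = compose cosets (restrict (act i g) cosets) (restrict (act i h) cosets)"
      using act_mult[OF _ i gh] act_cosets[OF _ i gh(2)] by (auto simp: compose_def restrict_def fun_eq_iff)
    then show "restrict (act i (g \<otimes>\<^bsub>G i\<^esub> h)) cosets = restrict (act i g) cosets \<otimes>\<^bsub>BijGroup cosets\<^esub> restrict (act i h) cosets"
      using cl gh by (simp add: BijGroup_def)
  qed (use cl in \<open>simp add: BijGroup_def\<close>)
qed

text \<open>The image of a coset in \<open>G v\<close>, which makes sense because the projection to
  \<open>G v\<close> kills \<open>G w\<close>.\<close>

definition v_prod :: "('v \<times> 'a) list \<Rightarrow> 'a" where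
  "v_prod us = foldr (\<lambda>(i, g) x. if i = v then g \<otimes>\<^bsub>G v\<^esub> x else x) us \<one>\<^bsub>G v\<^esub>"

lemma v_prod_simps [simp]:
  "v_prod [] = \<one>\<^bsub>G v\<^esub>" "v_prod ((i, g) # us) = (if i = v then g \<otimes>\<^bsub>G v\<^esub> v_prod us else v_prod us)"
  by (simp_all add: v_prod_def)

lemma v_prod_closed: "us \<in> cosets \<Longrightarrow> v_prod us \<in> carrier (G v)"
proof (induction us)
  case (Cons p us)
  then show ?case by (cases p) (auto simp: Cons_cosets)
qed simp

lemma v_prod_join:
  "us \<in> cosets \<Longrightarrow> i \<in> {v, w} \<Longrightarrow> g \<in> carrier (G i) \<Longrightarrow>
    v_prod (join i g us) = (if i = v then g \<otimes>\<^bsub>G v\<^esub> v_prod us else v_prod us)"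
  using v_prod_closed[of us] vw by (auto simp: join_def)

lemma v_prod_act:
  assumes "us \<in> cosets" "i \<in> {v, w}" "g \<in> carrier (G i)"
  shows "v_prod (act i g us) = (if i = v then g \<otimes>\<^bsub>G v\<^esub> v_prod us else v_prod us)"
proof -
  note s = split_cosets[OF assms(1,2)]
  have "v_prod us = (if i = v then fst (split i us) \<otimes>\<^bsub>G v\<^esub> v_prod (snd (split i us)) else v_prod (snd (split i us)))"
    using v_prod_join[OF s(2) assms(2) s(1)] unfolding s(4) .
  moreover have "v_prod (act i g us) = (if i = v then g \<otimes>\<^bsub>G v\<^esub> fst (split i us) \<otimes>\<^bsub>G v\<^esub> v_prod (snd (split i us))
      else v_prod (snd (split i us)))"
    unfolding act_def using v_prod_join[OF s(2) assms(2), of "g \<otimes>\<^bsub>G i\<^esub> fst (split i us)"] s(1) assms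
    by auto
  moreover have "monoid (G v)" using group.is_monoid[OF grp] by simp
  ultimately show ?thesis
    using s(1) assms v_prod_closed[OF s(2)] by (auto simp: monoid.m_assoc)
qed

text \<open>\<open>b\<close> is either put in front of the word or multiplied to its first letter;
  only absorption by the empty word leaves a word unchanged.\<close>

lemma act_w_fixed:
  assumes "us \<in> cosets" "b \<in> carrier (G w)" "b \<noteq> \<one>\<^bsub>G w\<^esub>" "act w b us = us"
  shows "us = []"
proof (rule ccontr)
  assume "us \<noteq> []"
  then obtain j h ws where us: "us = (j, h) # ws" by (metis neq_Nil_conv surj_pair)
  show False
  proof (cases "j = w")
    case True
    then have "ws \<noteq> []" "h \<in> carrier (G w)" using assms(1) vw by (auto simp: us Cons_cosets)
    moreover have "b \<otimes>\<^bsub>G w\<^esub> h = h"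
      using assms(4) \<open>ws \<noteq> []\<close> True by (auto simp: act_def split_def join_def us split: if_splits)
    ultimately show False
      using group.r_cancel_one[OF grp, of w h b] assms(2,3) by simp
  qed (use assms in \<open>auto simp: act_def split_def join_def us split: if_splits\<close>)
qed

end

section \<open>Centralisers and vertex groups in a complete graph product\<close>

context simple_graph_of_groups
begin

lemma ex_projection:
  assumes v: "v \<in> V"
  obtains p where "p \<in> hom W (G v)"
    "\<And>u g. u \<in> V \<Longrightarrow> g \<in> carrier (G u) \<Longrightarrow> p (gen u g) = (if u = v then g else \<one>\<^bsub>G v\<^esub>)"
proof -
  interpret Gv: group "G v" by (rule group_G[OF v])
  let ?f = "\<lambda>u g. if u = v then g else \<one>\<^bsub>G v\<^esub>"
  have "?f u \<in> hom (G u) (G v)" for u by (auto simp: hom_def)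
  moreover have "?f u g \<otimes>\<^bsub>G v\<^esub> ?f u' h = ?f u' h \<otimes>\<^bsub>G v\<^esub> ?f u g"
    if "{u, u'} \<in> E" "g \<in> carrier (G u)" "h \<in> carrier (G u')" for u u' g h
    using edgeD[OF that(1)] that(2,3) by auto
  ultimately show ?thesis
    using universal[of "G v" ?f] that by (metis Gv.is_group)
qed

text \<open>Otherwise a central element of \<open>G v\<close> commutes with every generator, and the
  projection to \<open>G v\<close> shows that it stays non-trivial in \<open>W\<close>.\<close>

lemma nonadjacent_vertex:
  assumes v: "v \<in> V" and "center W = {\<one>\<^bsub>W\<^esub>}" and "center (G v) \<noteq> {\<one>\<^bsub>G v\<^esub>}"
  shows "\<exists>w \<in> V. w \<notin> star V E v"
proof (rule ccontr)
  assume all: "\<not> ?thesis"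
  interpret Gv: group "G v" by (rule group_G[OF v])
  have "\<one>\<^bsub>G v\<^esub> \<in> center (G v)" by (simp add: center_def)
  then obtain z where z: "z \<in> center (G v)" "z \<noteq> \<one>\<^bsub>G v\<^esub>" using assms(3) by blast
  have zc: "z \<in> carrier (G v)" "\<And>g. g \<in> carrier (G v) \<Longrightarrow> z \<otimes>\<^bsub>G v\<^esub> g = g \<otimes>\<^bsub>G v\<^esub> z"
    using z by (auto simp: center_def)
  let ?x = "gen v z"
  have x: "?x \<in> carrier W" using zc v by simp
  have gens: "?x \<otimes>\<^bsub>W\<^esub> gen u g = gen u g \<otimes>\<^bsub>W\<^esub> ?x" if u: "u \<in> V" "g \<in> carrier (G u)" for u g
  proof (cases "u = v")
    case True
    then show ?thesis
      using hom_mult[OF gen_hom[OF v] zc(1), of g] hom_mult[OF gen_hom[OF v] _ zc(1), of g] zc(2) u by simp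
  next
    case False
    then have "{v, u} \<in> E" using all u by (auto simp: star_def)
    then show ?thesis using gen_commute[OF v u(1) _ zc(1) u(2)] by simp
  qed
  have "?x \<otimes>\<^bsub>W\<^esub> y = y \<otimes>\<^bsub>W\<^esub> ?x" if "y \<in> carrier W" for y
    using that
  proof (induction rule: W_induct)
    case (mult u g y)
    then show ?case using gens[of u g] x by (metis W.m_assoc gen_closed)
  qed (use x in simp)
  then have "?x \<in> center W" using x by (simp add: center_def)
  then have "?x = \<one>\<^bsub>W\<^esub>" using assms(2) by simp
  moreover obtain p where "p \<in> hom W (G v)" "p ?x = z"
    using ex_projection[OF v] zc(1) v by metis
  ultimately show False using z(2) hom_one[OF _ W.is_group Gv.is_group] by metis
qed

text \<open>As \<open>x\<close> commutes with \<open>gen w b\<close>, it permutes the fixed points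
  of \<open>gen w b\<close> among the coset words. The empty word is the only one, so
  \<open>x\<close> fixes it, and \<open>v_prod\<close> turns this into triviality of
  \<open>p x\<close>.\<close>

lemma centralizer_projection:
  assumes v: "v \<in> V" and w: "w \<in> V" "w \<notin> star V E v"
    and b: "b \<in> carrier (G w)" "b \<noteq> \<one>\<^bsub>G w\<^esub>"
    and x: "x \<in> carrier W" "x \<otimes>\<^bsub>W\<^esub> gen w b = gen w b \<otimes>\<^bsub>W\<^esub> x"
    and p: "p \<in> hom W (G v)" "\<And>u g. u \<in> V \<Longrightarrow> g \<in> carrier (G u) \<Longrightarrow> p (gen u g) = (if u = v then g else \<one>\<^bsub>G v\<^esub>)"
  shows "p x = \<one>\<^bsub>G v\<^esub>"
proof -
  have nE: "v \<noteq> w" "{v, w} \<notin> E" using w by (auto simp: star_def)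
  interpret Gv: group "G v" by (rule group_G[OF v])
  interpret coset_words G v w by (rule coset_words.intro) (use v w nE group_G in auto)
  interpret B: group "BijGroup cosets" by (rule group_BijGroup)
  let ?f = "\<lambda>u g. if u \<in> {v, w} then restrict (act u g) cosets else \<one>\<^bsub>BijGroup cosets\<^esub>"
  have f: "?f u \<in> hom (G u) (BijGroup cosets)" if "u \<in> V" for u
  proof (cases "u \<in> {v, w}")
    case True
    then show ?thesis using act_hom[OF True] by simp
  qed (auto simp: hom_def)
  have fc: "?f u g \<in> carrier (BijGroup cosets)" if "u \<in> V" "g \<in> carrier (G u)" for u g
    using hom_in_carrier[OF f] that by blast
  have "?f u g \<otimes>\<^bsub>BijGroup cosets\<^esub> ?f u' h = ?f u' h \<otimes>\<^bsub>BijGroup cosets\<^esub> ?f u g"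
    if "u \<in> V" "u' \<in> V" "{u, u'} \<in> E" "g \<in> carrier (G u)" "h \<in> carrier (G u')" for u u' g h
  proof -
    have "u \<notin> {v, w} \<or> u' \<notin> {v, w}" using that(3) nE edgeD[OF that(3)] by (auto simp: insert_commute)
    then show ?thesis using fc[OF that(1,4)] fc[OF that(2,5)] by (elim disjE) simp_all
  qed
  then obtain L where L: "L \<in> hom W (BijGroup cosets)"
    "\<And>u g. u \<in> V \<Longrightarrow> g \<in> carrier (G u) \<Longrightarrow> L (gen u g) = ?f u g"
    using universal[OF B.is_group f] by blast
  have LB: "L y \<in> Bij cosets" if "y \<in> carrier W" for y
    using hom_in_carrier[OF L(1) that] by (simp add: BijGroup_def)
  have LX: "L y us \<in> cosets" if "y \<in> carrier W" "us \<in> cosets" for y us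
    using LB[OF that(1)] that(2) by (auto simp: Bij_def bij_betw_def)
  have L_mult: "L (y \<otimes>\<^bsub>W\<^esub> z) us = L y (L z us)" if "y \<in> carrier W" "z \<in> carrier W" "us \<in> cosets" for y z us
    using hom_mult[OF L(1) that(1,2)] LB that by (simp add: BijGroup_def compose_def)
  have L_gen: "L (gen u g) us = (if u \<in> {v, w} then act u g us else us)"
    if "u \<in> V" "g \<in> carrier (G u)" "us \<in> cosets" for u g us
    using L(2)[OF that(1,2)] that(3) by (simp add: BijGroup_def)
  have pc: "p y \<in> carrier (G v)" if "y \<in> carrier W" for y using hom_in_carrier[OF p(1) that] .
  have v_prod_L: "v_prod (L y us) = p y \<otimes>\<^bsub>G v\<^esub> v_prod us" if "y \<in> carrier W" "us \<in> cosets" for y us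
    using that(1)
  proof (induction rule: W_induct)
    case one
    have "L \<one>\<^bsub>W\<^esub> us = us"
      using hom_one[OF L(1) W.is_group B.is_group] that(2) by (simp add: BijGroup_def)
    then show ?case
      using hom_one[OF p(1) W.is_group Gv.is_group] v_prod_closed[OF that(2)] by simp
  next
    case (mult u g y)
    have "v_prod (L (gen u g) (L y us)) = p (gen u g) \<otimes>\<^bsub>G v\<^esub> v_prod (L y us)"
      using L_gen[OF mult.hyps(1,2) LX[OF mult.hyps(3) that(2)]]
        v_prod_act[OF LX[OF mult.hyps(3) that(2)] _ mult.hyps(2)]
        v_prod_closed[OF LX[OF mult.hyps(3) that(2)]] p(2)[OF mult.hyps(1,2)] by auto
    then show ?case
      using mult L_mult[OF gen_closed[OF mult.hyps(1,2)] mult.hyps(3) that(2)]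
        hom_mult[OF p(1) gen_closed[OF mult.hyps(1,2)] mult.hyps(3)] pc v_prod_closed[OF that(2)]
      by (simp add: Gv.m_assoc)
  qed
  have bc: "gen w b \<in> carrier W" using w b by simp
  have "act w b [] = []" by (simp add: act_def split_def join_def)
  then have "L (gen w b) [] = []" using L_gen[OF w(1) b(1) Nil_cosets] by simp
  then have "L (gen w b) (L x []) = L x []"
    using L_mult[OF x(1) bc Nil_cosets] L_mult[OF bc x(1) Nil_cosets] x(2) by simp
  then have "act w b (L x []) = L x []" using L_gen[OF w(1) b(1) LX[OF x(1) Nil_cosets]] by simp
  then have "L x [] = []" by (rule act_w_fixed[OF LX[OF x(1) Nil_cosets] b])
  then show ?thesis using v_prod_L[OF x(1) Nil_cosets] pc[OF x(1)] by simp
qed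

lemma complete_vertex_group_rigid:
  assumes complete: "complete_group W"
    and v: "v \<in> V" and w: "w \<in> V" "w \<notin> star V E v" "\<not> trivial_group (G w)"
    and f: "f \<in> hom (G v) (G v)" "f' \<in> hom (G v) (G v)"
    and inverse: "\<And>k. k \<in> carrier (G v) \<Longrightarrow> f (f' k) = k" "\<And>k. k \<in> carrier (G v) \<Longrightarrow> f' (f k) = k"
    and k: "k \<in> carrier (G v)"
  shows "f k = k"
proof -
  have ex: "\<exists>F \<in> hom W W. \<forall>u \<in> V. \<forall>g \<in> carrier (G u). F (gen u g) = gen u (if u = v then h g else g)"
    if h: "h \<in> hom (G v) (G v)" for h
  proof -
    let ?f = "\<lambda>u g. gen u (if u = v then h g else g)"
    have cl: "(if u = v then h g else g) \<in> carrier (G u)" if "g \<in> carrier (G u)" for u g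
      using that hom_in_carrier[OF h] by auto
    have homs: "?f u \<in> hom (G u) W" if "u \<in> V" for u
    proof (cases "u = v")
      case True
      then show ?thesis using Group.hom_compose[OF h gen_hom[OF v]] by (simp add: comp_def)
    qed (use gen_hom[OF that] in simp)
    have comms: "?f u g \<otimes>\<^bsub>W\<^esub> ?f u' g' = ?f u' g' \<otimes>\<^bsub>W\<^esub> ?f u g"
      if "u \<in> V" "u' \<in> V" "{u, u'} \<in> E" "g \<in> carrier (G u)" "g' \<in> carrier (G u')" for u u' g g'
      by (rule gen_commute[OF that(1-3) cl[OF that(4)] cl[OF that(5)]])
    show ?thesis
    proof (rule universal[OF W.is_group homs comms])
      fix F assume "F \<in> hom W W" "\<And>u g. u \<in> V \<Longrightarrow> g \<in> carrier (G u) \<Longrightarrow> F (gen u g) = ?f u g"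
      then show ?thesis by (intro bexI[of _ F]) auto
    qed
  qed
  obtain F where F: "F \<in> hom W W"
    "\<And>u g. u \<in> V \<Longrightarrow> g \<in> carrier (G u) \<Longrightarrow> F (gen u g) = gen u (if u = v then f g else g)"
    using ex[OF f(1)] by blast
  obtain F' where F': "F' \<in> hom W W"
    "\<And>u g. u \<in> V \<Longrightarrow> g \<in> carrier (G u) \<Longrightarrow> F' (gen u g) = gen u (if u = v then f' g else g)"
    using ex[OF f(2)] by blast
  have fc: "f g \<in> carrier (G v)" "f' g \<in> carrier (G v)" if "g \<in> carrier (G v)" for g
    using hom_in_carrier[OF f(1) that] hom_in_carrier[OF f(2) that] by auto
  have id: "(\<lambda>x. x) \<in> hom W W" by (simp add: hom_def)
  have gens: "(F \<circ> F') (gen u g) = gen u g" "(F' \<circ> F) (gen u g) = gen u g" if "u \<in> V" "g \<in> carrier (G u)" for u g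
    using that fc F(2)[of u] F'(2)[of u] inverse by (cases "u = v"; simp)+
  have FF': "(F \<circ> F') x = x" if "x \<in> carrier W" for x
    by (rule hom_eqI[OF W.is_group Group.hom_compose[OF F'(1) F(1)] id _ that]) (rule gens(1))
  have F'F: "(F' \<circ> F) x = x" if "x \<in> carrier W" for x
    by (rule hom_eqI[OF W.is_group Group.hom_compose[OF F(1) F'(1)] id _ that]) (rule gens(2))
  obtain g where g: "g \<in> carrier W" "\<And>x. x \<in> carrier W \<Longrightarrow> F x = g \<otimes>\<^bsub>W\<^esub> x \<otimes>\<^bsub>W\<^esub> inv\<^bsub>W\<^esub> g"
    by (rule W.complete_inner[OF complete F(1) F'(1) FF'[unfolded comp_def] F'F[unfolded comp_def]]) blast+
  interpret Gv: group "G v" by (rule group_G[OF v])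
  interpret Gw: group "G w" by (rule group_G[OF w(1)])
  obtain b where b: "b \<in> carrier (G w)" "b \<noteq> \<one>\<^bsub>G w\<^esub>"
    using w(3) Gw.trivial_group_subset by blast
  obtain p where p: "p \<in> hom W (G v)"
    "\<And>u g. u \<in> V \<Longrightarrow> g \<in> carrier (G u) \<Longrightarrow> p (gen u g) = (if u = v then g else \<one>\<^bsub>G v\<^esub>)"
    by (rule ex_projection[OF v]) blast
  have bc: "gen w b \<in> carrier W" using w b by simp
  have "w \<noteq> v" using w by (auto simp: star_def)
  then have "gen w b = g \<otimes>\<^bsub>W\<^esub> gen w b \<otimes>\<^bsub>W\<^esub> inv\<^bsub>W\<^esub> g" using g(2)[OF bc] F(2)[OF w(1) b(1)] by simp
  then have "gen w b \<otimes>\<^bsub>W\<^esub> g = g \<otimes>\<^bsub>W\<^esub> gen w b \<otimes>\<^bsub>W\<^esub> inv\<^bsub>W\<^esub> g \<otimes>\<^bsub>W\<^esub> g" by simp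
  then have "g \<otimes>\<^bsub>W\<^esub> gen w b = gen w b \<otimes>\<^bsub>W\<^esub> g" using g bc by (simp add: W.m_assoc)
  then have pg: "p g = \<one>\<^bsub>G v\<^esub>" by (rule centralizer_projection[OF v w(1,2) b g(1) _ p])
  have kc: "gen v k \<in> carrier W" using v k by simp
  \<comment> \<open>Under \<open>p\<close> the conjugation by \<open>g\<close> disappears because
    \<open>p g\<close> is trivial, while \<open>F\<close> becomes \<open>f\<close>.\<close>
  have "p (F (gen v k)) = f k" using F(2)[OF v k] p(2)[OF v fc(1)[OF k]] by simp
  moreover have "p (g \<otimes>\<^bsub>W\<^esub> gen v k \<otimes>\<^bsub>W\<^esub> inv\<^bsub>W\<^esub> g) = k"
  proof -
    interpret p: group_hom W "G v" p
      using p(1) by (simp add: group_hom_def group_hom_axioms_def Gv.is_group)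
    show ?thesis using g(1) kc k v p(2)[OF v k] pg by simp
  qed
  ultimately show ?thesis using g(2)[OF kc] by simp
qed

end

text \<open>The record has no extension fields, which is the type over which
  \<open>directly_indecomposable\<close> lets the factors range.\<close>

lemma subgroup_group:
  assumes "group G" "subgroup S G"
  shows "group \<lparr>carrier = S, monoid.mult = monoid.mult G, one = \<one>\<^bsub>G\<^esub>\<rparr>"
proof -
  interpret G: group G by fact
  interpret S: subgroup S G by fact
  show ?thesis
    by (rule groupI) (auto simp: G.m_assoc intro!: bexI[of _ "inv\<^bsub>G\<^esub> _"])
qed

text \<open>Trivial conjugations make the group abelian, and trivial inversion gives exponent 2. In
  such a group the subgroup generated by any \<open>t\<close> has a direct complement, which
  indecomposability makes trivial.\<close>

lemma (in group) rigid_indecomposable_Z2: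
  assumes rigid: "\<And>f f' x. f \<in> hom G G \<Longrightarrow> f' \<in> hom G G \<Longrightarrow> (\<And>x. x \<in> carrier G \<Longrightarrow> f (f' x) = x) \<Longrightarrow>
      (\<And>x. x \<in> carrier G \<Longrightarrow> f' (f x) = x) \<Longrightarrow> x \<in> carrier G \<Longrightarrow> f x = x"
    and "\<not> trivial_group G" and indec: "directly_indecomposable G"
  shows "G \<cong> integer_mod_group 2"
proof -
  have comm: "x \<otimes> y = y \<otimes> x" if "x \<in> carrier G" "y \<in> carrier G" for x y
  proof -
    have c: "inv x \<otimes> (x \<otimes> z) = z" "x \<otimes> (inv x \<otimes> z) = z" if "z \<in> carrier G" for z
      using \<open>x \<in> carrier G\<close> that by (simp_all flip: m_assoc)
    have "x \<otimes> y \<otimes> inv x = y"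
      by (rule rigid[of "\<lambda>y. x \<otimes> y \<otimes> inv x" "\<lambda>y. inv x \<otimes> y \<otimes> x"])
         (use that c in \<open>auto simp: hom_def m_assoc\<close>)
    then have "x \<otimes> y \<otimes> inv x \<otimes> x = y \<otimes> x" by simp
    then show ?thesis using that by (simp add: m_assoc)
  qed
  have sq: "x \<otimes> x = \<one>" if "x \<in> carrier G" for x
  proof -
    have "m_inv G \<in> hom G G" using comm by (auto simp: hom_def inv_mult_group)
    then have "inv x = x" using rigid[of "m_inv G" "m_inv G" x] that by simp
    then show ?thesis using r_inv[OF that] by simp
  qed
  obtain t where t: "t \<in> carrier G" "t \<noteq> \<one>" using assms(2) trivial_group_subset by blast
  \<comment> \<open>A maximal subgroup avoiding \<open>t\<close> is a complement of the subgroup generated by \<open>t\<close>.\<close>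
  let ?A = "{K. subgroup K G \<and> t \<notin> K}"
  have "\<exists>M \<in> ?A. \<forall>K \<in> ?A. M \<subseteq> K \<longrightarrow> K = M"
  proof (rule subset_Zorn_nonempty)
    show "?A \<noteq> {}" using triv_subgroup t by blast
    fix C assume C: "C \<noteq> {}" "subset.chain ?A C"
    then have CA: "C \<subseteq> ?A" and ch: "\<And>K L. K \<in> C \<Longrightarrow> L \<in> C \<Longrightarrow> K \<subseteq> L \<or> L \<subseteq> K"
      by (auto simp: subset_chain_def)
    have "subgroup (\<Union>C) G"
    proof (rule subgroupI)
      show "\<Union>C \<subseteq> carrier G" using CA subgroup.subset by blast
      obtain K where "K \<in> C" using C(1) by blast
      then show "\<Union>C \<noteq> {}" using CA subgroup.one_closed[of K G] by blast
      show "inv x \<in> \<Union>C" if x: "x \<in> \<Union>C" for x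
      proof -
        obtain K where K: "K \<in> C" "x \<in> K" using x by blast
        then have "inv x \<in> K" using CA subgroup.m_inv_closed[of K G x] by blast
        then show ?thesis using K by blast
      qed
      fix x y assume "x \<in> \<Union>C" "y \<in> \<Union>C"
      then obtain K where K: "K \<in> C" "x \<in> K" "y \<in> K" using ch by (metis UnionE subsetD)
      then have "x \<otimes> y \<in> K" using CA subgroup.m_closed[of K G x y] by blast
      then show "x \<otimes> y \<in> \<Union>C" using K by blast
    qed
    then show "\<Union>C \<in> ?A" using CA by blast
  qed
  then obtain M where M: "subgroup M G" "t \<notin> M" and max: "\<And>K. subgroup K G \<Longrightarrow> t \<notin> K \<Longrightarrow> M \<subseteq> K \<Longrightarrow> K = M"
    by blast
  interpret M: subgroup M G by fact
  have swap: "x \<otimes> (y \<otimes> z) = y \<otimes> (x \<otimes> z)" if "x \<in> carrier G" "y \<in> carrier G" "z \<in> carrier G" for x y z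
    using comm that by (metis m_assoc)
  have cancel: "x \<otimes> (x \<otimes> z) = z" if "x \<in> carrier G" "z \<in> carrier G" for x z
    using sq that by (simp flip: m_assoc)
  have dec: "x \<in> M \<or> t \<otimes> x \<in> M" if x: "x \<in> carrier G" for x
  proof (rule ccontr)
    assume not: "\<not> ?thesis"
    \<comment> \<open>This subgroup would be larger than \<open>M\<close> and still avoid
      \<open>t\<close>, since \<open>t = x \<otimes> m\<close> would give
      \<open>t \<otimes> x = m\<close>.\<close>
    let ?K = "M \<union> (\<lambda>m. x \<otimes> m) ` M"
    have "subgroup ?K G"
    proof (rule subgroupI)
      show "?K \<subseteq> carrier G" using x by auto
      show "?K \<noteq> {}" using M.one_closed by blast
      have "inv y = y" if "y \<in> carrier G" for y using inv_equality[OF sq[OF that] that that] .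
      then show "inv y \<in> ?K" if "y \<in> ?K" for y using that x by auto
      fix y z assume "y \<in> ?K" "z \<in> ?K"
      then show "y \<otimes> z \<in> ?K"
        using x by (elim UnE imageE) (auto simp: m_assoc swap[of _ x] cancel)
    qed
    moreover have "t \<notin> ?K"
    proof
      assume "t \<in> ?K"
      then obtain m where m: "m \<in> M" "t = x \<otimes> m" using M(2) by blast
      then have "t \<otimes> x = m" using x comm[of x m] by (simp add: m_assoc sq)
      then show False using m not by simp
    qed
    moreover have "x \<in> ?K" using x M.one_closed by (intro UnI2 image_eqI[of _ _ \<one>]) auto
    ultimately show False using max[of ?K] not by blast
  qed
  define K1 where "K1 = \<lparr>carrier = {\<one>, t}, monoid.mult = monoid.mult G, one = \<one>\<rparr>"
  define K2 where "K2 = \<lparr>carrier = M, monoid.mult = monoid.mult G, one = \<one>\<rparr>"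
  have "inv t = t" using inv_equality[OF sq[OF t(1)] t(1) t(1)] .
  then have "subgroup {\<one>, t} G" using t by (intro subgroupI) (auto simp: sq)
  then have g: "group K1" "group K2"
    unfolding K1_def K2_def using subgroup_group[OF is_group] M by auto
  have "(\<lambda>(x, y). x \<otimes> y) \<in> iso (K1 \<times>\<times> K2) G"
  proof (rule isoI)
    show "(\<lambda>(x, y). x \<otimes> y) \<in> hom (K1 \<times>\<times> K2) G"
      using t by (auto simp: hom_def K1_def K2_def m_assoc swap sq cancel)
    have "inj_on (\<lambda>(x, y). x \<otimes> y) ({\<one>, t} \<times> M)"
    proof -
      have ne: "m' \<noteq> t \<otimes> m" if "m \<in> M" "m' \<in> M" for m m'
      proof
        assume "m' = t \<otimes> m"
        then have "m' \<otimes> m = t" using that t by (simp add: m_assoc sq)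
        then show False using that M by (metis M.m_closed)
      qed
      then show ?thesis using t ne[symmetric] by (auto simp: inj_on_def)
    qed
    moreover have "(\<lambda>(x, y). x \<otimes> y) ` ({\<one>, t} \<times> M) = carrier G"
    proof
      show "carrier G \<subseteq> (\<lambda>(x, y). x \<otimes> y) ` ({\<one>, t} \<times> M)"
      proof
        fix x assume x: "x \<in> carrier G"
        from dec[OF x] show "x \<in> (\<lambda>(x, y). x \<otimes> y) ` ({\<one>, t} \<times> M)"
        proof
          assume "x \<in> M"
          then show ?thesis using x by (intro image_eqI[of _ _ "(\<one>, x)"]) auto
        next
          assume "t \<otimes> x \<in> M"
          then show ?thesis using x t by (intro image_eqI[of _ _ "(t, t \<otimes> x)"]) (auto simp: cancel)
        qed
      qed
    qed (use t in auto)
    ultimately show "bij_betw (\<lambda>(x, y). x \<otimes> y) (carrier (K1 \<times>\<times> K2)) (carrier G)"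
      by (simp add: bij_betw_def K1_def K2_def)
  qed
  then have "G \<cong> K1 \<times>\<times> K2"
    using group.iso_sym[OF DirProd_group[OF g]] by (auto simp: is_iso_def)
  moreover have "\<not> trivial_group K1" using t by (auto simp: trivial_group_def K1_def)
  ultimately have "trivial_group K2" using indec g by (auto simp: directly_indecomposable_def)
  then have "M = {\<one>}" by (simp add: trivial_group_def K2_def)
  have "carrier G \<subseteq> {\<one>, t}"
  proof
    fix x assume x: "x \<in> carrier G"
    then have "x = \<one> \<or> t \<otimes> x = \<one>" using dec \<open>M = {\<one>}\<close> by auto
    then show "x \<in> {\<one>, t}" using cancel[OF t(1) x] t(1) by auto
  qed
  then have carrier: "carrier G = {\<one>, t}" using t by auto
  have "(\<lambda>x. if x = \<one> then 0 else 1) \<in> iso G (integer_mod_group 2)"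
  proof (rule isoI)
    show "(\<lambda>x. if x = \<one> then 0 else 1) \<in> hom G (integer_mod_group 2)"
      using t sq by (auto simp: hom_def carrier carrier_integer_mod_group)
    have "{0..<2::int} = {0, 1}" by auto
    then show "bij_betw (\<lambda>x. if x = \<one> then 0 else 1) (carrier G) (carrier (integer_mod_group 2))"
      using t by (auto simp: bij_betw_def carrier carrier_integer_mod_group)
  qed
  then show ?thesis by (rule is_isoI)
qed

theorem propositionA:
  fixes V :: "'v set" and E :: "'v set set" and G :: "'v \<Rightarrow> ('a, 'b) monoid_scheme"
  assumes "finite_simple_graph V E"
    and "V \<noteq> {}"
    and "\<And>v. v \<in> V \<Longrightarrow> group (G v)"
    and "\<And>v. v \<in> V \<Longrightarrow> \<not> trivial_group (G v)"
    and "\<And>v. v \<in> V \<Longrightarrow> directly_indecomposable (G v)"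
    and "\<And>v. v \<in> V \<Longrightarrow> center (G v) \<noteq> {\<one>\<^bsub>G v\<^esub>}"
  shows "complete_group (graph_product V E G) \<longleftrightarrow>
      (\<forall>v \<in> V. G v \<cong> integer_mod_group 2) \<and>
      \<not> has_separating_star V E \<and>
      asymmetric_graph V E \<and>
      (\<forall>v \<in> V. \<forall>w \<in> V. v \<noteq> w \<longrightarrow> \<not> star V E v \<subseteq> star V E w) \<and>
      induced_connected E V \<and>
      card V \<ge> 7"
proof
  interpret simple_graph_of_groups V G E
    by (intro simple_graph_of_groups.intro graph_of_groups.intro group_family.intro
        simple_graph_of_groups_axioms.intro assms(1,3))
  assume completeness: "complete_group W"
  then have center: "center W = {\<one>\<^bsub>W\<^esub>}" by (simp add: complete_group_def)
  have nonadjacent: "\<exists>w \<in> V. w \<notin> star V E v" if "v \<in> V" for v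
    by (rule nonadjacent_vertex[OF that center assms(6)[OF that]])
  have Z2: "G v \<cong> integer_mod_group 2" if v: "v \<in> V" for v
  proof -
    obtain w where w: "w \<in> V" "w \<notin> star V E v" using nonadjacent[OF v] by blast
    show ?thesis
      by (rule group.rigid_indecomposable_Z2[OF assms(3)[OF v] _ assms(4)[OF v] assms(5)[OF v]])
        (rule complete_vertex_group_rigid[OF completeness v w assms(4)[OF w(1)]])
  qed
  then interpret racg V G E by unfold_locales
  have "asymmetric_graph V E" "\<not> has_separating_star V E"
    using complete_asymmetric[OF completeness] complete_no_separating_star[OF completeness] by auto
  moreover have anti: "\<not> star V E v \<subseteq> star V E w" if "v \<in> V" "w \<in> V" "v \<noteq> w" for v w
    by (rule complete_not_star_subset[OF completeness that])
  moreover have "induced_connected E V" "card V \<ge> 7"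
    using asymmetric_connected_card[OF assms(1,2) nonadjacent anti] calculation(1,2) by auto
  ultimately show "(\<forall>v \<in> V. G v \<cong> integer_mod_group 2) \<and> \<not> has_separating_star V E \<and>
      asymmetric_graph V E \<and> (\<forall>v \<in> V. \<forall>w \<in> V. v \<noteq> w \<longrightarrow> \<not> star V E v \<subseteq> star V E w) \<and>
      induced_connected E V \<and> card V \<ge> 7"
    using Z2 by blast
next
  assume *: "(\<forall>v \<in> V. G v \<cong> integer_mod_group 2) \<and> \<not> has_separating_star V E \<and>
      asymmetric_graph V E \<and> (\<forall>v \<in> V. \<forall>w \<in> V. v \<noteq> w \<longrightarrow> \<not> star V E v \<subseteq> star V E w) \<and>
      induced_connected E V \<and> card V \<ge> 7"
  then have Z2: "G v \<cong> integer_mod_group 2" if "v \<in> V" for v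
    using that by blast
  interpret racg V G E
    by (intro racg.intro simple_graph_of_groups.intro graph_of_groups.intro group_family.intro
        simple_graph_of_groups_axioms.intro racg_axioms.intro assms(1,3) Z2)
  \<comment> \<open>A star equal to \<open>V\<close> would contain the star of every other vertex,
    and there is another one because \<open>V\<close> has at least seven.\<close>
  have "\<exists>w \<in> V. w \<notin> star V E v" if v: "v \<in> V" for v
  proof (rule ccontr)
    assume "\<not> ?thesis"
    then have "V \<subseteq> star V E v" by blast
    moreover have "V \<noteq> {v}" using * by auto
    then obtain u where "u \<in> V" "u \<noteq> v" using v by blast
    moreover have "star V E u \<subseteq> V" using \<open>u \<in> V\<close> by (auto simp: star_def)
    ultimately show False using * v by (meson subset_trans)
  qed
  then show "complete_group W"
    using racg_complete assms(2) * by blast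
qed

end
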